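(* Let $m,n\ge 2$ be integers with $\frac1m+\frac1n<\frac12$ (a hyperbolic type $\{m,n\}$). Then there exists a chiral map of type $\{m,n\}$ whose (orientation-preserving) automorphism group is an alternating group $A_k$ for some degree $k$.
   Context: A map is a cellular embedding of a connected graph in a closed surface. An orientably-regular map is a map on an orientable surface whose group of orientation-preserving automorphisms acts transitively on arcs (directed edges). Such a map is determined by its orientation-preserving automorphism group $G=\langle r,s\rangle$, where $r$ and $s$ are the one-step rotations about a face and an incident vertex, so that $rs$ is an involution; it is denoted $\mathcal{M}(G:r,s)$ and has type $\{m,n\}$ when $r$ has order $m$ and $s$ has order $n$. The map is reflexible if there is a group automorphism of $G$ sending $r\mapsto r^{-1}$ and $s\mapsto s^{-1}$, and chiral otherwise. "Automorphism group" of the chiral map means $G$. *)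

theory Defs
  imports "HOL-Algebra.Algebra"
begin

text \<open>
  A cellular embedding of a connected graph in a closed oriented surface is encoded by its rotation
  system (Heffter--Edmonds): the finite set of darts (directed edges), the permutation \<open>turn\<close>
  taking a dart to the next one, in the positive sense, around its initial vertex, and the
  permutation \<open>flip\<close> reversing a dart.  Loops and multiple edges are permitted.
\<close>

record 'a oriented_map =
  darts :: "'a set"
  turn :: "'a \<Rightarrow> 'a"
  flip :: "'a \<Rightarrow> 'a"

definition dart_step :: "('a, 'b) oriented_map_scheme \<Rightarrow> ('a \<times> 'a) set" where
  "dart_step M = {(d, turn M d) |d. d \<in> darts M} \<union> {(d, flip M d) |d. d \<in> darts M}"

text \<open>
  Connectedness of the graph is transitivity of the group generated by \<open>turn\<close> and \<open>flip\<close>; as the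
  set of darts is finite, forward steps suffice.
\<close>

definition is_oriented_map :: "('a, 'b) oriented_map_scheme \<Rightarrow> bool" where
  "is_oriented_map M \<longleftrightarrow>
     finite (darts M) \<and> darts M \<noteq> {} \<and>
     turn M permutes darts M \<and> flip M permutes darts M \<and>
     (\<forall>d\<in>darts M. flip M d \<noteq> d \<and> flip M (flip M d) = d) \<and>
     (\<forall>d\<in>darts M. \<forall>e\<in>darts M. (d, e) \<in> (dart_step M)\<^sup>*)"

text \<open>
  The next dart along the boundary of the face to the left of \<open>d\<close>: at the end of \<open>d\<close> take the
  dart preceding the reverse of \<open>d\<close>.  The cycles of this permutation are the faces.
\<close>

definition face_next :: "('a, 'b) oriented_map_scheme \<Rightarrow> 'a \<Rightarrow> 'a" where
  "face_next M d = inv_into UNIV (turn M) (flip M d)"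

definition rotation_group :: "('a, 'b) oriented_map_scheme \<Rightarrow> ('a \<Rightarrow> 'a) monoid" where
  "rotation_group M =
     \<lparr> carrier = {g. g permutes darts M \<and>
                     (\<forall>d\<in>darts M. g (turn M d) = turn M (g d) \<and> g (flip M d) = flip M (g d))},
       monoid.mult = (\<circ>), one = id \<rparr>"

definition orientably_regular :: "('a, 'b) oriented_map_scheme \<Rightarrow> bool" where
  "orientably_regular M \<longleftrightarrow> is_oriented_map M \<and>
     (\<forall>d\<in>darts M. \<forall>e\<in>darts M. \<exists>g\<in>carrier (rotation_group M). g d = e)"

text \<open>
  \<open>r\<close> and \<open>s\<close> are the one-step rotations about the face to the left of \<open>d\<close> and about the initial
  vertex of \<open>d\<close>.  In an orientably-regular map they exist and are unique for each dart \<open>d\<close>, and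
  the pairs belonging to different darts are simultaneously conjugate in the rotation group, so
  the notions defined from them do not depend on the choice of \<open>d\<close>.
\<close>

definition rotation_pair ::
  "('a, 'b) oriented_map_scheme \<Rightarrow> ('a \<Rightarrow> 'a) \<Rightarrow> ('a \<Rightarrow> 'a) \<Rightarrow> bool" where
  "rotation_pair M r s \<longleftrightarrow> r \<in> carrier (rotation_group M) \<and> s \<in> carrier (rotation_group M) \<and>
     (\<exists>d\<in>darts M. r d = face_next M d \<and> s d = turn M d)"

definition has_type :: "('a, 'b) oriented_map_scheme \<Rightarrow> nat \<Rightarrow> nat \<Rightarrow> bool" where
  "has_type M m n \<longleftrightarrow>
     (\<exists>r s. rotation_pair M r s \<and>
        group.ord (rotation_group M) r = m \<and> group.ord (rotation_group M) s = n)"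

definition reflexible :: "('a, 'b) oriented_map_scheme \<Rightarrow> bool" where
  "reflexible M \<longleftrightarrow>
     (\<exists>r s. rotation_pair M r s \<and>
        (\<exists>f\<in>Group.iso (rotation_group M) (rotation_group M).
           f r = inv\<^bsub>rotation_group M\<^esub> r \<and> f s = inv\<^bsub>rotation_group M\<^esub> s))"

definition chiral :: "('a, 'b) oriented_map_scheme \<Rightarrow> bool" where
  "chiral M \<longleftrightarrow> orientably_regular M \<and> \<not> reflexible M"

text \<open>
  The map \<open>\<M>(G : r, s)\<close>: the darts are the elements of \<open>G\<close>, on which \<open>G\<close> acts as the rotation group
  by left multiplication, with \<open>r\<close>, \<open>s\<close> the rotations belonging to the dart \<open>\<one>\<close>.
\<close>

definition regular_map_of :: "('a, 'b) monoid_scheme \<Rightarrow> 'a \<Rightarrow> 'a \<Rightarrow> 'a oriented_map" where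
  "regular_map_of G r s =
     \<lparr> darts = carrier G,
       turn = (\<lambda>x. if x \<in> carrier G then x \<otimes>\<^bsub>G\<^esub> s else x),
       flip = (\<lambda>x. if x \<in> carrier G then x \<otimes>\<^bsub>G\<^esub> (r \<otimes>\<^bsub>G\<^esub> s) else x) \<rparr>"

lemma group_rotation_group: "group (rotation_group M)"
proof (rule groupI)
  show "\<one>\<^bsub>rotation_group M\<^esub> \<in> carrier (rotation_group M)"
    by (simp add: rotation_group_def permutes_id)
next
  fix x y assume "x \<in> carrier (rotation_group M)" "y \<in> carrier (rotation_group M)"
  then show "x \<otimes>\<^bsub>rotation_group M\<^esub> y \<in> carrier (rotation_group M)"
    by (auto simp: rotation_group_def permutes_compose permutes_in_image)
next
  fix x assume x: "x \<in> carrier (rotation_group M)"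
  then have p: "x permutes darts M" by (simp add: rotation_group_def)
  let ?y = "inv_into UNIV x"
  have q: "?y permutes darts M" by (rule permutes_inv[OF p])
  have *: "?y (t d) = t (?y d)"
    if d: "d \<in> darts M" and t: "\<And>e. e \<in> darts M \<Longrightarrow> x (t e) = t (x e)" for d t
    using t[of "?y d"] d by (metis p permutes_in_image permutes_inverses q)
  have "?y \<in> carrier (rotation_group M)"
    using x q by (simp add: rotation_group_def *)
  moreover have "?y \<circ> x = id" by (rule permutes_inv_o(2)[OF p])
  ultimately show "\<exists>y\<in>carrier (rotation_group M). y \<otimes>\<^bsub>rotation_group M\<^esub> x = \<one>\<^bsub>rotation_group M\<^esub>"
    by (auto simp: rotation_group_def)
qed (auto simp: rotation_group_def)


context group
begin

definition left_mult :: "'a \<Rightarrow> 'a \<Rightarrow> 'a" where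
  "left_mult g x = (if x \<in> carrier G then g \<otimes> x else x)"

lemma right_mult_permutes:
  assumes g: "g \<in> carrier G"
  shows "(\<lambda>x. if x \<in> carrier G then x \<otimes> g else x) permutes carrier G"
proof (rule bij_imp_permutes)
  have "bij_betw (\<lambda>x. x \<otimes> g) (carrier G) (carrier G)"
    by (rule bij_betw_byWitness[where f' = "\<lambda>x. x \<otimes> inv g"]) (auto simp: g m_assoc)
  then show "bij_betw (\<lambda>x. if x \<in> carrier G then x \<otimes> g else x) (carrier G) (carrier G)"
    by (rule bij_betw_cong[THEN iffD1, rotated]) simp
qed simp

lemma left_mult_permutes:
  assumes g: "g \<in> carrier G"
  shows "left_mult g permutes carrier G"
proof (rule bij_imp_permutes)
  have "bij_betw (\<lambda>x. g \<otimes> x) (carrier G) (carrier G)"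
    by (rule bij_betw_byWitness[where f' = "\<lambda>x. inv g \<otimes> x"])
      (auto simp: g m_assoc[symmetric])
  then show "bij_betw (left_mult g) (carrier G) (carrier G)"
    by (rule bij_betw_cong[THEN iffD1, rotated]) (simp add: left_mult_def)
qed (simp add: left_mult_def)

end

lemma ord_iso:
  assumes "group G" "group H" and h: "h \<in> Group.iso G H" and x: "x \<in> carrier G"
  shows "group.ord H (h x) = group.ord G x"
proof -
  interpret G: group G by fact
  interpret H: group H by fact
  interpret group_hom G H h using h by unfold_locales (simp add: iso_def)
  have inj: "inj_on h (carrier G)" using h by (simp add: iso_def bij_betw_def)
  have "h x [^]\<^bsub>H\<^esub> k = \<one>\<^bsub>H\<^esub> \<longleftrightarrow> x [^]\<^bsub>G\<^esub> k = \<one>\<^bsub>G\<^esub>" for k :: nat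
  proof -
    have "h (x [^]\<^bsub>G\<^esub> k) = h \<one>\<^bsub>G\<^esub> \<longleftrightarrow> x [^]\<^bsub>G\<^esub> k = \<one>\<^bsub>G\<^esub>"
      using inj x by (intro inj_on_eq_iff) auto
    then show ?thesis using x by (simp add: hom_nat_pow)
  qed
  then show ?thesis by (simp add: G.ord_def H.ord_def)
qed

text \<open>
  For a finite group \<open>G\<close> generated by \<open>r\<close>, \<open>s\<close> with \<open>r \<otimes> s\<close> an involution, \<open>\<M>(G : r, s)\<close> is an
  orientably-regular map with rotation group isomorphic to \<open>G\<close>, whose type and reflexibility are
  read off from \<open>G\<close>, \<open>r\<close>, \<open>s\<close>.
\<close>

locale rotation_generators = group G for G (structure) +
  fixes r s
  assumes fin: "finite (carrier G)"
    and r: "r \<in> carrier G" and s: "s \<in> carrier G"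
    and gen: "generate G {r, s} = carrier G"
    and rs_nontrivial: "r \<otimes> s \<noteq> \<one>"
    and rs_square: "(r \<otimes> s) \<otimes> (r \<otimes> s) = \<one>"
begin

abbreviation M where "M \<equiv> regular_map_of G r s"

lemma M_simps [simp]:
  "darts M = carrier G"
  "x \<in> carrier G \<Longrightarrow> turn M x = x \<otimes> s"
  "x \<in> carrier G \<Longrightarrow> flip M x = x \<otimes> (r \<otimes> s)"
  by (simp_all add: regular_map_of_def)

lemma turn_permutes: "turn M permutes carrier G"
  using right_mult_permutes[OF s] by (simp add: regular_map_of_def)

lemma flip_permutes: "flip M permutes carrier G"
  using right_mult_permutes[of "r \<otimes> s"] r s by (simp add: regular_map_of_def)

lemma face_next_M: "x \<in> carrier G \<Longrightarrow> face_next M x = x \<otimes> r"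
proof -
  assume x: "x \<in> carrier G"
  have "turn M (x \<otimes> r) = flip M x" using x r s by (simp add: m_assoc)
  then show ?thesis unfolding face_next_def
    by (metis permutes_inverses(2)[OF turn_permutes])
qed

lemma reach:
  assumes "g \<in> carrier G" and "d \<in> carrier G"
  shows "(d, d \<otimes> g) \<in> (dart_step M)\<^sup>*"
proof -
  define H where "H = {g \<in> carrier G. \<forall>d\<in>carrier G. (d, d \<otimes> g) \<in> (dart_step M)\<^sup>*}"
  have one: "\<one> \<in> H" by (auto simp: H_def)
  have mult: "x \<otimes> y \<in> H" if "x \<in> H" "y \<in> H" for x y
  proof -
    have "(d, d \<otimes> (x \<otimes> y)) \<in> (dart_step M)\<^sup>*" if d: "d \<in> carrier G" for d
    proof -
      have "(d, d \<otimes> x) \<in> (dart_step M)\<^sup>*" "(d \<otimes> x, d \<otimes> x \<otimes> y) \<in> (dart_step M)\<^sup>*"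
        using \<open>x \<in> H\<close> \<open>y \<in> H\<close> d by (auto simp: H_def)
      then have "(d, d \<otimes> x \<otimes> y) \<in> (dart_step M)\<^sup>*" by (rule rtrancl_trans)
      then show ?thesis using \<open>x \<in> H\<close> \<open>y \<in> H\<close> d by (simp add: H_def m_assoc)
    qed
    with that show ?thesis by (simp add: H_def)
  qed
  have pow: "x [^] (k::nat) \<in> H" if "x \<in> H" for x k
    by (induction k) (use that one mult in auto)
  have inv: "inv x \<in> H" if x: "x \<in> H" for x
  proof -
    have xc: "x \<in> carrier G" using x by (simp add: H_def)
    have "order G > 0" using fin order_gt_0_iff_finite by blast
    then obtain k where k: "order G = Suc k" using gr0_implies_Suc by blast
    have "x [^] k \<otimes> x = \<one>" using pow_order_eq_1[OF xc] k by simp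
    then have "inv x = x [^] k" using xc by (simp add: inv_equality)
    then show ?thesis using pow[OF x] by simp
  qed
  have sub: "subgroup H G"
    by (rule subgroupI) (use one mult inv in \<open>auto simp: H_def\<close>)
  have sH: "s \<in> H" and tH: "r \<otimes> s \<in> H"
    using r s by (auto simp: H_def dart_step_def intro!: r_into_rtrancl)
  have "r = (r \<otimes> s) \<otimes> inv s" using r s by (simp add: m_assoc)
  then have "r \<in> H" using mult[OF tH inv[OF sH]] by simp
  then have "generate G {r, s} \<subseteq> H" using sH sub by (intro generate_subgroup_incl) auto
  then show ?thesis using assms gen by (auto simp: H_def)
qed

lemma oriented_map_M: "is_oriented_map M"
proof -
  have "flip M d \<noteq> d" "flip M (flip M d) = d" if "d \<in> carrier G" for d
  proof -
    show "flip M d \<noteq> d"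
      using that r s rs_nontrivial l_cancel[of d "r \<otimes> s" \<one>] by auto
    show "flip M (flip M d) = d"
      using that r s rs_square by (simp add: m_assoc)
  qed
  moreover have "(d, e) \<in> (dart_step M)\<^sup>*" if "d \<in> carrier G" "e \<in> carrier G" for d e
    using reach[of "inv d \<otimes> e" d] that by (simp add: m_assoc[symmetric])
  ultimately show ?thesis
    unfolding is_oriented_map_def
    using fin turn_permutes flip_permutes by auto
qed

lemma left_mult_carrier: "g \<in> carrier G \<Longrightarrow> left_mult g \<in> carrier (rotation_group M)"
  using r s by (auto simp: rotation_group_def left_mult_permutes m_assoc left_mult_def)

lemma rotation_group_left_mult:
  assumes h: "h \<in> carrier (rotation_group M)"
  shows "h \<one> \<in> carrier G" and "h = left_mult (h \<one>)"
proof -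
  have p: "h permutes carrier G"
    and t: "\<And>x. x \<in> carrier G \<Longrightarrow> h (turn M x) = turn M (h x)"
    and f: "\<And>x. x \<in> carrier G \<Longrightarrow> h (flip M x) = flip M (h x)"
    using h by (auto simp: rotation_group_def)
  have hc: "\<And>x. x \<in> carrier G \<Longrightarrow> h x \<in> carrier G"
    using p by (simp add: permutes_in_image)
  show h1: "h \<one> \<in> carrier G" by (rule hc) simp
  have "x \<in> carrier G \<and> h x = h \<one> \<otimes> x" if "(\<one>, x) \<in> (dart_step M)\<^sup>*" for x
    using that
  proof (induction rule: rtrancl_induct)
    case base
    then show ?case using h1 by simp
  next
    case (step y z)
    then have y: "y \<in> carrier G" "h y = h \<one> \<otimes> y" by auto
    from step.hyps(2) consider "z = turn M y" | "z = flip M y" by (auto simp: dart_step_def)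
    then show ?case
    proof cases
      case 1
      then show ?thesis using y t[OF y(1)] h1 s hc by (simp add: m_assoc)
    next
      case 2
      then show ?thesis using y f[OF y(1)] h1 r s hc by (simp add: m_assoc)
    qed
  qed
  then have *: "h x = h \<one> \<otimes> x" if "x \<in> carrier G" for x
    using reach[of x \<one>] l_one[OF that] that one_closed by metis
  show "h = left_mult (h \<one>)"
  proof
    fix x
    show "h x = left_mult (h \<one>) x"
      using *[of x] permutes_not_in[OF p, of x]
      by (cases "x \<in> carrier G") (auto simp only: left_mult_def if_True if_False not_False_eq_True simp_thms)
  qed
qed

lemma left_mult_iso: "left_mult \<in> Group.iso G (rotation_group M)"
proof -
  have "left_mult \<in> hom G (rotation_group M)"
  proof (rule homI)
    fix g h assume "g \<in> carrier G" "h \<in> carrier G"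
    then have "left_mult (g \<otimes> h) = left_mult g \<circ> left_mult h"
      by (simp add: left_mult_def m_assoc fun_eq_iff)
    then show "left_mult (g \<otimes> h) = left_mult g \<otimes>\<^bsub>rotation_group M\<^esub> left_mult h"
      by (simp add: rotation_group_def)
  qed (rule left_mult_carrier)
  moreover have "bij_betw left_mult (carrier G) (carrier (rotation_group M))"
  proof (rule bij_betw_byWitness[where f' = "\<lambda>h. h \<one>"])
    show "\<forall>g\<in>carrier G. left_mult g \<one> = g" by (simp add: left_mult_def)
    show "\<forall>h\<in>carrier (rotation_group M). left_mult (h \<one>) = h"
      by (auto intro: rotation_group_left_mult(2)[symmetric])
    show "left_mult ` carrier G \<subseteq> carrier (rotation_group M)"
      using left_mult_carrier by blast
    show "(\<lambda>h. h \<one>) ` carrier (rotation_group M) \<subseteq> carrier G"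
      using rotation_group_left_mult(1) by blast
  qed
  ultimately show ?thesis by (simp add: iso_def)
qed

lemma orientably_regular_M: "orientably_regular M"
proof -
  have "\<exists>g\<in>carrier (rotation_group M). g d = e" if "d \<in> carrier G" "e \<in> carrier G" for d e
    by (rule bexI[of _ "left_mult (e \<otimes> inv d)"])
      (use that in \<open>auto simp: left_mult_carrier\<close>, auto simp: left_mult_def m_assoc)
  then show ?thesis by (simp add: orientably_regular_def oriented_map_M)
qed

lemma rotation_pair_iff:
  "rotation_pair M R S \<longleftrightarrow>
     (\<exists>d\<in>carrier G. R = left_mult (d \<otimes> r \<otimes> inv d) \<and> S = left_mult (d \<otimes> s \<otimes> inv d))"
proof
  assume "rotation_pair M R S"
  then obtain d where R: "R \<in> carrier (rotation_group M)" and S: "S \<in> carrier (rotation_group M)"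
    and d: "d \<in> carrier G" and "R d = d \<otimes> r" "S d = d \<otimes> s"
    by (auto simp: rotation_pair_def face_next_M)
  have "h \<one> = d \<otimes> g \<otimes> inv d"
    if h: "h \<in> carrier (rotation_group M)" and e: "h d = d \<otimes> g" and g: "g \<in> carrier G" for h g
  proof -
    have "h \<one> \<otimes> d = d \<otimes> g"
      using fun_cong[OF rotation_group_left_mult(2)[OF h], of d] d e by (simp add: left_mult_def)
    then show ?thesis
      using rotation_group_left_mult(1)[OF h] d g by (metis inv_solve_right m_closed)
  qed
  then have "R \<one> = d \<otimes> r \<otimes> inv d" "S \<one> = d \<otimes> s \<otimes> inv d"
    using R S r s \<open>R d = d \<otimes> r\<close> \<open>S d = d \<otimes> s\<close> by blast+
  then show "\<exists>d\<in>carrier G. R = left_mult (d \<otimes> r \<otimes> inv d) \<and> S = left_mult (d \<otimes> s \<otimes> inv d)"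
    using rotation_group_left_mult(2)[OF R] rotation_group_left_mult(2)[OF S] d by auto
next
  assume "\<exists>d\<in>carrier G. R = left_mult (d \<otimes> r \<otimes> inv d) \<and> S = left_mult (d \<otimes> s \<otimes> inv d)"
  then obtain d where d: "d \<in> carrier G"
    and *: "R = left_mult (d \<otimes> r \<otimes> inv d)" "S = left_mult (d \<otimes> s \<otimes> inv d)" by blast
  then have "R d = d \<otimes> r" "S d = d \<otimes> s"
    using r s by (simp_all add: left_mult_def m_assoc)
  then show "rotation_pair M R S"
    using d * r s by (auto simp: rotation_pair_def face_next_M left_mult_carrier)
qed

lemma conj_left_mult_iso:
  assumes d: "d \<in> carrier G"
  shows "(\<lambda>g. left_mult (d \<otimes> g \<otimes> inv d)) \<in> Group.iso G (rotation_group M)"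
proof -
  have "(\<lambda>g. d \<otimes> g \<otimes> inv d) \<in> hom G G"
  proof (rule homI)
    fix g h assume gh: "g \<in> carrier G" "h \<in> carrier G"
    have "inv d \<otimes> (d \<otimes> (h \<otimes> inv d)) = h \<otimes> inv d"
      using gh d by (simp add: m_assoc[symmetric])
    then show "d \<otimes> (g \<otimes> h) \<otimes> inv d = (d \<otimes> g \<otimes> inv d) \<otimes> (d \<otimes> h \<otimes> inv d)"
      using gh d by (simp add: m_assoc)
  qed (simp add: d)
  moreover have "bij_betw (\<lambda>g. d \<otimes> g \<otimes> inv d) (carrier G) (carrier G)"
  proof (rule bij_betw_byWitness[where f' = "\<lambda>g. inv d \<otimes> g \<otimes> d"])
    have "inv d \<otimes> (d \<otimes> g \<otimes> inv d) \<otimes> d = g" if "g \<in> carrier G" for g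
      using that d by (metis inv_closed inv_solve_left m_assoc m_closed l_inv r_one)
    then show "\<forall>g\<in>carrier G. inv d \<otimes> (d \<otimes> g \<otimes> inv d) \<otimes> d = g" by blast
    have "d \<otimes> (inv d \<otimes> g \<otimes> d) \<otimes> inv d = g" if "g \<in> carrier G" for g
      using that d by (metis inv_closed m_assoc m_closed r_inv l_one r_one)
    then show "\<forall>g\<in>carrier G. d \<otimes> (inv d \<otimes> g \<otimes> d) \<otimes> inv d = g" by blast
  qed (auto simp: d)
  ultimately have "(\<lambda>g. d \<otimes> g \<otimes> inv d) \<in> Group.iso G G" by (simp add: iso_def)
  from iso_set_trans[OF this left_mult_iso] show ?thesis by (simp add: comp_def)
qed

lemma rotation_pair_left_mult: "rotation_pair M (left_mult r) (left_mult s)"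
  unfolding rotation_pair_iff using r s by (intro bexI[of _ \<one>]) auto

lemma has_type_iff: "has_type M m n \<longleftrightarrow> ord r = m \<and> ord s = n"
proof -
  have *: "group.ord (rotation_group M) R = ord r \<and> group.ord (rotation_group M) S = ord s"
    if "rotation_pair M R S" for R S
  proof -
    from that obtain d where d: "d \<in> carrier G"
      and "R = left_mult (d \<otimes> r \<otimes> inv d)" "S = left_mult (d \<otimes> s \<otimes> inv d)"
      unfolding rotation_pair_iff by blast
    then show ?thesis
      using ord_iso[OF is_group group_rotation_group conj_left_mult_iso[OF d]] r s by simp
  qed
  then show ?thesis
    unfolding has_type_def using rotation_pair_left_mult by metis
qed

lemma reflexible_iff: "reflexible M \<longleftrightarrow> (\<exists>f\<in>Group.iso G G. f r = inv r \<and> f s = inv s)"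
proof
  assume "reflexible M"
  then obtain R S f where RS: "rotation_pair M R S"
    and f: "f \<in> Group.iso (rotation_group M) (rotation_group M)"
    and fR: "f R = inv\<^bsub>rotation_group M\<^esub> R" and fS: "f S = inv\<^bsub>rotation_group M\<^esub> S"
    by (auto simp: reflexible_def)
  from RS obtain d where d: "d \<in> carrier G"
    and R: "R = left_mult (d \<otimes> r \<otimes> inv d)" and S: "S = left_mult (d \<otimes> s \<otimes> inv d)"
    unfolding rotation_pair_iff by blast
  define h where "h = (\<lambda>g. left_mult (d \<otimes> g \<otimes> inv d))"
  have h: "h \<in> Group.iso G (rotation_group M)"
    using conj_left_mult_iso[OF d] by (simp add: h_def)
  interpret h: group_hom G "rotation_group M" h
    using h group_rotation_group by (auto simp: group_hom_def group_hom_axioms_def iso_def)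
  have inj: "inj_on h (carrier G)" using h by (simp add: iso_def bij_betw_def)
  define k where "k = inv_into (carrier G) h \<circ> (f \<circ> h)"
  have "k \<in> Group.iso G G"
    unfolding k_def by (intro iso_set_trans[OF iso_set_trans[OF h f]] iso_set_sym h)
  moreover have "k r = inv r"
    using fR R r h.hom_inv[OF r] inv_into_f_f[OF inj, of "inv r"] by (simp add: k_def h_def)
  moreover have "k s = inv s"
    using fS S s h.hom_inv[OF s] inv_into_f_f[OF inj, of "inv s"] by (simp add: k_def h_def)
  ultimately show "\<exists>f\<in>Group.iso G G. f r = inv r \<and> f s = inv s" by blast
next
  assume "\<exists>f\<in>Group.iso G G. f r = inv r \<and> f s = inv s"
  then obtain f where f: "f \<in> Group.iso G G" and fr: "f r = inv r" and fs: "f s = inv s" by blast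
  interpret h: group_hom G "rotation_group M" left_mult
    using left_mult_iso group_rotation_group by (auto simp: group_hom_def group_hom_axioms_def iso_def)
  have inj: "inj_on left_mult (carrier G)" using left_mult_iso by (simp add: iso_def bij_betw_def)
  define k where "k = left_mult \<circ> f \<circ> inv_into (carrier G) left_mult"
  have "k \<in> Group.iso (rotation_group M) (rotation_group M)"
    using iso_set_trans[OF iso_set_trans[OF iso_set_sym[OF left_mult_iso] f] left_mult_iso]
    by (simp add: k_def comp_assoc)
  moreover have "k (left_mult r) = inv\<^bsub>rotation_group M\<^esub> (left_mult r)"
    using r inj fr by (simp add: k_def)
  moreover have "k (left_mult s) = inv\<^bsub>rotation_group M\<^esub> (left_mult s)"
    using s inj fs by (simp add: k_def)
  ultimately show "reflexible M"
    unfolding reflexible_def using rotation_pair_left_mult by blast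
qed

end

end

theory Submission
  imports Defs "HOL-Library.Nat_Bijection" "HOL-Library.Code_Binary_Nat" "HOL-Combinatorics.Permutations" "HOL-Combinatorics.Orbits"
begin

text \<open>
  A map with rotation group \<open>G\<close> amounts to two permutations: \<open>s\<close> of order \<open>n\<close> and an involution \<open>t\<close>, such
  that \<open>s \<circ> t\<close>, the inverse of \<open>r\<close>, has order \<open>m\<close>. If the commutator \<open>comm s t\<close> has exactly one cycle
  of length 3 and all other lengths prime to 3, some power of it is a 3-cycle. Both \<open>s\<close> and \<open>t\<close> being
  even and the group transitive, \<open>G\<close> is then the full alternating group as soon as the finest congruence
  identifying the three points also identifies some point with its image under \<open>s\<close>, and some point
  with its image under \<open>t\<close>. A relation that fails when \<open>s\<close> is replaced by its inverse gives chirality.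

  All these certificates involve only a small part of the permutations. Elsewhere one can insert new
  points so that the old cycles of the commutator are kept and the new ones have length prime to 3:
  either fixed points and short loops at marked points, one on each face, which lengthen
  both vertices and faces, or a whole ladder of faces at a rung joining the two vertices, which leaves
  the faces alone and adds \<open>m\<close> (for \<open>m = 3\<close> adds 5) to \<open>n\<close>. Every hyperbolic type with \<open>m \<le> n\<close> is
  reached in this way from a finite table; the remaining types follow by duality.
\<close>

section \<open>Alternating groups and 3-cycles\<close>

text \<open>Primitivity of groups of growing degree cannot be read off a finite table. Therefore
  Jordan's theorem is replaced by a local argument: a maximal set supporting all 3-cycles is a
  block, and relations near one 3-cycle force it to be everything. In the growing diagrams two
  vertices of equal length make \<open>s\<close> even for every \<open>n\<close>, and every
  insertion adds a multiple of 4 to the support of \<open>t\<close>, so parity never obstructs a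
  type. A ladder at fixed \<open>m\<close> leaves a window of values of \<open>n\<close> that widens
  with \<open>m\<close>. For \<open>m \<ge> 9\<close> this window is filled from marks. With one
  mark on each vertex, an inserted fixed point adds 1 to both \<open>m\<close> and \<open>n\<close>,
  and a loop adds 1 to \<open>m\<close> and 2 to \<open>n\<close>, so the loops control
  \<open>n - m\<close>. With two marks on each vertex, a fixed point adds 1 to \<open>m\<close> and
  2 to \<open>n\<close>, which keeps \<open>2 * m - n\<close>. A bundle of \<open>l\<close> loops
  creates a commutator cycle of length \<open>2 * l + 1\<close>; where this is divisible by 3, a
  second seed with another value of \<open>n - m\<close> is used. Small types, which leave no room
  for such insertions, have certificates of their own.\<close>

definition alt_on :: "'a set \<Rightarrow> ('a \<Rightarrow> 'a) monoid" where
  "alt_on U = \<lparr>carrier = {p. p permutes U \<and> evenperm p}, monoid.mult = (\<circ>), one = id\<rparr>"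

lemma alt_on_simps [simp]:
  "p \<in> carrier (alt_on U) \<longleftrightarrow> p permutes U \<and> evenperm p"
  "monoid.mult (alt_on U) = (\<circ>)" "one (alt_on U) = id"
  by (simp_all add: alt_on_def)

lemma alt_on_atLeastAtMost: "alt_on {1..k} = alt_group k"
  by (simp add: alt_on_def alt_group_def sym_group_def)

lemma permutes_imp_permutation: "finite U \<Longrightarrow> p permutes U \<Longrightarrow> permutation p"
  using permutation_permutes by blast

lemma group_alt_on:
  assumes "finite U" shows "group (alt_on U)"
proof (rule groupI)
  fix x y assume "x \<in> carrier (alt_on U)" "y \<in> carrier (alt_on U)"
  then show "x \<otimes>\<^bsub>alt_on U\<^esub> y \<in> carrier (alt_on U)"
    using assms by (simp add: permutes_compose evenperm_comp permutes_imp_permutation)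
next
  fix x assume x: "x \<in> carrier (alt_on U)"
  then have "inv' x \<circ> x = id" using permutes_inv_o(2) by auto
  moreover have "inv' x \<in> carrier (alt_on U)"
    using x assms by (simp add: permutes_inv evenperm_inv permutes_imp_permutation)
  ultimately show "\<exists>y\<in>carrier (alt_on U). y \<otimes>\<^bsub>alt_on U\<^esub> x = \<one>\<^bsub>alt_on U\<^esub>"
    by auto
qed (auto simp: permutes_id comp_assoc)

lemma inv_alt_on:
  assumes "finite U" "p \<in> carrier (alt_on U)"
  shows "inv\<^bsub>alt_on U\<^esub> p = inv' p"
proof -
  interpret group "alt_on U" using assms(1) by (rule group_alt_on)
  have "inv' p \<in> carrier (alt_on U)"
    using assms by (simp add: permutes_inv evenperm_inv permutes_imp_permutation)
  moreover have "inv' p \<circ> p = id" using assms permutes_inv_o(2) by auto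
  ultimately show ?thesis using assms(2) by (intro inv_equality) auto
qed

lemma pow_alt_on: "p [^]\<^bsub>alt_on U\<^esub> (k::nat) = p ^^ k"
  by (induction k) (simp_all add: nat_pow_def funpow_swap1 fun_eq_iff)

text \<open>The relabelling is a finitely supported permutation of the whole type and not merely a
  bijection of \<open>U\<close>, so the map is an honest conjugation and preserves parity.\<close>

lemma conj_alt_on_iso:
  assumes e: "permutation e" and fin: "finite U"
  shows "(\<lambda>p. e \<circ> p \<circ> inv' e) \<in> Group.iso (alt_on U) (alt_on (e ` U))"
proof -
  have bij: "bij e" using e by (simp add: permutation_bijective)
  let ?c = "\<lambda>p. e \<circ> p \<circ> inv' e" and ?d = "\<lambda>p. inv' e \<circ> p \<circ> e"
  have ie [simp]: "inv' e (e x) = x" "e (inv' e x) = x" for x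
    using bij by (simp_all add: bij_is_inj bij_is_surj surj_f_inv_f)
  have ei: "permutation (inv' e)" using e by (rule permutation_inverse)
  have perm: "(e \<circ> p \<circ> inv' e) permutes (e ` U)" if "p permutes U" for p
  proof -
    have "(e \<circ> p \<circ> inv' e) x = x" if "x \<notin> e ` U" for x
    proof -
      have "inv' e x \<notin> U" using that by (metis ie(2) image_eqI)
      then show ?thesis using \<open>p permutes U\<close> by (simp add: permutes_not_in)
    qed
    moreover have "bij (e \<circ> p \<circ> inv' e)"
      using bij \<open>p permutes U\<close> by (intro bij_comp) (auto simp: permutes_bij bij_imp_bij_inv)
    ultimately show ?thesis
      unfolding permutes_def by (metis bij_pointE)
  qed
  have perm': "(inv' e \<circ> p \<circ> e) permutes U" if "p permutes (e ` U)" for p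
  proof -
    have "(inv' e \<circ> p \<circ> e) x = x" if "x \<notin> U" for x
    proof -
      have "e x \<notin> e ` U" using that by (metis ie(1) image_iff)
      then show ?thesis using \<open>p permutes (e ` U)\<close> by (simp add: permutes_not_in)
    qed
    moreover have "bij (inv' e \<circ> p \<circ> e)"
      using bij that by (intro bij_comp) (auto simp: permutes_bij bij_imp_bij_inv)
    ultimately show ?thesis
      unfolding permutes_def by (metis bij_pointE)
  qed
  have ev: "evenperm (e \<circ> p \<circ> inv' e) \<longleftrightarrow> evenperm p" if "permutation p" for p
    using that e ei by (auto simp: evenperm_comp permutation_compose evenperm_inv)
  have ev': "evenperm (inv' e \<circ> p \<circ> e) \<longleftrightarrow> evenperm p" if "permutation p" for p
    using that e ei by (auto simp: evenperm_comp permutation_compose evenperm_inv)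
  have "?c \<in> hom (alt_on U) (alt_on (e ` U))"
    by (rule homI) (auto simp: perm ev permutes_imp_permutation[OF fin] fun_eq_iff)
  moreover have "bij_betw ?c (carrier (alt_on U)) (carrier (alt_on (e ` U)))"
    by (rule bij_betw_byWitness[where f' = ?d])
      (auto simp: perm perm' ev ev' permutes_imp_permutation[OF fin]
        permutes_imp_permutation[OF finite_imageI[OF fin]] fun_eq_iff)
  ultimately show ?thesis by (simp add: iso_def)
qed

text \<open>The product of transpositions to which \<open>cycle_of_list [i, j, k]\<close> reduces,
  so that the generation of alternating groups by 3-cycles can be used.\<close>

definition c3 :: "'a \<Rightarrow> 'a \<Rightarrow> 'a \<Rightarrow> 'a \<Rightarrow> 'a" where
  "c3 i j k = transpose i j \<circ> transpose j k"

lemma c3_apply: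
  assumes "i \<noteq> j" "j \<noteq> k" "i \<noteq> k"
  shows "c3 i j k x = (if x = i then j else if x = j then k else if x = k then i else x)"
  using assms by (auto simp: c3_def transpose_def)

lemma c3_rotate: "i \<noteq> j \<Longrightarrow> j \<noteq> k \<Longrightarrow> i \<noteq> k \<Longrightarrow> c3 j k i = c3 i j k"
  by (auto simp: c3_apply fun_eq_iff)

lemma c3_conj:
  assumes "bij h" "i \<noteq> j" "j \<noteq> k" "i \<noteq> k"
  shows "h \<circ> c3 i j k \<circ> inv' h = c3 (h i) (h j) (h k)"
proof
  fix x
  have inj: "inj h" using assms(1) by (rule bij_is_inj)
  obtain y where x: "x = h y" using assms(1) by (metis bij_pointE)
  have d: "h i \<noteq> h j" "h j \<noteq> h k" "h i \<noteq> h k" using assms inj by (auto dest: injD)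
  have "inv' h x = y" using inj x by simp
  then show "(h \<circ> c3 i j k \<circ> inv' h) x = c3 (h i) (h j) (h k) x"
    using assms(2-4) d inj x by (auto simp: c3_apply dest: injD)
qed

lemma c3_permutes: "i \<in> U \<Longrightarrow> j \<in> U \<Longrightarrow> k \<in> U \<Longrightarrow> c3 i j k permutes U"
  by (simp add: c3_def permutes_compose permutes_swap_id)

text \<open>A bijection from \<open>U\<close> to the initial segment extends because both sets have
  complements of equal size in their union. Outside the union the extension is the identity, which
  gives finite support.\<close>

lemma ex_permutation_image_atLeastAtMost:
  fixes U :: "nat set"
  assumes "finite U"
  shows "\<exists>e. permutation e \<and> e ` U = {1..card U}"
proof -
  let ?k = "card U"
  let ?A = "U \<union> {1..?k}"
  obtain f where f: "bij_betw f U {1..?k}"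
    using ex_bij_betw_finite_nat[OF assms] finite_same_card_bij[OF assms, of "{1..?k}"] by auto
  have "card (?A - U) = card (?A - {1..?k})"
    using assms by (simp add: card_Diff_subset)
  then obtain h where h: "bij_betw h (?A - U) (?A - {1..?k})"
    using assms by (meson finite_Diff finite_Un finite_atLeastAtMost finite_same_card_bij)
  define e where "e x = (if x \<in> U then f x else if x \<in> ?A then h x else x)" for x
  have "bij_betw e U {1..?k}"
    by (rule bij_betw_cong[THEN iffD1, OF _ f]) (simp add: e_def)
  moreover have "bij_betw e (?A - U) (?A - {1..?k})"
    by (rule bij_betw_cong[THEN iffD1, OF _ h]) (auto simp: e_def)
  ultimately have "bij_betw e (U \<union> (?A - U)) ({1..?k} \<union> (?A - {1..?k}))"
    by (rule bij_betw_combine) blast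
  moreover have "U \<union> (?A - U) = ?A" "{1..?k} \<union> (?A - {1..?k}) = ?A" by blast+
  ultimately have "bij_betw e ?A ?A" by (simp only:)
  then have "e permutes ?A" by (rule bij_imp_permutes) (auto simp: e_def)
  then have "permutation e" using assms by (intro permutes_imp_permutation[of ?A]) auto
  moreover have "e ` U = {1..?k}"
    using f by (auto simp: e_def bij_betw_def)
  ultimately show ?thesis by blast
qed

text \<open>The known generation of \<open>alt_group k\<close> by 3-cycles, moved to
  \<open>U\<close> by conjugation. \<open>H\<close> is only required to be closed under the group
  operations, so the lemma applies to any group of permutations containing the 3-cycles on
  \<open>U\<close>.\<close>

lemma alt_on_subset_generated_by_c3:
  fixes U :: "nat set"
  assumes fin: "finite U"
    and c: "\<And>i j k. i \<in> U \<Longrightarrow> j \<in> U \<Longrightarrow> k \<in> U \<Longrightarrow> i \<noteq> j \<Longrightarrow> j \<noteq> k \<Longrightarrow> i \<noteq> k \<Longrightarrow> c3 i j k \<in> H"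
    and one: "id \<in> H" and mult: "\<And>x y. x \<in> H \<Longrightarrow> y \<in> H \<Longrightarrow> x \<circ> y \<in> H"
    and inv: "\<And>x. x \<in> H \<Longrightarrow> inv' x \<in> H"
    and p: "p permutes U" "evenperm p"
  shows "p \<in> H"
proof -
  let ?k = "card U"
  obtain e where pe: "permutation e" and eim: "e ` U = {1..?k}"
    using ex_permutation_image_atLeastAtMost[OF fin] by blast
  have be: "bij e" using pe by (simp add: permutation_bijective)
  have ie [simp]: "inv' e (e x) = x" "e (inv' e x) = x" for x
    using be by (simp_all add: bij_is_inj bij_is_surj surj_f_inv_f)
  have bie: "bij (inv' e)" using be by (rule bij_imp_bij_inv)
  have iie: "inv' (inv' e) = e" using be by (simp add: inv_inv_eq)
  interpret A: group "alt_group ?k" by (rule alt_group_is_group)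
  define K where "K = {q. inv' e \<circ> q \<circ> e \<in> H}"
  have "q \<in> K" if "q \<in> generate (alt_group ?k) (three_cycles ?k)" for q
    using that
  proof (induction rule: generate.induct)
    case one
    have "inv' e \<circ> e = id" by (simp add: fun_eq_iff)
    then show ?case using assms(3) unfolding K_def mem_Collect_eq alt_group_one by simp
  next
    case (incl h)
    then obtain cs where cs: "h = cycle_of_list cs" "cycle cs" "length cs = 3" "set cs \<subseteq> {1..?k}" by auto
    obtain i j l where l: "cs = [i, j, l]" using stupid_lemma[OF cs(3)] by auto
    have h: "h = c3 i j l" using cs l by (simp add: c3_def)
    let ?g = "inv' e"
    have eq: "?g \<circ> h \<circ> e = c3 (?g i) (?g j) (?g l)"
      using c3_conj[OF bie, of i j l] cs(2) l iie unfolding h by auto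
    have gU: "?g x \<in> U" if "x \<in> {1..?k}" for x
      using that eim by (metis ie(1) imageE)
    have ne: "?g x \<noteq> ?g y" if "x \<noteq> y" for x y using that by (metis ie(2))
    have "c3 (?g i) (?g j) (?g l) \<in> H"
      by (intro c gU ne) (use cs l in auto)
    then show ?case unfolding K_def mem_Collect_eq eq .
  next
    case (inv h)
    then have hc: "h \<in> carrier (alt_group ?k)" using three_cycles_incl by blast
    have hb: "bij h" using hc by (auto simp: alt_group_carrier dest: permutes_bij)
    from inv obtain cs where cs: "h = cycle_of_list cs" "cycle cs" "length cs = 3" "set cs \<subseteq> {1..?k}" by auto
    obtain i j l where l: "cs = [i, j, l]" using stupid_lemma[OF cs(3)] by auto
    have h: "h = c3 i j l" using cs l by (simp add: c3_def)
    let ?g = "inv' e"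
    have eq: "?g \<circ> h \<circ> e = c3 (?g i) (?g j) (?g l)"
      using c3_conj[OF bie, of i j l] cs(2) l iie unfolding h by auto
    have gU: "?g x \<in> U" if "x \<in> {1..?k}" for x
      using that eim by (metis ie(1) imageE)
    have ne: "?g x \<noteq> ?g y" if "x \<noteq> y" for x y using that by (metis ie(2))
    have "c3 (?g i) (?g j) (?g l) \<in> H"
      by (intro c gU ne) (use cs l in auto)
    then have "?g \<circ> h \<circ> e \<in> H" unfolding eq .
    from assms(5)[OF this] have "inv' (?g \<circ> h \<circ> e) \<in> H" .
    also have "inv' (?g \<circ> h \<circ> e) = ?g \<circ> inv' h \<circ> e"
      using be bie hb by (simp add: o_inv_distrib bij_comp iie comp_assoc)
    finally show ?case unfolding K_def mem_Collect_eq alt_group_inv_equality[OF hc] .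
  next
    case (eng h1 h2)
    have eq: "(inv' e \<circ> h1 \<circ> e) \<circ> (inv' e \<circ> h2 \<circ> e) = inv' e \<circ> (h1 \<circ> h2) \<circ> e"
      by (simp add: fun_eq_iff)
    have "inv' e \<circ> h1 \<circ> e \<in> H" "inv' e \<circ> h2 \<circ> e \<in> H"
      using eng.IH unfolding K_def mem_Collect_eq .
    from mult[OF this] show ?case unfolding eq K_def mem_Collect_eq alt_group_mult .
  qed
  moreover have "e \<circ> p \<circ> inv' e \<in> carrier (alt_group ?k)"
    using conj_alt_on_iso[OF pe fin] p eim
    by (auto simp: iso_def hom_def Pi_def alt_on_atLeastAtMost[symmetric])
  ultimately have "e \<circ> p \<circ> inv' e \<in> K"
    by (simp add: alt_group_carrier_as_three_cycles)
  moreover have "inv' e \<circ> (e \<circ> p \<circ> inv' e) \<circ> e = p" by (simp add: fun_eq_iff)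
  ultimately show ?thesis unfolding K_def mem_Collect_eq by simp
qed

section \<open>A Jordan-type theorem: from one 3-cycle to all of them\<close>

definition alt_in :: "('a \<Rightarrow> 'a) set \<Rightarrow> 'a set \<Rightarrow> bool" where
  "alt_in H D \<longleftrightarrow> (\<forall>i\<in>D. \<forall>j\<in>D. \<forall>k\<in>D. i \<noteq> j \<longrightarrow> j \<noteq> k \<longrightarrow> i \<noteq> k \<longrightarrow> c3 i j k \<in> H)"

lemma alt_inD: "alt_in H D \<Longrightarrow> i \<in> D \<Longrightarrow> j \<in> D \<Longrightarrow> k \<in> D \<Longrightarrow> i \<noteq> j \<Longrightarrow> j \<noteq> k \<Longrightarrow> i \<noteq> k \<Longrightarrow> c3 i j k \<in> H"
  by (simp add: alt_in_def)

lemma card_ge_3_avoid: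
  assumes "finite D" "card D \<ge> 3"
  shows "\<exists>z\<in>D. z \<noteq> x \<and> z \<noteq> y"
proof (rule ccontr)
  assume "\<not> ?thesis"
  then have "D \<subseteq> {x, y}" by blast
  then have "card D \<le> card {x, y}" by (simp add: card_mono)
  also have "\<dots> \<le> 2" by (simp add: card_insert_if)
  finally show False using assms by simp
qed

text \<open>Transitivity of the generated group. Forward closure suffices, since on a finite set a
  subset mapped into itself by a permutation is mapped onto itself.\<close>

definition connected_on :: "'a set \<Rightarrow> ('a \<Rightarrow> 'a) \<Rightarrow> ('a \<Rightarrow> 'a) \<Rightarrow> bool" where
  "connected_on U s t \<longleftrightarrow> (\<forall>S. S \<subseteq> U \<longrightarrow> S \<noteq> {} \<longrightarrow> s ` S \<subseteq> S \<longrightarrow> t ` S \<subseteq> S \<longrightarrow> S = U)"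

text \<open>Quantifying over every such \<open>R\<close> makes this a statement about the finest
  one. The equivalence for \<open>s\<close> expresses invariance under the inverse too;
  \<open>t\<close> is an involution wherever this is used, so there one direction gives
  both.\<close>

definition linked :: "('a \<Rightarrow> 'a) \<Rightarrow> ('a \<Rightarrow> 'a) \<Rightarrow> 'a \<Rightarrow> 'a \<Rightarrow> 'a \<Rightarrow> bool" where
  "linked s t a b c \<longleftrightarrow> (\<forall>R. (\<forall>x y. R x y \<longrightarrow> R y x) \<longrightarrow> (\<forall>x y z. R x y \<longrightarrow> R y z \<longrightarrow> R x z) \<longrightarrow>
     (\<forall>x y. R (s x) (s y) \<longleftrightarrow> R x y) \<longrightarrow> (\<forall>x y. R x y \<longrightarrow> R (t x) (t y)) \<longrightarrow> R a b \<longrightarrow> R a c \<longrightarrow>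
     (\<exists>x. R a x \<and> R a (s x)) \<and> (\<exists>x. R a x \<and> R a (t x)))"

locale perm_set_group =
  fixes H :: "('a \<Rightarrow> 'a) set" and U :: "'a set"
  assumes finU: "finite U"
    and perm: "h \<in> H \<Longrightarrow> h permutes U"
    and id_in: "id \<in> H"
    and comp_in: "x \<in> H \<Longrightarrow> y \<in> H \<Longrightarrow> x \<circ> y \<in> H"
    and inv_in: "x \<in> H \<Longrightarrow> inv' x \<in> H"
begin

lemma bijH: "h \<in> H \<Longrightarrow> bij h" by (meson perm permutes_bij)

lemma c3_conj_in:
  assumes "h \<in> H" "c3 i j k \<in> H" "i \<noteq> j" "j \<noteq> k" "i \<noteq> k"
  shows "c3 (h i) (h j) (h k) \<in> H"
proof -
  have "h \<circ> c3 i j k \<circ> inv' h \<in> H" using assms by (simp add: comp_in inv_in)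
  then show ?thesis using c3_conj[OF bijH[OF assms(1)] assms(3-5)] by simp
qed

lemma c3_swap_in:
  assumes "c3 i j k \<in> H" "i \<noteq> j" "j \<noteq> k" "i \<noteq> k"
  shows "c3 j i k \<in> H"
proof -
  have "c3 i j k \<circ> c3 i j k = c3 j i k"
    using assms(2-4) by (auto simp: c3_apply fun_eq_iff)
  then show ?thesis using comp_in[OF assms(1) assms(1)] by simp
qed

lemma alt_in_image:
  assumes "alt_in H D" "h \<in> H"
  shows "alt_in H (h ` D)"
  unfolding alt_in_def
proof (intro ballI impI)
  fix i j k assume "i \<in> h ` D" "j \<in> h ` D" "k \<in> h ` D" "i \<noteq> j" "j \<noteq> k" "i \<noteq> k"
  then obtain x y z where "i = h x" "j = h y" "k = h z" and xyz: "x \<in> D" "y \<in> D" "z \<in> D" "x \<noteq> y" "y \<noteq> z" "x \<noteq> z"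
    by blast
  then show "c3 i j k \<in> H"
    using c3_conj_in[OF assms(2) alt_inD[OF assms(1) xyz] xyz(4-6)] by simp
qed

text \<open>One 3-cycle through \<open>z\<close> with its other points in \<open>D\<close> is
  enough: conjugation by 3-cycles inside \<open>D\<close>, which fix \<open>z\<close>, changes the
  other two points, and inversion reverses their order.\<close>

lemma alt_in_insert:
  assumes D: "alt_in H D" and pq: "p \<in> D" "q \<in> D" "p \<noteq> q" and z: "z \<notin> D" and c: "c3 p q z \<in> H"
  shows "alt_in H (insert z D)"
proof -
  have step: "c3 j k z \<in> H" if "c3 i j z \<in> H" "i \<in> D" "j \<in> D" "k \<in> D" "i \<noteq> j" "j \<noteq> k" "i \<noteq> k" for i j k
  proof -
    have "c3 (c3 i j k i) (c3 i j k j) (c3 i j k z) \<in> H"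
      by (rule c3_conj_in[OF alt_inD[OF D]]) (use that z in auto)
    then show ?thesis using that z by (auto simp: c3_apply split: if_splits)
  qed
  have swap: "c3 j i z \<in> H" if "c3 i j z \<in> H" "i \<in> D" "j \<in> D" "i \<noteq> j" for i j
    using c3_swap_in[OF that(1)] that z by auto
  have p: "c3 p j z \<in> H" if "j \<in> D" "j \<noteq> p" for j
    using step[OF c, of j] step[of q j p] swap[of j p] pq that c by metis
  have all: "c3 i j z \<in> H" if "i \<in> D" "j \<in> D" "i \<noteq> j" for i j
    using p[of i] p[of j] step[of p i j] swap[of p i] pq(1) that by metis
  show ?thesis
    unfolding alt_in_def
  proof (intro ballI impI)
    fix i j k assume ijk: "i \<in> insert z D" "j \<in> insert z D" "k \<in> insert z D" "i \<noteq> j" "j \<noteq> k" "i \<noteq> k"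
    then consider "i \<in> D" "j \<in> D" "k \<in> D" | "i = z" "j \<in> D" "k \<in> D" | "j = z" "i \<in> D" "k \<in> D" | "k = z" "i \<in> D" "j \<in> D"
      by auto
    then show "c3 i j k \<in> H"
    proof cases
      case 1 then show ?thesis using D ijk by (simp add: alt_inD)
    next
      case 2 then show ?thesis using all[of j k] c3_rotate[of i j k] ijk by metis
    next
      case 3 then show ?thesis using all[of k i] c3_rotate[of k i j] ijk by metis
    next
      case 4 then show ?thesis using all[of i j] ijk by metis
    qed
  qed
qed

text \<open>If a translate met \<open>D\<close> without being equal to it, some 3-cycle in
  \<open>H\<close> would pass through a point of \<open>D\<close> and a point outside. With exactly
  one outside point, \<open>D\<close> grows by it. With two, conjugating a 3-cycle of
  \<open>D\<close> through the common point yields a 3-cycle with a single outside point, and again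
  \<open>D\<close> grows, contrary to maximality.\<close>

lemma maximal_alt_block:
  assumes D: "alt_in H D" "D \<subseteq> U" "card D \<ge> 3"
    and max: "\<And>E. alt_in H E \<Longrightarrow> E \<subseteq> U \<Longrightarrow> D \<subseteq> E \<Longrightarrow> card E \<le> card D"
    and h: "h \<in> H" and meet: "h ` D \<inter> D \<noteq> {}"
  shows "h ` D = D"
proof -
  have finD: "finite D" using D(2) finU by (rule finite_subset)
  have inj: "inj_on h D" using bijH[OF h] by (meson bij_is_inj inj_on_subset subset_UNIV)
  have card: "card (h ` D) = card D" using inj by (rule card_image)
  have hDU: "h ` D \<subseteq> U" using image_mono[OF D(2), of h] permutes_image[OF perm[OF h]] by simp
  have grow: False if "alt_in H (insert z D)" "z \<in> U" "z \<notin> D" for z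
  proof -
    have "card (insert z D) \<le> card D" using that D(2) by (intro max) auto
    then show False using that(3) finD by simp
  qed
  have hD: "alt_in H (h ` D)" using D(1) h by (rule alt_in_image)
  obtain p where p: "p \<in> D" "p \<in> h ` D" using meet by blast
  have "h ` D \<subseteq> D"
  proof
    fix z assume z: "z \<in> h ` D"
    show "z \<in> D"
    proof (rule ccontr)
      assume zD: "z \<notin> D"
      obtain y where y: "y \<in> h ` D" "y \<noteq> p" "y \<noteq> z"
        using card_ge_3_avoid[of "h ` D" p z] finD card D(3) by auto
      have pz: "p \<noteq> z" using p zD by blast
      have c: "c3 p y z \<in> H" using hD p y z pz by (auto intro: alt_inD)
      show False
      proof (cases "y \<in> D")
        case True
        then show False
          using grow[OF alt_in_insert[OF D(1) p(1) True _ zD c]] y z hDU zD by auto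
      next
        case False
        obtain q where q: "q \<in> D" "q \<noteq> p" using card_ge_3_avoid[of D p p] finD D(3) by auto
        obtain r where r: "r \<in> D" "r \<noteq> p" "r \<noteq> q" using card_ge_3_avoid[of D p q] finD D(3) by auto
        have "c3 (c3 p y z p) (c3 p y z q) (c3 p y z r) \<in> H"
          by (rule c3_conj_in[OF c]) (use D(1) p q r in \<open>auto intro: alt_inD\<close>)
        moreover have "c3 p y z p = y" "c3 p y z q = q" "c3 p y z r = r"
          using y pz zD q r False by (auto simp: c3_apply)
        ultimately have "c3 y q r \<in> H" by simp
        then have "c3 q r y \<in> H" using c3_rotate[of y q r] q r False by metis
        then show False
          using grow[OF alt_in_insert[OF D(1) q(1) r(1) _ False]] r y hDU False by auto
      qed
    qed
  qed
  then show ?thesis using card finD by (simp add: card_subset_eq)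
qed

text \<open>A maximal set \<open>D\<close> is a block, so lying in a common translate of
  \<open>D\<close> is a congruence. The hypothesis \<open>linked\<close> then yields a point of
  \<open>D\<close> that \<open>s\<close> keeps in \<open>D\<close>, and one that \<open>t\<close>
  keeps in \<open>D\<close>. Hence both generators map \<open>D\<close> to itself, and connectedness
  gives \<open>D = U\<close>.\<close>

theorem even_perms_in:
  fixes s t :: "'a \<Rightarrow> 'a"
  assumes st: "s \<in> H" "t \<in> H"
    and trans: "connected_on U s t"
    and abc: "a \<in> U" "b \<in> U" "c \<in> U" "a \<noteq> b" "b \<noteq> c" "a \<noteq> c" "c3 a b c \<in> H"
    and link: "linked s t a b c"
  shows "alt_in H U"
proof -
  let ?P = "\<lambda>D. alt_in H D \<and> D \<subseteq> U \<and> {a, b, c} \<subseteq> D"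
  have "?P {a, b, c}"
    using abc c3_rotate[of a b c] c3_rotate[of b c a] c3_swap_in[of a b c]
      c3_rotate[of b a c] c3_rotate[of a c b] by (auto simp: alt_in_def)
  moreover have "\<forall>E. ?P E \<longrightarrow> card E < Suc (card U)" using finU by (simp add: card_mono less_Suc_eq_le)
  ultimately have "\<exists>D. ?P D \<and> (\<forall>E. ?P E \<longrightarrow> card E \<le> card D)"
    by (rule ex_has_greatest_nat)
  then obtain D where D: "?P D" and max: "\<And>E. ?P E \<Longrightarrow> card E \<le> card D" by blast
  have finD: "finite D" using D finU finite_subset by blast
  have "card {a, b, c} \<le> card D" using D finD by (intro card_mono) auto
  then have D3: "card D \<ge> 3" using abc by simp
  have block: "h ` D = D" if "h \<in> H" "h ` D \<inter> D \<noteq> {}" for h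
  proof (rule maximal_alt_block[OF _ _ D3 _ that])
    show "alt_in H D" "D \<subseteq> U" using D by auto
    fix E assume "alt_in H E" "E \<subseteq> U" "D \<subseteq> E"
    then show "card E \<le> card D" using D by (intro max) auto
  qed
  define R where "R x y \<longleftrightarrow> (\<exists>h\<in>H. x \<in> h ` D \<and> y \<in> h ` D)" for x y
  \<comment> \<open>Two translates with a common point coincide; this is what makes \<open>R\<close>
    transitive.\<close>
  have inter: "g ` D = h ` D" if gh: "g \<in> H" "h \<in> H" and x: "x \<in> g ` D" "x \<in> h ` D" for g h x
  proof -
    let ?k = "inv' g \<circ> h"
    have ginv: "inv' g (g y) = y" "g (inv' g y) = y" for y
      using bijH[OF gh(1)] by (simp_all add: bij_is_inj bij_is_surj surj_f_inv_f)
    have "?k \<in> H" using gh by (simp add: comp_in inv_in)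
    moreover obtain y z where "x = g y" "y \<in> D" "x = h z" "z \<in> D" using x by blast
    then have "?k z = y" by (metis comp_apply ginv(1))
    then have "y \<in> ?k ` D \<inter> D" using \<open>y \<in> D\<close> \<open>z \<in> D\<close> by (metis IntI image_eqI)
    ultimately have "?k ` D = D" using block by blast
    moreover have "g ` (?k ` D) = h ` D" by (simp add: image_image ginv)
    ultimately show ?thesis by simp
  qed
  have RD: "x \<in> D" if "R a x" for x
  proof -
    obtain h where h: "h \<in> H" "a \<in> h ` D" "x \<in> h ` D" using \<open>R a x\<close> by (auto simp: R_def)
    then have "h ` D = D" using block D by blast
    then show ?thesis using h by simp
  qed
  have move: "R (g x) (g y)" if "R x y" "g \<in> H" for g x y
  proof -
    obtain h where "h \<in> H" "x \<in> h ` D" "y \<in> h ` D" using \<open>R x y\<close> by (auto simp: R_def)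
    then have "g \<circ> h \<in> H" "g x \<in> (g \<circ> h) ` D" "g y \<in> (g \<circ> h) ` D"
      using \<open>g \<in> H\<close> by (auto simp: comp_in)
    then show ?thesis unfolding R_def by blast
  qed
  have R_sym: "\<forall>x y. R x y \<longrightarrow> R y x" unfolding R_def by blast
  have R_trans: "\<forall>x y z. R x y \<longrightarrow> R y z \<longrightarrow> R x z"
  proof (intro allI impI)
    fix x y z assume "R x y" "R y z"
    then obtain g h where gh: "g \<in> H" "h \<in> H" "x \<in> g ` D" "y \<in> g ` D" "y \<in> h ` D" "z \<in> h ` D"
      by (auto simp: R_def)
    then show "R x z" using inter[of g h y] unfolding R_def by blast
  qed
  have R_s: "\<forall>x y. R (s x) (s y) \<longleftrightarrow> R x y"
  proof (intro allI)
    fix x y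
    have inv_s: "inv' s (s z) = z" for z
      using bijH[OF st(1)] by (simp add: bij_is_inj)
    show "R (s x) (s y) \<longleftrightarrow> R x y"
      using move[OF _ inv_in[OF st(1)], of "s x" "s y"] move[OF _ st(1), of x y]
      unfolding inv_s by blast
  qed
  have R_t: "\<forall>x y. R x y \<longrightarrow> R (t x) (t y)" using move st(2) by blast
  have R_abc: "R a b" "R a c" using id_in D unfolding R_def by (auto intro!: bexI[of _ id])
  have "(\<exists>x. R a x \<and> R a (s x)) \<and> (\<exists>x. R a x \<and> R a (t x))"
    using link[unfolded linked_def, THEN spec, of R] R_sym R_trans R_s R_t R_abc by blast
  then obtain x y where "x \<in> D" "s x \<in> D" "y \<in> D" "t y \<in> D" using RD by blast
  then have "s ` D = D" "t ` D = D" using block st by blast+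
  moreover have "D \<subseteq> U" "D \<noteq> {}" using D by auto
  ultimately have "D = U" using trans[unfolded connected_on_def, rule_format, of D] by simp
  then show ?thesis using D by simp
qed

end

section \<open>A criterion for chiral maps with alternating group\<close>

text \<open>The darts of \<open>regular_map_of\<close> are the group elements, here typically
  permutations, whereas the map has to have darts in \<open>nat\<close>. So the construction is
  applied to an isomorphic copy of the finite group inside \<open>nat\<close>.\<close>

lemma rotation_generators_nat_copy:
  assumes R: "rotation_generators G r s"
    and nonref: "\<not> (\<exists>f\<in>Group.iso G G. f r = inv\<^bsub>G\<^esub> r \<and> f s = inv\<^bsub>G\<^esub> s)"
  shows "\<exists>M :: nat oriented_map. chiral M \<and> has_type M (group.ord G r) (group.ord G s) \<and> G \<cong> rotation_group M"
proof -
  interpret R: rotation_generators G r s by fact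
  obtain f :: "'a \<Rightarrow> nat" where inj: "inj_on f (carrier G)"
    using R.fin finite_imp_inj_to_nat_seg by blast
  define G' where "G' = image_group f G"
  have iso: "f \<in> Group.iso G G'"
    unfolding G'_def by (rule inj_imp_image_group_iso[OF inj])
  have grp: "group G'"
    unfolding G'_def by (rule R.inj_imp_image_group_is_group[OF inj])
  interpret G': group G' by fact
  interpret f: group_hom G G' f
    using iso grp by (auto simp: group_hom_def group_hom_axioms_def iso_def R.is_group)
  have car: "carrier G' = f ` carrier G" using iso by (simp add: iso_def bij_betw_def)
  have rsf: "f r \<otimes>\<^bsub>G'\<^esub> f s = f (r \<otimes>\<^bsub>G\<^esub> s)" using R.r R.s by simp
  interpret R': rotation_generators G' "f r" "f s"
  proof
    show "finite (carrier G')" using R.fin car by simp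
    show "f r \<in> carrier G'" "f s \<in> carrier G'" using R.r R.s by auto
    have "generate G' (f ` {r, s}) = f ` generate G {r, s}"
      using R.r R.s by (intro f.generate_img) auto
    then show "generate G' {f r, f s} = carrier G'" using R.gen car by simp
    have "f (r \<otimes>\<^bsub>G\<^esub> s) \<noteq> f \<one>\<^bsub>G\<^esub>"
      using inj_on_eq_iff[OF inj, of "r \<otimes>\<^bsub>G\<^esub> s" "\<one>\<^bsub>G\<^esub>"] R.rs_nontrivial R.r R.s by auto
    then show "f r \<otimes>\<^bsub>G'\<^esub> f s \<noteq> \<one>\<^bsub>G'\<^esub>" unfolding rsf f.hom_one .
    have "f (r \<otimes>\<^bsub>G\<^esub> s) \<otimes>\<^bsub>G'\<^esub> f (r \<otimes>\<^bsub>G\<^esub> s) = f \<one>\<^bsub>G\<^esub>"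
      using f.hom_mult[of "r \<otimes>\<^bsub>G\<^esub> s" "r \<otimes>\<^bsub>G\<^esub> s"] R.rs_square R.r R.s by simp
    then show "f r \<otimes>\<^bsub>G'\<^esub> f s \<otimes>\<^bsub>G'\<^esub> (f r \<otimes>\<^bsub>G'\<^esub> f s) = \<one>\<^bsub>G'\<^esub>"
      unfolding rsf f.hom_one .
  qed
  have "\<not> reflexible R'.M"
  proof
    assume "reflexible R'.M"
    then obtain F where F: "F \<in> Group.iso G' G'" "F (f r) = inv\<^bsub>G'\<^esub> (f r)" "F (f s) = inv\<^bsub>G'\<^esub> (f s)"
      by (auto simp: R'.reflexible_iff)
    define k where "k = inv_into (carrier G) f \<circ> (F \<circ> f)"
    have "k \<in> Group.iso G G"
      unfolding k_def by (intro iso_set_trans[OF iso_set_trans[OF iso F(1)]] R.iso_set_sym iso)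
    moreover have "k r = inv\<^bsub>G\<^esub> r" "k s = inv\<^bsub>G\<^esub> s"
      using F R.r R.s f.hom_inv[OF R.r] f.hom_inv[OF R.s]
        inv_into_f_f[OF inj, of "inv\<^bsub>G\<^esub> r"] inv_into_f_f[OF inj, of "inv\<^bsub>G\<^esub> s"]
      by (simp_all add: k_def)
    ultimately show False using nonref by blast
  qed
  then have "chiral R'.M" by (simp add: chiral_def R'.orientably_regular_M)
  moreover have "has_type R'.M (group.ord G r) (group.ord G s)"
    using ord_iso[OF R.is_group grp iso] R.r R.s by (simp add: R'.has_type_iff)
  moreover have "G \<cong> rotation_group R'.M"
    using iso_set_trans[OF iso R'.left_mult_iso] by (auto simp: is_iso_def)
  ultimately show ?thesis by blast
qed

text \<open>Pairs of values of one word, taken at \<open>s\<close>, \<open>t\<close> and at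
  \<open>inv' s\<close>, \<open>t\<close>. A homomorphism that inverts \<open>s\<close> and fixes
  \<open>t\<close> would have to send each first member to the second, so a pair \<open>id\<close>,
  \<open>v'\<close> with \<open>v' \<noteq> id\<close> excludes it.\<close>

inductive twin :: "('a \<Rightarrow> 'a) \<Rightarrow> ('a \<Rightarrow> 'a) \<Rightarrow> ('a \<Rightarrow> 'a) \<Rightarrow> ('a \<Rightarrow> 'a) \<Rightarrow> bool"
  for s t :: "'a \<Rightarrow> 'a" where
  twin_id: "twin s t id id"
| twin_s: "twin s t s (inv' s)"
| twin_t: "twin s t t t"
| twin_comp: "twin s t u u' \<Longrightarrow> twin s t v v' \<Longrightarrow> twin s t (u \<circ> v) (u' \<circ> v')"
| twin_inv: "twin s t u u' \<Longrightarrow> twin s t (inv' u) (inv' u')"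

text \<open>Stated for the group and its generators on an arbitrary finite set of numbers.
  Relabelling to \<open>alt_group k\<close> and the passage to maps then happen only once, and
  duality becomes the exchange of \<open>r\<close> and \<open>s\<close>.\<close>

definition chiral_alternating :: "nat \<Rightarrow> nat \<Rightarrow> bool" where
  "chiral_alternating m n \<longleftrightarrow> (\<exists>(U :: nat set) r s. finite U \<and> rotation_generators (alt_on U) r s \<and>
     \<not> (\<exists>f\<in>Group.iso (alt_on U) (alt_on U). f r = inv\<^bsub>alt_on U\<^esub> r \<and> f s = inv\<^bsub>alt_on U\<^esub> s) \<and>
     group.ord (alt_on U) r = m \<and> group.ord (alt_on U) s = n)"

text \<open>Passing to the dual map exchanges \<open>r\<close> and \<open>s\<close>. The product in
  the other order is again an involution because it is conjugate to
  \<open>r \<otimes> s\<close>.\<close>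

lemma chiral_alternating_sym:
  assumes "chiral_alternating m n" shows "chiral_alternating n m"
proof -
  obtain U :: "nat set" and r s where fin: "finite U" and R: "rotation_generators (alt_on U) r s"
    and nonref: "\<not> (\<exists>f\<in>Group.iso (alt_on U) (alt_on U). f r = inv\<^bsub>alt_on U\<^esub> r \<and> f s = inv\<^bsub>alt_on U\<^esub> s)"
    and ords: "group.ord (alt_on U) r = m" "group.ord (alt_on U) s = n"
    using assms unfolding chiral_alternating_def by blast
  interpret R: rotation_generators "alt_on U" r s by fact
  let ?G = "alt_on U"
  have r: "r \<in> carrier ?G" and s: "s \<in> carrier ?G" by (rule R.r, rule R.s)
  have conj: "s \<otimes>\<^bsub>?G\<^esub> r = s \<otimes>\<^bsub>?G\<^esub> (r \<otimes>\<^bsub>?G\<^esub> s) \<otimes>\<^bsub>?G\<^esub> inv\<^bsub>?G\<^esub> s"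
    using r s by (simp only: R.m_assoc R.r_inv R.r_one R.m_closed R.inv_closed)
  interpret R': rotation_generators ?G s r
  proof
    show "finite (carrier ?G)" by (rule R.fin)
    show "generate ?G {s, r} = carrier ?G" using R.gen by (simp only: insert_commute)
    show "s \<otimes>\<^bsub>?G\<^esub> r \<noteq> \<one>\<^bsub>?G\<^esub>"
    proof
      assume "s \<otimes>\<^bsub>?G\<^esub> r = \<one>\<^bsub>?G\<^esub>"
      then have "r \<otimes>\<^bsub>?G\<^esub> s = \<one>\<^bsub>?G\<^esub>" by (rule R.inv_comm[OF _ s r])
      then show False using R.rs_nontrivial by blast
    qed
    have "r \<otimes>\<^bsub>?G\<^esub> (s \<otimes>\<^bsub>?G\<^esub> r \<otimes>\<^bsub>?G\<^esub> s) = \<one>\<^bsub>?G\<^esub>"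
      using R.rs_square r s by (simp only: R.m_assoc R.m_closed)
    then have "(s \<otimes>\<^bsub>?G\<^esub> r \<otimes>\<^bsub>?G\<^esub> s) \<otimes>\<^bsub>?G\<^esub> r = \<one>\<^bsub>?G\<^esub>"
      by (rule R.inv_comm) (simp_all only: r s R.m_closed)
    then show "s \<otimes>\<^bsub>?G\<^esub> r \<otimes>\<^bsub>?G\<^esub> (s \<otimes>\<^bsub>?G\<^esub> r) = \<one>\<^bsub>?G\<^esub>"
      using r s by (simp only: R.m_assoc R.m_closed)
  qed (rule s, rule r)
  show ?thesis
    unfolding chiral_alternating_def using fin R'.rotation_generators_axioms nonref ords by blast
qed

lemma ex_chiral_map_of_chiral_alternating:
  assumes "chiral_alternating m n"
  shows "\<exists>(M :: nat oriented_map) k. chiral M \<and> has_type M m n \<and> rotation_group M \<cong> alt_group k"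
proof -
  obtain U :: "nat set" and r s where fin: "finite U" and R: "rotation_generators (alt_on U) r s"
    and nonref: "\<not> (\<exists>f\<in>Group.iso (alt_on U) (alt_on U). f r = inv\<^bsub>alt_on U\<^esub> r \<and> f s = inv\<^bsub>alt_on U\<^esub> s)"
    and ords: "group.ord (alt_on U) r = m" "group.ord (alt_on U) s = n"
    using assms unfolding chiral_alternating_def by blast
  interpret R: rotation_generators "alt_on U" r s by fact
  obtain M :: "nat oriented_map" where M: "chiral M" "has_type M m n" "alt_on U \<cong> rotation_group M"
    using rotation_generators_nat_copy[OF R nonref] ords by auto
  obtain e where e: "permutation e" "e ` U = {1..card U}"
    using ex_permutation_image_atLeastAtMost[OF fin] by blast
  have "alt_on U \<cong> alt_group (card U)"
    using is_isoI[OF conj_alt_on_iso[OF e(1) fin]] unfolding e(2) alt_on_atLeastAtMost .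
  then have "rotation_group M \<cong> alt_group (card U)"
    using iso_trans[OF R.iso_sym[OF M(3)]] by blast
  then show ?thesis using M by blast
qed

text \<open>Here \<open>t\<close> plays the part of \<open>r \<otimes> s\<close>, so
  \<open>r = t \<circ> inv' s\<close>, and \<open>s \<circ> t\<close> is the inverse of
  \<open>r\<close> and has the same order. The words in \<open>s\<close> and \<open>t\<close>
  contain all 3-cycles by \<open>even_perms_in\<close>, hence all even permutations, and nothing
  else because both generators are even.\<close>

theorem chiral_alternating_criterion:
  fixes U :: "nat set"
  assumes fin: "finite U"
    and s: "s permutes U" "evenperm s" and t: "t permutes U" "evenperm t"
    and tt: "\<And>x. t (t x) = x" and t_id: "t \<noteq> id"
    and ord_s: "\<And>k. s ^^ k = id \<longleftrightarrow> n dvd k"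
    and ord_r: "\<And>k. (s \<circ> t) ^^ k = id \<longleftrightarrow> m dvd k"
    and trans: "connected_on U s t"
    and abc: "a \<in> U" "b \<in> U" "c \<in> U" "a \<noteq> b" "b \<noteq> c" "a \<noteq> c" "twin s t (c3 a b c) x'"
    and link: "linked s t a b c"
    and chir: "twin s t id v'" "v' \<noteq> id"
  shows "chiral_alternating m n"
proof -
  let ?G = "alt_on U" and ?i = "inv' :: (nat \<Rightarrow> nat) \<Rightarrow> _"
  define r where "r = t \<circ> ?i s"
  interpret G: group ?G using fin by (rule group_alt_on)
  have bs: "bij s" using s permutes_bij by blast
  have bt: "bij t" using t permutes_bij by blast
  have is_simps [simp]: "?i s (s x) = x" "s (?i s x) = x" for x
    using bs by (simp_all add: bij_is_inj bij_is_surj surj_f_inv_f)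
  have it: "?i t = t" using tt bt by (metis bij_inv_eq_iff ext)
  have ps: "permutation s" "permutation t" using s t fin permutes_imp_permutation by blast+
  have sc: "s \<in> carrier ?G" and tc: "t \<in> carrier ?G" using s t by auto
  have isc: "?i s \<in> carrier ?G" using sc fin inv_alt_on[OF fin sc] G.inv_closed[OF sc] by simp
  have rc: "r \<in> carrier ?G" using G.m_closed[OF tc isc] by (simp add: r_def)
  have rs: "r \<circ> s = t" by (simp add: r_def fun_eq_iff)
  have twin_alt: "u \<in> carrier ?G \<and> u' \<in> carrier ?G" if "twin s t u u'" for u u'
    using that
  proof induction
    case twin_id then show ?case using permutes_id[of U] by (simp add: id_def)
  next
    case twin_s then show ?case using sc isc by simp
  next
    case twin_t then show ?case using tc by simp
  next
    case (twin_comp u u' v v')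
    then show ?case using G.m_closed[of u v] G.m_closed[of u' v'] by (simp add: comp_def)
  next
    case (twin_inv u u')
    then show ?case
      using G.inv_closed[of u] G.inv_closed[of u'] inv_alt_on[OF fin, of u] inv_alt_on[OF fin, of u'] by simp
  qed
  interpret H: perm_set_group "{u. \<exists>u'. twin s t u u'}" U
  proof
    fix h assume "h \<in> {u. \<exists>u'. twin s t u u'}"
    then show "h permutes U" using twin_alt by fastforce
  qed (use fin in \<open>auto intro: twin_id twin_comp twin_inv\<close>)
  have "alt_in {u. \<exists>u'. twin s t u u'} U"
    by (rule H.even_perms_in[OF _ _ trans abc(1-6) _ link]) (use abc(7) in \<open>auto intro: twin_s twin_t\<close>)
  then have all_twin: "\<exists>p'. twin s t p p'" if "p permutes U" "evenperm p" for p
    using alt_on_subset_generated_by_c3[OF fin _ H.id_in H.comp_in H.inv_in that]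
    by (auto dest: alt_inD)
  have gen_twin: "u \<in> generate ?G {r, s}" if "twin s t u u'" for u u'
    using that
  proof induction
    case twin_id then show ?case using generate.one[of ?G "{r, s}"] by (simp add: id_def)
  next
    case twin_s then show ?case by (simp add: generate.incl)
  next
    case twin_t
    have "r \<in> generate ?G {r, s}" "s \<in> generate ?G {r, s}" by (simp_all add: generate.incl)
    from generate.eng[OF this] show ?case using rs by simp
  next
    case (twin_comp u u' v v')
    then show ?case using generate.eng[of u ?G "{r, s}" v] by (simp add: comp_def)
  next
    case (twin_inv u u')
    then show ?case
      using G.generate_m_inv_closed[of "{r, s}" u] rc sc twin_alt[of u u'] inv_alt_on[OF fin, of u] by simp
  qed
  have gen: "generate ?G {r, s} = carrier ?G"
  proof
    show "generate ?G {r, s} \<subseteq> carrier ?G" using rc sc by (intro G.generate_incl) auto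
    show "carrier ?G \<subseteq> generate ?G {r, s}"
      using all_twin gen_twin by (metis alt_on_simps(1) subsetI)
  qed
  interpret R: rotation_generators ?G r s
  proof
    show "finite (carrier ?G)"
      by (rule finite_subset[OF _ finite_permutations[OF fin]]) auto
  qed (use rc sc gen rs tt t_id in \<open>auto simp: fun_eq_iff\<close>)
  have ir: "inv\<^bsub>?G\<^esub> r = s \<circ> t"
    using rc G.m_closed[OF sc tc] tt by (intro G.inv_equality) (auto simp: r_def fun_eq_iff)
  have nonref: "\<not> (\<exists>f\<in>Group.iso ?G ?G. f r = inv\<^bsub>?G\<^esub> r \<and> f s = inv\<^bsub>?G\<^esub> s)"
  proof
    assume "\<exists>f\<in>Group.iso ?G ?G. f r = inv\<^bsub>?G\<^esub> r \<and> f s = inv\<^bsub>?G\<^esub> s"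
    then obtain f where f: "f \<in> Group.iso ?G ?G" "f r = s \<circ> t" "f s = ?i s"
      using ir inv_alt_on[OF fin sc] by auto
    interpret f: group_hom ?G ?G f
      using f(1) by unfold_locales (simp add: iso_def)
    \<comment> \<open>An automorphism inverting \<open>r\<close> and \<open>s\<close> sends
      \<open>t = r \<circ> s\<close> to \<open>s \<circ> t \<circ> inv' s\<close>. Conjugating its
      values back by \<open>s\<close> makes it fix \<open>t\<close> while it still inverts
      \<open>s\<close>, which is the situation that \<open>twin\<close> describes.\<close>
    define h where "h u = ?i s \<circ> f u \<circ> s" for u
    have mult: "f (u \<circ> v) = f u \<circ> f v" if "u \<in> carrier ?G" "v \<in> carrier ?G" for u v
      using f.hom_mult[OF that] by simp
    have "h u = u'" if "twin s t u u'" for u u'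
      using that
    proof induction
      case twin_id then show ?case using f.hom_one by (simp add: h_def fun_eq_iff id_def)
    next
      case twin_s then show ?case using f(3) by (simp add: h_def fun_eq_iff)
    next
      case twin_t
      have "f t = s \<circ> t \<circ> ?i s" using mult[OF rc sc] f rs by simp
      then show ?case by (simp add: h_def fun_eq_iff)
    next
      case (twin_comp u u' v v')
      have "f (u \<circ> v) = f u \<circ> f v" using twin_alt twin_comp.hyps by (intro mult) blast+
      then have "h (u \<circ> v) = h u \<circ> h v" by (simp add: h_def fun_eq_iff)
      then show ?case using twin_comp.IH by (simp add: comp_def)
    next
      case (twin_inv u u')
      have u: "u \<in> carrier ?G" using twin_alt twin_inv.hyps by blast
      have "f (?i u) = ?i (f u)"
        using f.hom_inv[OF u] inv_alt_on[OF fin u] inv_alt_on[OF fin f.hom_closed[OF u]] by simp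
      moreover have "bij (f u)" using f.hom_closed[OF u] by (auto dest: permutes_bij)
      ultimately have "h (?i u) = ?i (h u)"
        using bs by (simp add: h_def o_inv_distrib bij_comp bij_imp_bij_inv inv_inv_eq comp_assoc)
      then show ?case using twin_inv.IH by simp
    qed
    from this[OF chir(1)] this[OF twin_id] chir(2) show False by simp
  qed
  have "G.ord s dvd k \<longleftrightarrow> n dvd k" for k
    using G.pow_eq_id[OF sc, of k] ord_s[of k] by (simp add: pow_alt_on)
  then have os: "G.ord s = n" by (metis dvd_antisym dvd_refl)
  have "r [^]\<^bsub>?G\<^esub> k = \<one>\<^bsub>?G\<^esub> \<longleftrightarrow> (s \<circ> t) ^^ k = id" for k :: nat
  proof -
    have "(s \<circ> t) ^^ k = inv\<^bsub>?G\<^esub> (r [^]\<^bsub>?G\<^esub> k)"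
      using G.nat_pow_inv[OF rc, of k] ir pow_alt_on[of U "s \<circ> t" k] by simp
    moreover have "inv\<^bsub>?G\<^esub> (r [^]\<^bsub>?G\<^esub> k) = \<one>\<^bsub>?G\<^esub> \<longleftrightarrow> r [^]\<^bsub>?G\<^esub> k = \<one>\<^bsub>?G\<^esub>"
      using G.inv_eq_1_iff[OF G.nat_pow_closed[OF rc]] by blast
    ultimately show ?thesis by simp
  qed
  then have "G.ord r dvd k \<longleftrightarrow> m dvd k" for k
    using G.pow_eq_id[OF rc, of k] ord_r[of k] by simp
  then have or: "G.ord r = m" by (metis dvd_antisym dvd_refl)
  show ?thesis
    unfolding chiral_alternating_def using fin R.rotation_generators_axioms nonref or os by blast
qed

section \<open>Coset diagrams\<close>

lemma orbit_conv_support: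
  assumes "permutation f" shows "orbit f x = set (support f x)"
  unfolding support_set[OF assms] orbit_altdef_permutation[OF assms] by blast

lemma card_orbit:
  assumes "permutation f" shows "card (orbit f x) = least_power f x"
  using distinct_card[OF cycle_of_permutation[OF assms], of x] orbit_conv_support[OF assms, of x] by simp

lemma card_orbit_dvd:
  assumes "permutation f" shows "card (orbit f x) dvd k \<longleftrightarrow> (f ^^ k) x = x"
  using card_orbit[OF assms] least_power_dvd[OF assms] by metis

lemma orbit_sym:
  assumes "permutation f" "y \<in> orbit f x" shows "x \<in> orbit f y"
  using orbit_swap[OF permutation_self_in_orbit[OF assms(1)] assms(2)] .

lemma orbit_eq_iff_mem:
  assumes "permutation f" "y \<in> orbit f x" shows "orbit f y = orbit f x"
  using orbit_trans assms orbit_sym by (metis subsetI subset_antisym)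

lemma orbit_subset_closed:
  assumes "f ` S \<subseteq> S" "x \<in> S" shows "orbit f x \<subseteq> S"
proof
  fix y assume "y \<in> orbit f x"
  then show "y \<in> S" by induction (use assms in auto)
qed

text \<open>An orbit in this sense starts at \<open>p x\<close>, and for a general \<open>p\<close>
  need not contain \<open>x\<close>; this is why \<open>x\<close> is listed separately in the
  hypothesis.\<close>

lemma orbit_semiconj:
  assumes "\<And>z. z \<in> orbit p x \<or> z = x \<Longrightarrow> f (\<theta> z) = \<theta> (p z)"
  shows "orbit f (\<theta> x) = \<theta> ` orbit p x"
proof
  show "orbit f (\<theta> x) \<subseteq> \<theta> ` orbit p x"
  proof
    fix y assume "y \<in> orbit f (\<theta> x)"
    then show "y \<in> \<theta> ` orbit p x"
    proof induction
      case base then show ?case using assms[of x] by (auto intro: orbit.base)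
    next
      case (step y)
      then obtain z where z: "z \<in> orbit p x" "y = \<theta> z" by blast
      then show ?case using assms[of z] by (auto intro: orbit.step)
    qed
  qed
  show "\<theta> ` orbit p x \<subseteq> orbit f (\<theta> x)"
  proof
    fix y assume "y \<in> \<theta> ` orbit p x"
    then obtain z where "z \<in> orbit p x" "y = \<theta> z" by blast
    then show "y \<in> orbit f (\<theta> x)"
    proof (induction arbitrary: y)
      case base then show ?case using assms[of x] orbit.base[of f "\<theta> x"] by simp
    next
      case (step z)
      then have "f (\<theta> z) \<in> orbit f (\<theta> x)" by (intro orbit.step) auto
      then show ?case using assms[of z] step by simp
    qed
  qed
qed

lemma orbit_of_indexed_cycle:
  fixes \<phi> :: "nat \<Rightarrow> 'a"
  assumes l: "l > 0" and step: "\<And>j. j < l \<Longrightarrow> f (\<phi> j) = \<phi> (Suc j mod l)" and i: "i < l"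
  shows "orbit f (\<phi> i) = \<phi> ` {..<l}"
proof
  show "orbit f (\<phi> i) \<subseteq> \<phi> ` {..<l}"
    by (rule orbit_subset_closed) (use l step i in auto)
  have pow: "(f ^^ k) (\<phi> i) = \<phi> ((i + k) mod l)" for k
  proof (induction k)
    case 0 then show ?case using i by simp
  next
    case (Suc k) then show ?case using step[of "(i + k) mod l"] l by (simp add: mod_Suc_eq)
  qed
  show "\<phi> ` {..<l} \<subseteq> orbit f (\<phi> i)"
  proof
    fix y assume "y \<in> \<phi> ` {..<l}"
    then obtain j where j: "j < l" "y = \<phi> j" by auto
    have "i + (l - i + j) = l + j" using i by simp
    then have "(f ^^ (l - i + j)) (\<phi> i) = \<phi> j" using pow[of "l - i + j"] j by simp
    moreover have "l - i + j > 0" using i by simp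
    ultimately show "y \<in> orbit f (\<phi> i)"
      unfolding orbit_altdef j(2) by (intro CollectI exI[of _ "l - i + j"]) simp
  qed
qed

lemma funpow_of_indexed_cycle:
  fixes \<phi> :: "nat \<Rightarrow> 'a"
  assumes "l > 0" and step: "\<And>j. j < l \<Longrightarrow> f (\<phi> j) = \<phi> (Suc j mod l)" and i: "i < l"
  shows "(f ^^ l) (\<phi> i) = \<phi> i"
proof -
  have "(f ^^ k) (\<phi> i) = \<phi> ((i + k) mod l)" for k
  proof (induction k)
    case 0 then show ?case using i by simp
  next
    case (Suc k) then show ?case using step[of "(i + k) mod l"] assms(1) by (simp add: mod_Suc_eq)
  qed
  then show ?thesis using i by simp
qed

definition regular_cycles :: "'a set \<Rightarrow> ('a \<Rightarrow> 'a) \<Rightarrow> nat \<Rightarrow> bool" where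
  "regular_cycles U p l \<longleftrightarrow> (\<forall>x\<in>U. p x = x \<or> card (orbit p x) = l) \<and> (\<exists>x\<in>U. card (orbit p x) = l)"

lemma regular_cycles_funpow_eq_id:
  assumes "regular_cycles U p l" "finite U" "p permutes U"
  shows "p ^^ k = id \<longleftrightarrow> l dvd k"
proof
  have perm: "permutation p" using assms(2,3) by (rule permutes_imp_permutation)
  obtain x where x: "x \<in> U" "card (orbit p x) = l" using assms(1) by (auto simp: regular_cycles_def)
  {
    assume "p ^^ k = id"
    then show "l dvd k" using card_orbit_dvd[OF perm, of x k] x by simp
  next
    assume l: "l dvd k"
    show "p ^^ k = id"
    proof
      fix y
      have "(p ^^ k) y = y" if "p y = y" using that by (induction k) auto
      moreover have "p y = y \<or> card (orbit p y) = l"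
        using assms(1,3) by (cases "y \<in> U") (auto simp: regular_cycles_def permutes_not_in)
      ultimately show "(p ^^ k) y = id y" using card_orbit_dvd[OF perm, of y k] l by auto
    qed
  }
qed

lemma evenperm_cycle_of_list:
  assumes "cycle cs" "cs \<noteq> []"
  shows "evenperm (cycle_of_list cs) \<longleftrightarrow> odd (length cs)"
proof -
  have "swapidseq (length cs - 1) (cycle_of_list cs)"
    by (rule swapidseq_ext_imp_swapidseq[OF swapidseq_ext_of_cycles[OF assms(1)]])
  then have "evenperm (cycle_of_list cs) \<longleftrightarrow> even (length cs - 1)" by (rule evenperm_unique) simp
  then show ?thesis using assms(2) by (cases cs) auto
qed

text \<open>Two cycles of the same length have the same parity, so their product is even whatever
  the length. This is the reason for using two long vertices in the diagrams that are to
  grow.\<close>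

lemma evenperm_two_cycles:
  assumes fin: "finite U" and s: "s permutes U"
    and disj: "orbit s A \<inter> orbit s B = {}" and card: "card (orbit s A) = card (orbit s B)"
    and cover: "\<And>x. x \<in> U \<Longrightarrow> s x = x \<or> x \<in> orbit s A \<union> orbit s B"
  shows "evenperm s"
proof -
  have ps: "permutation s" using fin s by (rule permutes_imp_permutation)
  note os = orbit_conv_support[OF ps]
  have cyc: "cycle (support s x)" for x by (rule cycle_of_permutation[OF ps])
  have ne: "support s x \<noteq> []" for x using least_power_of_permutation(2)[OF ps, of x] by simp
  let ?a = "cycle_of_list (support s A)" and ?b = "cycle_of_list (support s B)"
  have "s = ?a \<circ> ?b"
  proof
    fix x
    consider "x \<in> orbit s A" | "x \<in> orbit s B" | "x \<notin> orbit s A" "x \<notin> orbit s B" "s x = x"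
      using cover[of x] permutes_not_in[OF s, of x] by blast
    then show "s x = (?a \<circ> ?b) x"
    proof cases
      case 1
      then have "?b x = x" using disj by (intro id_outside_supp) (auto simp: os[symmetric] simp del: set_map)
      then show ?thesis using 1 cycle_restrict[OF ps, of x A] by (simp add: os del: set_map)
    next
      case 2
      then have "?b x = s x" using cycle_restrict[OF ps, of x B] by (simp add: os del: set_map)
      moreover have "s x \<in> orbit s B" using 2 by (rule orbit.step)
      then have "?a (s x) = s x" using disj by (intro id_outside_supp) (auto simp: os[symmetric] simp del: set_map)
      ultimately show ?thesis by simp
    next
      case 3
      then have "?b x = x" "?a x = x" by (auto intro!: id_outside_supp simp: os[symmetric] simp del: set_map)
      then show ?thesis using 3 by simp
    qed
  qed
  moreover have "length (support s A) = length (support s B)"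
    using card by (simp add: card_orbit[OF ps])
  then have "evenperm ?a = evenperm ?b"
    unfolding evenperm_cycle_of_list[OF cyc ne] by simp
  ultimately show ?thesis by (metis evenperm_comp permutation_of_cycle)
qed

text \<open>Composing with the transposition of one exchanged pair leaves an involution that moves
  two points fewer and has the opposite parity.\<close>

lemma evenperm_involution:
  assumes "finite U" "t permutes U" "\<And>x. t (t x) = x"
  shows "\<exists>k. card {x \<in> U. t x \<noteq> x} = 2 * k \<and> (evenperm t \<longleftrightarrow> even k)"
  using assms(2,3)
proof (induction "card {x \<in> U. t x \<noteq> x}" arbitrary: t rule: less_induct)
  case less
  show ?case
  proof (cases "{x \<in> U. t x \<noteq> x} = {}")
    case True
    then have "t = id" using less.prems(1) by (auto simp: fun_eq_iff permutes_def)
    then show ?thesis using True by (intro exI[of _ 0]) auto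
  next
    case False
    then obtain x where x: "x \<in> U" "t x \<noteq> x" by blast
    define u where "u = transpose x (t x) \<circ> t"
    have tx: "t x \<in> U" using x less.prems(1) by (simp add: permutes_in_image)
    have u: "u y = (if y = x \<or> y = t x then y else t y)" for y
      using less.prems(2) x by (auto simp: u_def transpose_def) (metis less.prems(2))+
    have up: "u permutes U" unfolding u_def using less.prems(1) x tx
      by (intro permutes_compose permutes_swap_id)
    have uu: "u (u y) = y" for y using less.prems(2) by (auto simp: u) (metis less.prems(2))+
    have set: "{y \<in> U. t y \<noteq> y} = insert x (insert (t x) {y \<in> U. u y \<noteq> y})"
      using x tx less.prems(2) by (auto simp: u)
    have "x \<notin> insert (t x) {y \<in> U. u y \<noteq> y}" "t x \<notin> {y \<in> U. u y \<noteq> y}"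
      using x by (auto simp: u)
    then have card: "card {y \<in> U. t y \<noteq> y} = 2 + card {y \<in> U. u y \<noteq> y}"
      unfolding set using assms(1) by simp
    obtain k where k: "card {y \<in> U. u y \<noteq> y} = 2 * k" "evenperm u \<longleftrightarrow> even k"
      using less.hyps[OF _ up uu] card by auto
    have "t = transpose x (t x) \<circ> u" by (simp add: u_def fun_eq_iff)
    moreover have "permutation u" using assms(1) up by (rule permutes_imp_permutation)
    ultimately have "evenperm t \<longleftrightarrow> \<not> evenperm u"
      using evenperm_comp[OF permutation_swap_id, of u x "t x"] evenperm_swap[of x "t x"] x(2) by auto
    then show ?thesis using card k by (intro exI[of _ "Suc k"]) auto
  qed
qed

section \<open>Certificates read off a part of the permutations\<close>

definition comm :: "('a \<Rightarrow> 'a) \<Rightarrow> ('a \<Rightarrow> 'a) \<Rightarrow> 'a \<Rightarrow> 'a" where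
  "comm s t = s \<circ> t \<circ> inv' s \<circ> t"

text \<open>The consequences of congruence that are derivable from values of \<open>s\<close> and
  \<open>t\<close> on \<open>F\<close> alone. Being inductive, they can be carried along any
  embedding that agrees with the permutations on \<open>F\<close>; for a statement about all
  congruences this is not directly possible.\<close>

inductive near :: "('a \<Rightarrow> 'a) \<Rightarrow> ('a \<Rightarrow> 'a) \<Rightarrow> 'a set \<Rightarrow> 'a \<Rightarrow> 'a \<Rightarrow> 'a \<Rightarrow> 'a \<Rightarrow> 'a \<Rightarrow> bool"
  for s t F a b c where
  near_ab: "near s t F a b c a b"
| near_ac: "near s t F a b c a c"
| near_sym: "near s t F a b c x y \<Longrightarrow> near s t F a b c y x"
| near_trans: "near s t F a b c x y \<Longrightarrow> near s t F a b c y z \<Longrightarrow> near s t F a b c x z"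
| near_s: "near s t F a b c x y \<Longrightarrow> x \<in> F \<Longrightarrow> y \<in> F \<Longrightarrow> near s t F a b c (s x) (s y)"
| near_s_back: "near s t F a b c (s x) (s y) \<Longrightarrow> x \<in> F \<Longrightarrow> y \<in> F \<Longrightarrow> near s t F a b c x y"
| near_t: "near s t F a b c x y \<Longrightarrow> x \<in> F \<Longrightarrow> y \<in> F \<Longrightarrow> near s t F a b c (t x) (t y)"

lemma near_image:
  assumes "near s t F a b c x y"
    and "\<And>x. x \<in> F \<Longrightarrow> s' (\<iota> x) = \<iota> (s x)" "\<And>x. x \<in> F \<Longrightarrow> t' (\<iota> x) = \<iota> (t x)"
  shows "near s' t' (\<iota> ` F) (\<iota> a) (\<iota> b) (\<iota> c) (\<iota> x) (\<iota> y)"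
  using assms(1)
proof induction
  case (near_s x y) then show ?case using near.near_s[of s' t' "\<iota> ` F" _ _ _ "\<iota> x" "\<iota> y"] assms(2) by auto
next
  case (near_s_back x y) then show ?case using near.near_s_back[of s' t' "\<iota> ` F" _ _ _ "\<iota> x" "\<iota> y"] assms(2) by auto
next
  case (near_t x y) then show ?case using near.near_t[of s' t' "\<iota> ` F" _ _ _ "\<iota> x" "\<iota> y"] assms(3) by auto
qed (auto intro: near.intros)

lemma near_imp_rel:
  assumes "near s t F a b c x y" "\<And>x y. R x y \<Longrightarrow> R y x" "\<And>x y z. R x y \<Longrightarrow> R y z \<Longrightarrow> R x z"
    "\<And>x y. R (s x) (s y) \<longleftrightarrow> R x y" "\<And>x y. R x y \<Longrightarrow> R (t x) (t y)" "R a b" "R a c"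
  shows "R x y"
  using assms(1) by induction (use assms in blast)+

datatype letter = Fwd | Bwd | Flip

fun mirror :: "letter \<Rightarrow> letter" where
  "mirror Fwd = Bwd" | "mirror Bwd = Fwd" | "mirror Flip = Flip"

text \<open>A path reading \<open>w\<close> whose steps only use values at points of
  \<open>F\<close>; for a backward step this is the value at its target. The end point has to lie in
  \<open>F\<close> as well, so that the value of \<open>t\<close> there survives.\<close>

fun trail :: "('a \<Rightarrow> 'a) \<Rightarrow> ('a \<Rightarrow> 'a) \<Rightarrow> 'a set \<Rightarrow> letter list \<Rightarrow> 'a list \<Rightarrow> bool" where
  "trail s t F [] [x] \<longleftrightarrow> x \<in> F"
| "trail s t F (Fwd # w) (x # y # p) \<longleftrightarrow> x \<in> F \<and> y = s x \<and> trail s t F w (y # p)"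
| "trail s t F (Bwd # w) (x # y # p) \<longleftrightarrow> y \<in> F \<and> x = s y \<and> trail s t F w (y # p)"
| "trail s t F (Flip # w) (x # y # p) \<longleftrightarrow> x \<in> F \<and> y = t x \<and> trail s t F w (y # p)"
| "trail s t F _ _ \<longleftrightarrow> False"

fun letter_perm :: "('a \<Rightarrow> 'a) \<Rightarrow> ('a \<Rightarrow> 'a) \<Rightarrow> letter \<Rightarrow> 'a \<Rightarrow> 'a" where
  "letter_perm s t Fwd = s" | "letter_perm s t Bwd = inv' s" | "letter_perm s t Flip = t"

text \<open>Words are read from left to right along a path, so the first letter is the innermost
  factor.\<close>

fun word_perm :: "('a \<Rightarrow> 'a) \<Rightarrow> ('a \<Rightarrow> 'a) \<Rightarrow> letter list \<Rightarrow> 'a \<Rightarrow> 'a" where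
  "word_perm s t [] = id" | "word_perm s t (l # w) = word_perm s t w \<circ> letter_perm s t l"

lemma trail_last:
  assumes "inj s" "trail s t F w p"
  shows "p \<noteq> [] \<and> last p = word_perm s t w (hd p) \<and> last p \<in> F"
  using assms(2,1) by (induction s t F w p rule: trail.induct) auto

lemma trail_image:
  assumes "trail s t F w p"
    and "\<And>x. x \<in> F \<Longrightarrow> s' (\<iota> x) = \<iota> (s x)" "\<And>x. x \<in> F \<Longrightarrow> t' (\<iota> x) = \<iota> (t x)"
  shows "trail s' t' (\<iota> ` F) w (map \<iota> p)"
  using assms by (induction s t F w p rule: trail.induct) auto

lemma twin_word_perm:
  assumes "bij s"
  shows "twin s t (word_perm s t w) (word_perm s t (map mirror w))"
proof (induction w)
  case (Cons l w)
  have "twin s t (letter_perm s t l) (letter_perm s t (mirror l))"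
    using assms twin_s[of s t] twin_t[of s t] twin_inv[OF twin_s[of s t]]
    by (cases l) (simp_all add: inv_inv_eq)
  from twin_comp[OF Cons this] show ?case unfolding list.map word_perm.simps .
qed (use twin_id in \<open>simp add: id_def\<close>)

text \<open>
  An automorphism inverting \<open>s\<close> and fixing \<open>t\<close> takes a power of the commutator to the
  \<open>s\<close>-conjugate of its inverse. Here the 3-cycle on \<open>a\<close>, \<open>b\<close>, \<open>c\<close> commutes with the conjugate of
  \<open>t\<close> by the word \<open>w\<close>, because \<open>t\<close> fixes the images of these points, but the images under such an
  automorphism would not commute.
\<close>

definition chiral_at :: "('a \<Rightarrow> 'a) \<Rightarrow> ('a \<Rightarrow> 'a) \<Rightarrow> 'a set \<Rightarrow> 'a \<Rightarrow> 'a \<Rightarrow> 'a \<Rightarrow> bool" where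
  "chiral_at s t F a b c \<longleftrightarrow> (\<exists>w p q r p'. trail s t F w (a # p) \<and> trail s t F w (b # q) \<and> trail s t F w (c # r) \<and>
     t (last (a # p)) = last (a # p) \<and> t (last (b # q)) = last (b # q) \<and> t (last (c # r)) = last (c # r) \<and>
     trail s t F (Bwd # map mirror w) p' \<and> hd p' \<in> {a, b, c} \<and> t (last p') \<noteq> last p')"

lemma trail_tail_in:
  assumes "trail s t F w p" shows "last p \<in> F"
  using assms by (induction s t F w p rule: trail.induct) auto

text \<open>The end point moved by \<open>t\<close> stays moved because \<iota> is injective; the
  trails and the fixed end points are carried by the agreement on \<open>F\<close>.\<close>

lemma chiral_at_image:
  assumes "chiral_at s t F a b c" "inj \<iota>"
    and "\<And>x. x \<in> F \<Longrightarrow> s' (\<iota> x) = \<iota> (s x)" "\<And>x. x \<in> F \<Longrightarrow> t' (\<iota> x) = \<iota> (t x)"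
  shows "chiral_at s' t' (\<iota> ` F) (\<iota> a) (\<iota> b) (\<iota> c)"
proof -
  obtain w p q r p' where w: "trail s t F w (a # p)" "trail s t F w (b # q)" "trail s t F w (c # r)"
    "t (last (a # p)) = last (a # p)" "t (last (b # q)) = last (b # q)" "t (last (c # r)) = last (c # r)"
    "trail s t F (Bwd # map mirror w) p'" "hd p' \<in> {a, b, c}" "t (last p') \<noteq> last p'"
    using assms(1) unfolding chiral_at_def by blast
  note im = trail_image[where s' = s' and t' = t' and \<iota> = \<iota>, OF _ assms(3,4)]
  have ne: "p' \<noteq> []" using w(7) by (cases p') auto
  have last: "t' (last (map \<iota> z)) = \<iota> (t (last z))" if "z \<noteq> []" "trail s t F u z" for z u
    using assms(4)[OF trail_tail_in[OF that(2)]] that(1) by (simp add: last_map)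
  have fixed: "t' (last (map \<iota> z)) = last (map \<iota> z)" if "z \<noteq> []" "trail s t F u z" "t (last z) = last z" for z u
    using last[OF that(1,2)] that by (simp add: last_map)
  have "t' (last (map \<iota> p')) \<noteq> last (map \<iota> p')"
    using last[OF ne w(7)] w(9) ne assms(2) by (simp add: last_map inj_eq)
  moreover have "hd (map \<iota> p') \<in> {\<iota> a, \<iota> b, \<iota> c}" using w(8) ne by (auto simp: hd_map)
  ultimately show ?thesis
    unfolding chiral_at_def
    using im[OF w(1)] im[OF w(2)] im[OF w(3)] im[OF w(7)]
      fixed[OF _ w(1,4)] fixed[OF _ w(2,5)] fixed[OF _ w(3,6)]
    by (intro exI[of _ w] exI[of _ "map \<iota> p"] exI[of _ "map \<iota> q"] exI[of _ "map \<iota> r"] exI[of _ "map \<iota> p'"]) simp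
qed

text \<open>On the three points only the residue of \<open>N\<close> modulo 3 counts. As this is 1
  or 2, the power is the 3-cycle or its inverse.\<close>

lemma three_cycle_power:
  assumes g: "g a = b" "g b = c" "g c = a" and d: "a \<noteq> b" "b \<noteq> c" "a \<noteq> c"
    and N: "\<not> 3 dvd N" "\<And>y. y \<notin> {a, b, c} \<Longrightarrow> (g ^^ N) y = y"
  shows "g ^^ N = c3 a b c \<or> g ^^ N = c3 a c b"
proof -
  have cyc: "(g ^^ 3) a = a" "(g ^^ 3) b = b" "(g ^^ 3) c = c"
    using g by (simp_all add: numeral_3_eq_3)
  then have red: "(g ^^ N) a = (g ^^ (N mod 3)) a" "(g ^^ N) b = (g ^^ (N mod 3)) b" "(g ^^ N) c = (g ^^ (N mod 3)) c"
    by (simp_all add: funpow_mod_eq)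
  have "N mod 3 = 1 \<or> N mod 3 = 2" using N(1) by (auto simp: dvd_eq_mod_eq_0)
  then show ?thesis
  proof
    assume "N mod 3 = 1"
    then have "g ^^ N = c3 a b c" using red g N(2) d by (auto simp: fun_eq_iff c3_apply)
    then show ?thesis ..
  next
    assume "N mod 3 = 2"
    then have "g ^^ N = c3 a c b" using red g N(2) d by (auto simp: fun_eq_iff c3_apply numeral_2_eq_2)
    then show ?thesis ..
  qed
qed

lemma twin_power: "twin s t u u' \<Longrightarrow> twin s t (u ^^ k) (u' ^^ k)"
proof (induction k)
  case 0 then show ?case using twin_id by (simp add: id_def)
next
  case (Suc k) then show ?case using twin_comp[of s t u u' "u ^^ k" "u' ^^ k"] by (simp add: comp_def)
qed

text \<open>
  The later insertions of points change \<open>s\<close> and \<open>t\<close> only outside \<open>F\<close>, so that the certificates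
  \<open>near\<close> and \<open>chiral_at\<close> remain valid.
\<close>

locale coset_diagram =
  fixes U :: "'a set" and s t :: "'a \<Rightarrow> 'a" and F :: "'a set" and a b c :: 'a
  assumes fin: "finite U" and s: "s permutes U" and t: "t permutes U" and tt: "\<And>x. t (t x) = x"
    and conn: "connected_on U s t" and FU: "F \<subseteq> U"
    and abc: "a \<in> U" "b \<in> U" "c \<in> U" "a \<noteq> b" "b \<noteq> c" "a \<noteq> c"
    and g_abc: "comm s t a = b" "comm s t b = c" "comm s t c = a" and ta: "t a = c"
    and power: "\<exists>N. \<not> 3 dvd N \<and> (\<forall>x\<in>U. x \<notin> {a, b, c} \<longrightarrow> (comm s t ^^ N) x = x)"
    and near: "\<exists>x\<in>F. near s t F a b c a x \<and> near s t F a b c a (s x)"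
    and chir: "chiral_at s t F a b c"
    and moved: "4 dvd card {x \<in> U. t x \<noteq> x}"
begin

lemma perm_s: "permutation s" using fin s by (rule permutes_imp_permutation)

lemma inv_s [simp]: "inv' s (s x) = x" "s (inv' s x) = x"
  using permutes_inverses[OF s] by simp_all

lemma comm_permutes: "comm s t permutes U"
  unfolding comm_def using s t by (intro permutes_compose permutes_inv)

lemma comm_eq: "comm s t x = s (t (inv' s (t x)))"
  by (simp add: comm_def)

text \<open>The clause for \<open>t\<close> follows from \<open>t a = c\<close>, since
  \<open>a\<close> and \<open>c\<close> both lie on the 3-cycle. Only the clause for
  \<open>s\<close> draws on the certificate \<open>near\<close>.\<close>

lemma linked: "linked s t a b c"
  unfolding linked_def
proof (intro allI impI)
  fix R :: "'a \<Rightarrow> 'a \<Rightarrow> bool"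
  assume R: "\<forall>x y. R x y \<longrightarrow> R y x" "\<forall>x y z. R x y \<longrightarrow> R y z \<longrightarrow> R x z"
    "\<forall>x y. R (s x) (s y) = R x y" "\<forall>x y. R x y \<longrightarrow> R (t x) (t y)" "R a b" "R a c"
  have "R x y" if "near s t F a b c x y" for x y
    using that R by (intro near_imp_rel[of s t F a b c x y R]) blast+
  moreover have "R a a" using R by blast
  ultimately show "(\<exists>x. R a x \<and> R a (s x)) \<and> (\<exists>x. R a x \<and> R a (t x))"
    using near R(6) ta by metis
qed

lemma twin_comm: "twin s t (comm s t) (inv' s \<circ> t \<circ> s \<circ> t)"
proof -
  have bs: "bij s" using s by (rule permutes_bij)
  have "twin s t (inv' s) s"
    using twin_inv[OF twin_s[of s t]] bs by (simp add: inv_inv_eq)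
  then show ?thesis
    unfolding comm_def by (intro twin_comp twin_s twin_t)
qed

text \<open>Inverting \<open>s\<close> in the commutator gives
  \<open>inv' s \<circ> t \<circ> s \<circ> t\<close>, which is the inverse commutator conjugated by
  \<open>s\<close>. The same relation passes to all powers, so the partner of the 3-cycle is known
  explicitly.\<close>

lemma three_cycle_twin:
  "\<exists>x x'. twin s t x x' \<and> (x = c3 a b c \<or> x = c3 a c b) \<and> x' = inv' s \<circ> inv' x \<circ> s"
proof -
  obtain N where N: "\<not> 3 dvd N" "\<And>x. x \<in> U \<Longrightarrow> x \<notin> {a, b, c} \<Longrightarrow> (comm s t ^^ N) x = x"
    using power by blast
  let ?g = "comm s t"
  define x where "x = ?g ^^ N"
  have out: "(?g ^^ N) y = y" if "y \<notin> {a, b, c}" for y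
  proof (cases "y \<in> U")
    case True then show ?thesis using N(2) that by simp
  next
    case False
    then have "?g y = y" using comm_permutes permutes_not_in by metis
    then show ?thesis by (induction N) auto
  qed
  have x3: "x = c3 a b c \<or> x = c3 a c b"
    unfolding x_def by (rule three_cycle_power[OF g_abc abc(4-6) N(1) out])
  let ?h = "inv' s \<circ> t \<circ> s \<circ> t"
  have "inv' ?g = t \<circ> s \<circ> t \<circ> inv' s"
    by (rule inv_unique_comp) (auto simp: fun_eq_iff comm_def tt)
  then have h: "?h = inv' s \<circ> inv' ?g \<circ> s" by (simp add: fun_eq_iff)
  have "?h ^^ k = inv' s \<circ> inv' (?g ^^ k) \<circ> s" for k
  proof (induction k)
    case 0 then show ?case by (simp add: fun_eq_iff inv_id[unfolded id_def] id_def)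
  next
    case (Suc k)
    have bg: "bij ?g" "bij (?g ^^ k)"
      using comm_permutes permutes_funpow[OF comm_permutes] by (auto intro: permutes_bij)
    have "inv' (?g ^^ Suc k) = inv' ?g \<circ> inv' (?g ^^ k)"
      using bg by (simp only: funpow_Suc_right o_inv_distrib)
    then have e: "inv' ?g \<circ> inv' (?g ^^ k) = inv' (?g ^^ Suc k)" by (rule sym)
    have "?h ^^ Suc k = ?h \<circ> (inv' s \<circ> inv' (?g ^^ k) \<circ> s)"
      by (simp only: funpow.simps(2) Suc.IH)
    also have "\<dots> = inv' s \<circ> (inv' ?g \<circ> inv' (?g ^^ k)) \<circ> s"
      unfolding h by (simp add: fun_eq_iff)
    finally show ?case unfolding e .
  qed
  then have "?h ^^ N = inv' s \<circ> inv' x \<circ> s" by (simp only: x_def)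
  moreover have "twin s t x (?h ^^ N)" unfolding x_def by (rule twin_power[OF twin_comm])
  ultimately show ?thesis using x3 by metis
qed

end

text \<open>If \<open>y\<close> moved one of the three points, it would commute with the 3-cycle and
  therefore act on these points as a nontrivial power of it; but such a power has order 3.\<close>

lemma involution_moving_three_cycle:
  fixes y :: "'a \<Rightarrow> 'a"
  assumes d: "i \<noteq> j" "j \<noteq> k" "i \<noteq> k" and yy: "\<And>z. y (y z) = z"
    and com: "\<And>z. y (c3 i j k z) = c3 i j k (y z)" and q: "q \<in> {i, j, k}"
  shows "y q = q"
proof (rule ccontr)
  let ?x = "c3 i j k"
  assume ne: "y q \<noteq> q"
  have q_moved: "?x q \<noteq> q" and x3: "?x (?x (?x z)) = z" for z
    using d q by (auto simp: c3_apply)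
  have "?x (y q) \<noteq> y q" using com[of q] q_moved yy by metis
  then have "y q \<in> {i, j, k}" using d by (auto simp: c3_apply split: if_splits)
  then have "y q = ?x q \<or> y q = ?x (?x q)" using ne q d by (auto simp: c3_apply split: if_splits)
  then have "?x (?x q) = q \<or> ?x (?x (?x (?x q))) = q" using com[of q] com[of "?x q"] yy[of q] by metis
  then show False using q_moved x3 by metis
qed

theorem chiral_alternating_of_diagram:
  fixes U :: "nat set"
  assumes D: "coset_diagram U s t F a b c"
    and vert: "regular_cycles U s n" "evenperm s" and faces: "regular_cycles U (s \<circ> t) m"
  shows "chiral_alternating m n"
proof -
  interpret coset_diagram U s t F a b c by fact
  have bs: "bij s" using s by (rule permutes_bij)
  obtain x x' where tx: "twin s t x x'" and x: "x = c3 a b c \<or> x = c3 a c b"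
    and x': "x' = inv' s \<circ> inv' x \<circ> s"
    using three_cycle_twin by blast
  obtain w p q r p' where w: "trail s t F w (a # p)" "trail s t F w (b # q)" "trail s t F w (c # r)"
    "t (last (a # p)) = last (a # p)" "t (last (b # q)) = last (b # q)" "t (last (c # r)) = last (c # r)"
    "trail s t F (Bwd # map mirror w) p'" "hd p' \<in> {a, b, c}" "t (last p') \<noteq> last p'"
    using chir unfolding chiral_at_def by blast
  define u where "u = word_perm s t w"
  define u' where "u' = word_perm s t (map mirror w)"
  have tu: "twin s t u u'" unfolding u_def u'_def by (rule twin_word_perm[OF bs])
  have bij_letter: "bij (letter_perm s t l)" for l
    using bs t by (cases l) (auto simp: bij_imp_bij_inv permutes_bij)
  have bij_word: "bij (word_perm s t v)" for v
  proof (induction v)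
    case Nil show ?case using bij_id by (simp add: id_def)
  next
    case (Cons l v) then show ?case unfolding word_perm.simps by (intro bij_comp bij_letter)
  qed
  have bu: "bij u" "bij u'" unfolding u_def u'_def by (rule bij_word)+
  have bx: "bij x" using x abc c3_permutes[of a "{a, b, c}" b c] c3_permutes[of a "{a, b, c}" c b]
    by (auto intro: permutes_bij)
  have iu [simp]: "inv' u (u z) = z" "u (inv' u z) = z"
    "inv' u' (u' z) = z" "u' (inv' u' z) = z" for z
    using bu by (simp_all add: bij_is_inj bij_is_surj surj_f_inv_f)
  have ix [simp]: "inv' x (x z) = z" "x (inv' x z) = z" for z
    using bx by (simp_all add: bij_is_inj bij_is_surj surj_f_inv_f)
  define k where "k = inv' u \<circ> t \<circ> u"
  define k' where "k' = inv' u' \<circ> t \<circ> u'"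
  have tk: "twin s t k k'" unfolding k_def k'_def by (intro twin_comp twin_inv tu twin_t)
  have kk: "k (k z) = z" "k' (k' z) = z" for z by (simp_all add: k_def k'_def tt)
  have ik: "inv' k = k" "inv' k' = k'"
    by (rule inv_unique_comp; simp add: fun_eq_iff kk)+
  have fixed: "k a = a" "k b = b" "k c = c"
    using trail_last[OF bij_is_inj[OF bs] w(1)] trail_last[OF bij_is_inj[OF bs] w(2)]
      trail_last[OF bij_is_inj[OF bs] w(3)] w(4-6) by (simp_all add: k_def u_def[symmetric])
  have kx: "k (x z) = x (k z)" for z
  proof (cases "z \<in> {a, b, c}")
    case True
    then show ?thesis using x fixed abc(4-6) by (auto simp: c3_apply)
  next
    case False
    then have "k z \<notin> {a, b, c}" using fixed kk by (metis insert_iff singletonD)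
    then show ?thesis using False x abc(4-6) by (auto simp: c3_apply)
  qed
  \<comment> \<open>\<open>k\<close> fixes \<open>a\<close>, \<open>b\<close> and \<open>c\<close>,
    so it commutes with \<open>x\<close> and \<open>v\<close> is trivial. It remains to see that its
    partner \<open>v'\<close> is not.\<close>
  define v where "v = x \<circ> k \<circ> inv' x \<circ> inv' k"
  define v' where "v' = x' \<circ> k' \<circ> inv' x' \<circ> inv' k'"
  have "twin s t v v'" unfolding v_def v'_def by (intro twin_comp twin_inv tx tk)
  moreover have "v z = z" for z
    using kx[of "inv' x (k z)"] kx[of z] kk by (simp add: v_def ik)
  then have "v = id" by (simp add: fun_eq_iff)
  ultimately have tv: "twin s t id v'" by simp
  have "v' \<noteq> id"
  proof
    assume v': "v' = id"
    have bx': "bij x'" unfolding x' using bs bx by (intro bij_comp bij_imp_bij_inv)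
    have com': "x' (k' z) = k' (x' z)" for z
    proof -
      have "v' (k' (x' z)) = k' (x' z)" using v' by simp
      then show ?thesis using bx' kk by (simp add: v'_def ik bij_is_inj)
    qed
    \<comment> \<open>Conjugation by \<open>s\<close> turns \<open>x'\<close> back into the inverse
      of \<open>x\<close>. This shift is the source of the leading \<open>Bwd\<close> in the
      mirrored trail.\<close>
    define y where "y = s \<circ> k' \<circ> inv' s"
    have yy: "y (y z) = z" for z by (simp add: y_def kk)
    have y_inv: "inv' x (y z) = y (inv' x z)" for z
      using arg_cong[OF com'[of "inv' s z"], of s] by (simp add: y_def x')
    have yx: "y (x z) = x (y z)" for z using y_inv[of "x z"] by (metis ix)
    let ?q = "hd p'"
    have "last p' = u' (inv' s ?q)"
      using trail_last[OF bij_is_inj[OF bs] w(7)] by (simp add: u'_def)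
    then have "k' (inv' s ?q) \<noteq> inv' s ?q"
      using w(9) unfolding k'_def by (metis comp_apply iu(4))
    then have "y ?q \<noteq> ?q" unfolding y_def by (metis comp_apply inv_s(1))
    moreover have "y ?q = ?q" using x
    proof
      assume "x = c3 a b c"
      then show ?thesis using yx yy w(8) abc(4-6) by (intro involution_moving_three_cycle[of a b c y]) auto
    next
      assume "x = c3 a c b"
      then show ?thesis using yx yy w(8) abc(4-6) by (intro involution_moving_three_cycle[of a c b y]) auto
    qed
    ultimately show False by simp
  qed
  obtain j where "card {x \<in> U. t x \<noteq> x} = 2 * j" "evenperm t \<longleftrightarrow> even j"
    using evenperm_involution[OF fin t tt] by blast
  then have et: "evenperm t" using moved by auto
  have "t \<noteq> id" using ta abc by auto
  have twin_c3: "\<exists>x'. twin s t (c3 a b c) x'"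
    using x
  proof
    assume "x = c3 a c b"
    moreover have "c3 a c b \<circ> c3 a c b = c3 a b c" using abc(4-6) by (auto simp: fun_eq_iff c3_apply)
    ultimately show ?thesis using twin_comp[OF tx tx] by metis
  qed (use tx in blast)
  then obtain x'' where x'': "twin s t (c3 a b c) x''" by blast
  show ?thesis
    by (rule chiral_alternating_criterion[OF fin s vert(2) t et tt \<open>t \<noteq> id\<close>
          regular_cycles_funpow_eq_id[OF vert(1) fin s]
          regular_cycles_funpow_eq_id[OF faces fin permutes_compose[OF t s]]
          conn abc x'' linked tv \<open>v' \<noteq> id\<close>])
qed

lemma not_three_dvd_mult: "\<not> 3 dvd m \<Longrightarrow> \<not> 3 dvd n \<Longrightarrow> \<not> 3 dvd m * (n::nat)"
proof -
  assume "\<not> 3 dvd m" "\<not> 3 dvd n"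
  then have "m mod 3 = 1 \<or> m mod 3 = 2" "n mod 3 = 1 \<or> n mod 3 = 2"
    by (auto simp: dvd_eq_mod_eq_0)
  then have "(m mod 3) * (n mod 3) mod 3 \<noteq> 0" by auto
  then show ?thesis by (simp add: dvd_eq_mod_eq_0 mod_mult_eq)
qed

text \<open>\<open>E\<close> collects the old points whose commutator cycles are altered by an
  insertion; outside \<open>E\<close> the commutator is copied by \<iota>. The power
  \<open>k\<close> kills all remaining points, new ones and images of points of \<open>E\<close>
  alike, so the product of \<open>k\<close> with the old exponent isolates the 3-cycle again.
  Connectedness is inherited because every new point lies on an \<open>s'\<close>-cycle through an
  old one.\<close>

lemma (in coset_diagram) extend:
  assumes inj: "inj \<iota>" and fin': "finite U'" and s': "s' permutes U'" and t': "t' permutes U'"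
    and tt': "\<And>z. t' (t' z) = z" and \<iota>U: "\<iota> ` U \<subseteq> U'"
    and agree: "\<And>x. x \<in> F \<Longrightarrow> s' (\<iota> x) = \<iota> (s x)" "\<And>x. x \<in> F \<Longrightarrow> t' (\<iota> x) = \<iota> (t x)"
    and ta': "t' (\<iota> a) = \<iota> c"
    and E: "{a, b, c} \<inter> E = {}" "\<And>x. x \<in> U - E \<Longrightarrow> comm s t x \<notin> E"
    and g': "\<And>x. x \<in> U - E \<Longrightarrow> comm s' t' (\<iota> x) = \<iota> (comm s t x)"
    and k: "\<not> 3 dvd k" "\<And>z. z \<in> U' \<Longrightarrow> z \<notin> \<iota> ` (U - E) \<Longrightarrow> (comm s' t' ^^ k) z = z"
    and orb: "\<And>x. x \<in> U \<Longrightarrow> \<iota> (s x) \<in> orbit s' (\<iota> x)"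
      "\<And>x. x \<in> U \<Longrightarrow> \<iota> (t x) \<in> orbit s' (t' (\<iota> x))"
      "\<And>z. z \<in> U' \<Longrightarrow> \<exists>x\<in>U. z \<in> orbit s' (\<iota> x)"
    and moved': "4 dvd card {z \<in> U'. t' z \<noteq> z}"
  shows "coset_diagram U' s' t' (\<iota> ` F) (\<iota> a) (\<iota> b) (\<iota> c)"
proof
  have perm_s': "permutation s'" using fin' s' by (rule permutes_imp_permutation)
  have not_E: "a \<in> U - E" "b \<in> U - E" "c \<in> U - E" using E(1) abc by auto
  show "comm s' t' (\<iota> a) = \<iota> b" "comm s' t' (\<iota> b) = \<iota> c" "comm s' t' (\<iota> c) = \<iota> a"
    using g' not_E g_abc by simp_all
  show "\<iota> a \<in> U'" "\<iota> b \<in> U'" "\<iota> c \<in> U'" using \<iota>U abc by auto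
  show "\<iota> a \<noteq> \<iota> b" "\<iota> b \<noteq> \<iota> c" "\<iota> a \<noteq> \<iota> c" using inj abc by (auto dest: injD)
  show "\<iota> ` F \<subseteq> U'" using FU \<iota>U by blast
  show "connected_on U' s' t'"
    unfolding connected_on_def
  proof (intro allI impI)
    fix S assume S: "S \<subseteq> U'" "S \<noteq> {}" "s' ` S \<subseteq> S" "t' ` S \<subseteq> S"
    have closed: "orbit s' z \<subseteq> S" if "z \<in> S" for z using S(3) that by (rule orbit_subset_closed)
    \<comment> \<open>\<open>s'\<close> and \<open>t'\<close> follow \<open>s\<close> and
      \<open>t\<close> only up to a movement along cycles of \<open>s'\<close>, which does no harm
      because \<open>S\<close> is a union of such cycles.\<close>
    define P where "P = {x \<in> U. \<iota> x \<in> S}"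
    obtain z where z: "z \<in> S" using S(2) by blast
    obtain x where x: "x \<in> U" "z \<in> orbit s' (\<iota> x)" using orb(3) z S(1) by blast
    have "\<iota> x \<in> S" using closed[OF z] orbit_sym[OF perm_s' x(2)] by blast
    then have "P \<noteq> {}" using x by (auto simp: P_def)
    moreover have "s ` P \<subseteq> P"
      using closed orb(1) s by (auto simp: P_def permutes_in_image)
    moreover have "t ` P \<subseteq> P"
      using closed orb(2) t S(4) by (auto simp: P_def permutes_in_image)
    ultimately have "P = U" using conn[unfolded connected_on_def, rule_format, of P] by (auto simp: P_def)
    then have "U' \<subseteq> S" using orb(3) closed by (fastforce simp: P_def)
    then show "S = U'" using S(1) by blast
  qed
  obtain N where N: "\<not> 3 dvd N" "\<And>x. x \<in> U \<Longrightarrow> x \<notin> {a, b, c} \<Longrightarrow> (comm s t ^^ N) x = x"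
    using power by blast
  have iter: "(comm s' t' ^^ j) (\<iota> x) = \<iota> ((comm s t ^^ j) x) \<and> (comm s t ^^ j) x \<in> U - E" if "x \<in> U - E" for x j
  proof (induction j)
    case 0 then show ?case using that by simp
  next
    case (Suc j) then show ?case using g' E(2) comm_permutes by (auto simp: permutes_in_image)
  qed
  show "\<exists>N. \<not> 3 dvd N \<and> (\<forall>z\<in>U'. z \<notin> {\<iota> a, \<iota> b, \<iota> c} \<longrightarrow> (comm s' t' ^^ N) z = z)"
  proof (intro exI[of _ "N * k"] conjI ballI impI)
    show "\<not> 3 dvd N * k" using N(1) k(1) by (rule not_three_dvd_mult)
    have rep: "(f ^^ (i * j)) z = z" if "(f ^^ i) z = z" for f :: "'x \<Rightarrow> 'x" and z i j
      using that by (induction j) (simp_all add: funpow_add)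
    fix z assume z: "z \<in> U'" "z \<notin> {\<iota> a, \<iota> b, \<iota> c}"
    show "(comm s' t' ^^ (N * k)) z = z"
    proof (cases "z \<in> \<iota> ` (U - E)")
      case True
      then obtain x where x: "x \<in> U - E" "z = \<iota> x" by blast
      then have "(comm s t ^^ N) x = x" using N(2) z by auto
      then show ?thesis using iter[OF x(1), of "N * k"] rep x by metis
    next
      case False
      then show ?thesis using k(2) z rep[of k _ z N] by (simp add: mult.commute)
    qed
  qed
  obtain x where x: "x \<in> F" "near s t F a b c a x" "near s t F a b c a (s x)" using near by blast
  note im = near_image[where s' = s' and t' = t' and \<iota> = \<iota>, OF _ agree]
  show "\<exists>x\<in>\<iota> ` F. near s' t' (\<iota> ` F) (\<iota> a) (\<iota> b) (\<iota> c) (\<iota> a) x \<and>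
      near s' t' (\<iota> ` F) (\<iota> a) (\<iota> b) (\<iota> c) (\<iota> a) (s' x)"
    using im[OF x(2)] im[OF x(3)] x(1) agree(1)[OF x(1)] by (intro bexI[of _ "\<iota> x"]) auto
  show "chiral_at s' t' (\<iota> ` F) (\<iota> a) (\<iota> b) (\<iota> c)"
    using chir inj agree by (rule chiral_at_image)
qed (use fin' s' t' tt' ta' moved' in auto)

section \<open>Inserting points into the cycles of a permutation\<close>

definition tower :: "'a set \<Rightarrow> ('a \<Rightarrow> nat) \<Rightarrow> ('a \<times> nat) set" where
  "tower U h = {(x, i). x \<in> U \<and> i \<le> h x}"

lemma mem_tower [simp]: "(x, i) \<in> tower U h \<longleftrightarrow> x \<in> U \<and> i \<le> h x"
  by (simp add: tower_def)

lemma finite_tower: "finite U \<Longrightarrow> finite (tower U h)"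
proof -
  assume "finite U"
  moreover have "tower U h = Sigma U (\<lambda>x. {..h x})" by auto
  ultimately show ?thesis by simp
qed

text \<open>The new points over \<open>x\<close> follow \<open>x\<close> in its cycle: a column is
  climbed to its top before the next old point is reached.\<close>

definition climb :: "'a set \<Rightarrow> ('a \<Rightarrow> nat) \<Rightarrow> ('a \<Rightarrow> 'a) \<Rightarrow> 'a \<times> nat \<Rightarrow> 'a \<times> nat" where
  "climb U h s z = (case z of (x, i) \<Rightarrow>
     if x \<in> U \<and> i \<le> h x then (if i < h x then (x, Suc i) else (s x, 0)) else (x, i))"

lemma climb_permutes:
  assumes s: "s permutes U"
  shows "climb U h s permutes tower U h"
    and inv_climb: "x \<in> U \<Longrightarrow> i \<le> h x \<Longrightarrow> inv' (climb U h s) (x, i) =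
      (if i = 0 then (inv' s x, h (inv' s x)) else (x, i - 1))"
proof -
  let ?i = "inv' s"
  note inv = permutes_inverses[OF s]
  have mem: "s x \<in> U \<longleftrightarrow> x \<in> U" "?i x \<in> U \<longleftrightarrow> x \<in> U" for x
    using permutes_in_image[OF s] permutes_in_image[OF permutes_inv[OF s]] by blast+
  define d where "d z = (case z of (x, i) \<Rightarrow>
     if x \<in> U \<and> i \<le> h x then (if i = 0 then (?i x, h (?i x)) else (x, i - 1)) else (x, i))" for z
  have dc: "d (climb U h s z) = z" "climb U h s (d z) = z" for z
    by (auto simp: d_def climb_def mem inv split: prod.split)
  then have "bij (climb U h s)" by (metis bijI' )
  moreover have "climb U h s z = z" if "z \<notin> tower U h" for z
    using that by (cases z) (auto simp: climb_def)
  ultimately show "climb U h s permutes tower U h"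
    unfolding permutes_def by (metis bij_pointE)
  have "inv' (climb U h s) = d"
    by (rule inv_unique_comp) (simp_all add: fun_eq_iff dc)
  then show "inv' (climb U h s) (x, i) = (if i = 0 then (?i x, h (?i x)) else (x, i - 1))"
    if "x \<in> U" "i \<le> h x" using that by (simp add: d_def)
qed

lemma orbit_climb:
  assumes fin: "finite U" and s: "s permutes U" and x: "x \<in> U"
  shows "orbit (climb U h s) (x, 0) = Sigma (orbit s x) (\<lambda>y. {..h y})"
proof
  let ?c = "climb U h s"
  have ps: "permutation s" using fin s by (rule permutes_imp_permutation)
  have pc: "permutation ?c"
    using finite_tower[OF fin] climb_permutes(1)[OF s] by (rule permutes_imp_permutation)
  have OU: "orbit s x \<subseteq> U" by (rule orbit_subset_closed) (use s x in \<open>auto simp: permutes_in_image\<close>)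
  show "orbit ?c (x, 0) \<subseteq> Sigma (orbit s x) (\<lambda>y. {..h y})"
    by (rule orbit_subset_closed)
      (use OU permutation_self_in_orbit[OF ps] in \<open>auto simp: climb_def split: if_splits intro: orbit.step\<close>)
  have up: "(y, j) \<in> orbit ?c (x, 0)" if "(y, 0) \<in> orbit ?c (x, 0)" "y \<in> U" "j \<le> h y" for y j
    using that(3)
  proof (induction j)
    case (Suc j)
    then have "?c (y, j) \<in> orbit ?c (x, 0)" by (intro orbit.step) simp
    moreover have "?c (y, j) = (y, Suc j)" using Suc.prems that(2) by (simp add: climb_def)
    ultimately show ?case by simp
  qed (use that in simp)
  have next0: "(s y, 0) \<in> orbit ?c (x, 0)" if "(y, 0) \<in> orbit ?c (x, 0)" "y \<in> U" for y
  proof -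
    have "?c (y, h y) \<in> orbit ?c (x, 0)" using up[OF that, of "h y"] by (intro orbit.step) simp
    then show ?thesis using that(2) by (simp add: climb_def)
  qed
  have "(y, 0) \<in> orbit ?c (x, 0)" if "y \<in> orbit s x" for y
    using that
  proof induction
    case base then show ?case using next0[of x] permutation_self_in_orbit[OF pc] x by blast
  next
    case (step y) then show ?case using next0[of y] OU by blast
  qed
  then show "Sigma (orbit s x) (\<lambda>y. {..h y}) \<subseteq> orbit ?c (x, 0)" using up OU by auto
qed

lemma card_orbit_climb:
  assumes "finite U" "s permutes U" "x \<in> U"
  shows "card (orbit (climb U h s) (x, 0)) = card (orbit s x) + sum h (orbit s x)"
proof -
  have "finite (orbit s x)"
    using finite_orbit[OF permutation_self_in_orbit[OF permutes_imp_permutation[OF assms(1,2)]]] .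
  then show ?thesis
    unfolding orbit_climb[OF assms] by (simp add: card_SigmaI sum.distrib[symmetric] sum_Suc add.commute)
qed

text \<open>A rung is an edge joining the two long vertices. Its ends avoid \<open>F\<close>, so it
  can be replaced by a ladder without disturbing the certificates.\<close>

locale rung_diagram = coset_diagram U s t F a b c
  for U :: "'a set" and s t F a b c +
  fixes A B :: 'a and n :: nat
  assumes AB: "A \<in> U" "B \<in> U" "t A = B" "A \<notin> F" "B \<notin> F"
    and orbits_AB: "orbit s A \<inter> orbit s B = {}" "card (orbit s A) = n" "card (orbit s B) = n"
      "\<And>x. x \<in> U \<Longrightarrow> s x = x \<or> x \<in> orbit s A \<union> orbit s B"
begin

lemma A_ne_B: "A \<noteq> B"
  using orbits_AB(1) permutation_self_in_orbit[OF perm_s] by blast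

lemma tB: "t B = A"
  using tt AB(3) by metis

lemma evenperm_s: "evenperm s"
  using evenperm_two_cycles[OF fin s orbits_AB(1) _ orbits_AB(4)] orbits_AB(2,3) by simp

lemma vertices: "regular_cycles U s n"
  unfolding regular_cycles_def
proof (intro conjI ballI bexI)
  fix x assume "x \<in> U"
  then show "s x = x \<or> card (orbit s x) = n"
    using orbits_AB orbit_eq_iff_mem[OF perm_s] by (metis Un_iff)
qed (use AB orbits_AB in auto)

text \<open>After an insertion behind both ends, the last edge of the ladder joins the top of one
  column to the bottom of the other. It becomes the rung at which the next ladder is
  inserted.\<close>

lemma rung_diagram_climb:
  assumes D: "coset_diagram (tower U h) (climb U h s) u F' a' b' c'"
    and h: "\<And>x. h x = (if x = A \<or> x = B then l else 0)"
    and u: "u (A, l) = (B, 0)" and F': "(A, l) \<notin> F'" "(B, 0) \<notin> F'"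
  shows "rung_diagram (tower U h) (climb U h s) u F' a' b' c' (A, l) (B, 0) (n + l)"
proof (intro rung_diagram.intro D rung_diagram_axioms.intro)
  let ?s = "climb U h s"
  have self: "x \<in> orbit s x" for x by (rule permutation_self_in_orbit[OF perm_s])
  have card_vertex: "card (orbit ?s (x, 0)) = n + l" if x: "x \<in> {A, B}" for x
  proof -
    have xU: "x \<in> U" using x AB by auto
    have fO: "finite (orbit s x)" using finite_orbit[OF self] .
    have "orbit s x \<inter> {A, B} = {x}" using x self[of A] self[of B] orbits_AB(1) by auto
    moreover have "sum h (orbit s x) = sum h (orbit s x \<inter> {A, B})"
      by (rule sum.mono_neutral_right) (use fO h in auto)
    ultimately have "sum h (orbit s x) = l" using x h by auto
    then show ?thesis using card_orbit_climb[OF fin s xU, of h] orbits_AB(2,3) x by auto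
  qed
  have ps: "permutation ?s"
    using finite_tower[OF fin] climb_permutes(1)[OF s] by (rule permutes_imp_permutation)
  have top_orbit: "orbit ?s (A, l) = orbit ?s (A, 0)"
    by (rule orbit_eq_iff_mem[OF ps]) (use AB self in \<open>simp add: orbit_climb[OF fin s] h\<close>)
  show "(A, l) \<in> tower U h" "(B, 0) \<in> tower U h" using AB by (auto simp: h)
  show "orbit ?s (A, l) \<inter> orbit ?s (B, 0) = {}"
    unfolding top_orbit using orbits_AB(1) AB(1,2) by (auto simp: orbit_climb[OF fin s])
  show "card (orbit ?s (A, l)) = n + l" "card (orbit ?s (B, 0)) = n + l"
    unfolding top_orbit using card_vertex by simp_all
  show "?s z = z \<or> z \<in> orbit ?s (A, l) \<union> orbit ?s (B, 0)" if z: "z \<in> tower U h" for z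
  proof -
    obtain x i where xi: "z = (x, i)" "x \<in> U" "i \<le> h x" using z by (cases z) auto
    show ?thesis
    proof (cases "x \<in> orbit s A \<union> orbit s B")
      case True then show ?thesis unfolding top_orbit using xi AB by (auto simp: orbit_climb[OF fin s])
    next
      case False
      then have "s x = x" "h x = 0" using orbits_AB(4) xi(2) self h by auto
      then show ?thesis using xi by (simp add: climb_def)
    qed
  qed
qed (fact u F')+

end

text \<open>With the neighbours of the rung fixed by \<open>t\<close>, the commutator exchanges
  \<open>A\<close> with \<open>B\<close> and \<open>s A\<close> with \<open>s B\<close>. These are
  the only old cycles that a ladder alters, and they have to avoid the 3-cycle.\<close>

locale runged_diagram = rung_diagram U s t F a b c A B n
  for U :: "'a set" and s t F a b c A B and m n :: nat +
  assumes free_AB: "t (s A) = s A" "t (s B) = s B"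
      "t (inv' s A) = inv' s A" "t (inv' s B) = inv' s B"
    and abc_AB: "{a, b, c} \<inter> {A, B, s A, s B} = {}"
    and faces: "regular_cycles U (s \<circ> t) m"

lemma chiral_alternating_of_runged:
  fixes U :: "nat set"
  assumes "runged_diagram U s t F a b c A B m n"
  shows "chiral_alternating m n"
proof -
  interpret runged_diagram U s t F a b c A B m n by fact
  show ?thesis
    by (rule chiral_alternating_of_diagram[OF coset_diagram_axioms vertices evenperm_s faces])
qed

section \<open>Lengthening the vertex cycles and the faces\<close>

lemma involution_permutes:
  assumes "\<And>z. t (t z) = z" "\<And>z. z \<notin> S \<Longrightarrow> t z = z"
  shows "t permutes S"
  unfolding permutes_def using assms by metis

lemma (in runged_diagram) face_B: "(s \<circ> t) B \<noteq> B"
  using free_AB(1) A_ne_B AB(3) tB by auto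

text \<open>One mark on every nontrivial face and \<open>d\<close> marks on each long vertex:
  inserting the same number of points at all marks lengthens the faces equally and the two vertices
  equally.\<close>

locale marked_diagram = runged_diagram U s t F a b c A B m n
  for U :: "'a set" and s t F a b c A B m n +
  fixes Y :: "'a set" and d :: nat
  assumes X_props: "Y \<subseteq> U" "Y \<inter> F = {}" "\<And>x. x \<in> Y \<Longrightarrow> t x = x" "\<And>x. x \<in> Y \<Longrightarrow> s x \<noteq> x"
    and X_AB: "card (Y \<inter> orbit s A) = d" "card (Y \<inter> orbit s B) = d"
    and X_face: "\<And>x. x \<in> U \<Longrightarrow> s (t x) \<noteq> x \<Longrightarrow> card (Y \<inter> orbit (s \<circ> t) x) = 1"
begin

text \<open>Each mark is followed by \<open>l\<close> loops and then by \<open>f\<close> fixed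
  points. A loop cuts off a face of length 1 and contributes its other end to the marked face. So a
  face grows by \<open>l + f\<close>, and a vertex by \<open>2 * l + f\<close> for each of its
  marks. In every new column the commutator has one cycle of length \<open>2 * l + 1\<close> and
  otherwise fixed points, whence the condition modulo 3. The support of \<open>t\<close> grows by
  \<open>2 * l\<close> points at each of the \<open>2 * d\<close> marks, a multiple of 4.\<close>

theorem insert_chunks:
  assumes f: "f \<ge> 1" and c3: "\<not> 3 dvd 2 * l + 1"
  shows "\<exists>U' s' t' F' a' b' c' A' B'. runged_diagram (U' :: ('a \<times> nat) set) s' t' F' a' b' c' A' B'
    (m + l + f) (n + d * (2 * l + f))"
proof -
  define h where "h x = (if x \<in> Y then 2 * l + f else 0)" for x
  let ?T = "tower U h" and ?s = "climb U h s"
  define u where "u z = (case z of (x, i) \<Rightarrow>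
     if x \<in> U \<and> i \<le> h x then
       (if i = 0 then (t x, 0) else if i \<le> 2 * l then (x, if odd i then Suc i else i - 1) else (x, i))
     else (x, i))" for z :: "'a \<times> nat"
  have finT: "finite ?T" using fin by (rule finite_tower)
  have sT: "?s permutes ?T" using s by (rule climb_permutes)
  have ps: "permutation ?s" using finT sT by (rule permutes_imp_permutation)
  have memU: "s x \<in> U \<longleftrightarrow> x \<in> U" "t x \<in> U \<longleftrightarrow> x \<in> U" "inv' s x \<in> U \<longleftrightarrow> x \<in> U" for x
    using permutes_in_image[OF s] permutes_in_image[OF t] permutes_in_image[OF permutes_inv[OF s]] by blast+
  have tX: "t x \<in> Y \<longleftrightarrow> x \<in> Y" for x using X_props(3) tt by metis
  have htX: "h (t x) = h x" for x by (simp add: h_def tX)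
  have hX: "h x = 2 * l + f" if "x \<in> Y" for x using that by (simp add: h_def)
  have hN: "h x = 0" if "x \<notin> Y" for x using that by (simp add: h_def)
  have u0: "u (x, 0) = (t x, 0)" if "x \<in> U" for x using that by (simp add: u_def)
  have u1: "u (x, i) = (x, Suc i)" if "x \<in> Y" "odd i" "i < 2 * l" for x i
    using that X_props(1) f odd_pos[of i] by (auto simp: u_def hX)
  have u2: "u (x, i) = (x, i - 1)" if "x \<in> Y" "even i" "i \<noteq> 0" "i \<le> 2 * l" for x i
    using that X_props(1) f by (auto simp: u_def hX)
  have u3: "u (x, i) = (x, i)" if "x \<in> Y" "i > 2 * l" "i \<le> h x" for x i
    using that X_props(1) f by (auto simp: u_def)
  \<comment> \<open>Going back along \<open>?s\<close> from level 0 leads to the top of a column.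
    The commutator at level 0 thus sees \<open>u\<close> only at level 0 and at tops, and
    \<open>f \<ge> 1\<close> keeps the tops above all loops.\<close>
  have utop: "u (x, h x) = (t x, h x)" if "x \<in> U" for x
    using that u0[OF that] u3[of x "h x"] f X_props(3) by (cases "x \<in> Y") (auto simp: h_def)
  have uu: "u (u z) = z" for z
  proof (cases z)
    case (Pair x i)
    consider "x \<notin> U \<or> i > h x" | "x \<in> U" "i = 0" | "x \<in> Y" "odd i" "i < 2 * l" |
      "x \<in> Y" "even i" "i \<noteq> 0" "i \<le> 2 * l" | "x \<in> Y" "i > 2 * l" "i \<le> h x"
    proof -
      have "i < 2 * l" if "odd i" "i \<le> 2 * l" using that by (metis dvd_triv_left le_neq_implies_less)
      moreover have "x \<in> Y" if "x \<in> U" "i \<noteq> 0" "i \<le> h x" using that by (auto simp: h_def split: if_splits)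
      ultimately show ?thesis using that by (metis not_le_imp_less)
    qed
    then show ?thesis
    proof cases
      case 1 then show ?thesis unfolding Pair by (auto simp: u_def)
    next
      case 2 then show ?thesis unfolding Pair by (simp add: u0 memU tt)
    next
      case 3 then show ?thesis unfolding Pair using u1[of x i] u2[of x "Suc i"] by simp
    next
      case 4 then show ?thesis unfolding Pair using u2[of x i] u1[of x "i - 1"] by simp
    next
      case 5 then show ?thesis unfolding Pair by (simp add: u3)
    qed
  qed
  have uT: "u permutes ?T"
    by (rule involution_permutes[OF uu]) (auto simp: u_def tower_def split: prod.splits)
  have s0: "?s (x, 0) = (s x, 0)" if "x \<in> U" "x \<notin> Y" for x
    using that by (simp add: climb_def hN)
  have s1: "?s (x, i) = (x, Suc i)" if "x \<in> Y" "i < 2 * l + f" for x i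
    using that X_props(1) by (auto simp: climb_def hX)
  have stop: "?s (x, h x) = (s x, 0)" if "x \<in> U" for x
    using that by (simp add: climb_def)
  have i0: "inv' ?s (x, 0) = (inv' s x, h (inv' s x))" if "x \<in> U" for x
    using inv_climb[OF s that, of 0 h] by simp
  have i1: "inv' ?s (x, Suc i) = (x, i)" if "x \<in> Y" "i < 2 * l + f" for x i
    using inv_climb[OF s, of x "Suc i" h] that X_props(1) by (auto simp: hX)
  have g0: "comm ?s u (x, 0) = (comm s t x, 0)" if "x \<in> U" for x
  proof -
    let ?w = "inv' s (t x)"
    have w: "?w \<in> U" using that by (simp add: memU)
    have "comm ?s u (x, 0) = ?s (u (?w, h ?w))"
      using that by (simp add: comm_def u0 i0 memU)
    also have "\<dots> = ?s (t ?w, h (t ?w))" using utop[OF w] by (simp add: htX)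
    also have "\<dots> = (s (t ?w), 0)" using w by (intro stop) (simp add: memU)
    finally show ?thesis by (simp add: comm_eq)
  qed
  \<comment> \<open>The cycle runs upwards through the odd levels as far as \<open>2 * l + 1\<close>
    and returns to level 1 through the even ones; all higher levels are fixed.\<close>
  have gX: "comm ?s u (x, i) = (if i > 2 * l + 1 then (x, i)
      else if odd i then (if i < 2 * l + 1 then (x, i + 2) else if l = 0 then (x, 1) else (x, 2 * l))
      else if i = 2 then (x, 1) else (x, i - 2))"
    if x: "x \<in> Y" and i: "0 < i" "i \<le> 2 * l + f" for x i
  proof -
    have xU: "x \<in> U" using x X_props(1) by blast
    consider "i > 2 * l + 1" | "i = 1" "l = 0" | "i = 2 * l + 1" "l > 0" | "odd i" "i < 2 * l" |
      "i = 2" "l > 0" | "even i" "i \<ge> 4" "i \<le> 2 * l"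
    proof -
      have "i < 2 * l \<or> i = 2 * l + 1 \<or> i > 2 * l + 1" if "odd i"
        using that by (metis Suc_eq_plus1 dvd_triv_left linorder_neqE_nat not_less_eq)
      moreover have "i \<le> 2 * l \<or> i > 2 * l + 1" if "even i"
        using that by (metis Suc_eq_plus1 even_plus_one_iff dvd_triv_left linorder_neqE_nat not_less not_less_eq)
      moreover have "i = 2 \<or> i \<ge> 4" if "even i" using that i(1) by presburger
      ultimately show ?thesis using that i(1) by (cases "odd i"; cases "l = 0") auto
    qed
    then show ?thesis
    proof cases
      case 1
      then obtain k where k: "i = Suc k" "k > 2 * l" by (cases i) auto
      then show ?thesis using i x u3[of x i] u3[of x k] i1[of x k] s1[of x k] by (simp add: comm_def hX)
    next
      case 2
      then show ?thesis using i x xU u3[of x 1] i1[of x 0] u0[of x] X_props(3)[OF x] s1[of x 0] by (simp add: comm_def hX)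
    next
      case 3
      then show ?thesis
        using i x u3[of x i] i1[of x "2 * l"] u2[of x "2 * l"] s1[of x "2 * l - 1"] by (simp add: comm_def hX)
    next
      case 4
      then show ?thesis
        using i x u1[of x i] i1[of x i] s1[of x "Suc i"] f by (auto simp: comm_def)
    next
      case 5
      then show ?thesis
        using i x xU f u2[of x 2] i1[of x 0] u0[of x] X_props(3)[OF x] s1[of x 0] by (simp add: comm_def)
    next
      case 6
      then obtain k where k: "i = Suc (Suc (Suc (Suc k)))"
        using le_Suc_ex[of 4 i] by (auto simp: numeral_eq_Suc)
      then show ?thesis
        using 6 i x u2[of x i] i1[of x "i - 2"] u2[of x "i - 2"] s1[of x "i - 3"] by (simp add: comm_def)
    qed
  qed
  have pw: "(comm ?s u ^^ (2 * l + 1)) z = z" if z: "z \<in> ?T" "z \<notin> (\<lambda>x. (x, 0)) ` (U - {})" for z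
  proof -
    obtain x i where xi: "z = (x, i)" by (cases z)
    have i: "0 < i" "x \<in> Y" "i \<le> 2 * l + f"
      using z xi by (auto simp: h_def split: if_splits)
    show ?thesis
    proof (cases "i > 2 * l + 1")
      case True
      then have "comm ?s u z = z" using gX[OF i(2,1,3)] xi by simp
      moreover have "(f ^^ k) z = z" if "f z = z" for f :: "'a \<times> nat \<Rightarrow> 'a \<times> nat" and k
        using that by (induction k) auto
      ultimately show ?thesis by blast
    next
      case False
      define \<phi> where "\<phi> j = (x, if j \<le> l then 2 * j + 1 else 2 * (2 * l + 1 - j))" for j :: nat
      have step: "comm ?s u (\<phi> j) = \<phi> (Suc j mod (2 * l + 1))" if j: "j < 2 * l + 1" for j
      proof -
        consider "j < l" | "j = l" "l = 0" | "j = l" "l > 0" | "l < j" "j < 2 * l" | "j = 2 * l" "l > 0" using j by linarith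
        then show ?thesis
          by cases (use i j f in \<open>auto simp: \<phi>_def gX mod_less\<close>)
      qed
      obtain j where j: "j < 2 * l + 1" "z = \<phi> j"
      proof (cases "odd i")
        case True
        then show ?thesis using that[of "i div 2"] False i xi by (auto simp: \<phi>_def elim!: oddE)
      next
        case ev: False
        then show ?thesis using that[of "2 * l + 1 - i div 2"] False i xi by (auto simp: \<phi>_def elim!: evenE)
      qed
      have "(comm ?s u ^^ (2 * l + 1)) (\<phi> j) = \<phi> j"
        by (rule funpow_of_indexed_cycle[where f = "comm ?s u" and \<phi> = \<phi> and l = "2 * l + 1"])
          (use step j(1) in auto)
      then show ?thesis unfolding j(2) .
    qed
  qed
  have finX: "finite Y" using X_props(1) fin by (rule finite_subset)
  have orbU: "orbit s x \<subseteq> U" if "x \<in> U" for x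
    by (rule orbit_subset_closed) (use that in \<open>auto simp: memU\<close>)
  have X_cover: "Y \<subseteq> orbit s A \<union> orbit s B" using X_props orbits_AB(4) by blast
  then have "Y = (Y \<inter> orbit s A) \<union> (Y \<inter> orbit s B)" by blast
  then have cardX: "card Y = 2 * d"
  proof -
    have "(Y \<inter> orbit s A) \<inter> (Y \<inter> orbit s B) = {}" using orbits_AB(1) by blast
    from card_Un_disjoint[OF finite_Int[OF disjI1, OF finX] finite_Int[OF disjI1, OF finX] this]
    have "card (Y \<inter> orbit s A \<union> Y \<inter> orbit s B) = d + d" unfolding X_AB .
    then show ?thesis using \<open>Y = (Y \<inter> orbit s A) \<union> (Y \<inter> orbit s B)\<close> by simp
  qed
  have "{z \<in> ?T. u z \<noteq> z} = (\<lambda>x. (x, 0)) ` {x \<in> U. t x \<noteq> x} \<union> Y \<times> {1..2 * l}"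
  proof -
    have "u (x, i) \<noteq> (x, i) \<longleftrightarrow> i = 0 \<and> t x \<noteq> x \<or> i \<in> {1..2 * l}" if "x \<in> U" "i \<le> h x" for x i
      using that by (auto simp: u_def)
    moreover have "x \<in> Y" if "i \<in> {1..2 * l}" "i \<le> h x" for x i using that by (auto simp: h_def split: if_splits)
    ultimately have "(x, i) \<in> {z \<in> ?T. u z \<noteq> z} \<longleftrightarrow> (x, i) \<in> (\<lambda>x. (x, 0)) ` {x \<in> U. t x \<noteq> x} \<union> Y \<times> {1..2 * l}" for x i
      using X_props(1) f by (cases "x \<in> U \<and> i \<le> h x") (auto simp: hX)
    then show ?thesis unfolding set_eq_iff split_paired_All by blast
  qed
  moreover have "card ((\<lambda>x. (x, 0 :: nat)) ` {x \<in> U. t x \<noteq> x} \<union> Y \<times> {1..2 * l}) =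
      card {x \<in> U. t x \<noteq> x} + 4 * (d * l)"
    using finX fin by (subst card_Un_disjoint) (auto simp: card_image inj_on_def card_cartesian_product cardX)
  ultimately have moved': "4 dvd card {z \<in> ?T. u z \<noteq> z}" using moved by simp
  have D: "coset_diagram ?T ?s u ((\<lambda>x. (x, 0)) ` F) (a, 0) (b, 0) (c, 0)"
  proof (rule extend[where E = "{}" and k = "2 * l + 1"])
    show "inj (\<lambda>x. (x, 0 :: nat))" by (simp add: inj_on_def)
    show "(\<lambda>x. (x, 0)) ` U \<subseteq> ?T" by auto
    show "?s (x, 0) = (s x, 0)" if "x \<in> F" for x using that X_props(2) FU by (intro s0) auto
    show "u (x, 0) = (t x, 0)" if "x \<in> F" for x using that FU by (intro u0) auto
    show "u (a, 0) = (c, 0)" using u0 abc ta by simp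
    show "comm ?s u (x, 0) = (comm s t x, 0)" if "x \<in> U - {}" for x using g0 that by simp
    show "(s x, 0) \<in> orbit ?s (x, 0)" if "x \<in> U" for x
      unfolding orbit_climb[OF fin s that] by (auto intro: orbit.base)
    show "(t x, 0) \<in> orbit ?s (u (x, 0))" if "x \<in> U" for x
      unfolding u0[OF that] by (rule permutation_self_in_orbit[OF ps])
    show "\<exists>x\<in>U. z \<in> orbit ?s (x, 0)" if "z \<in> ?T" for z
      using that orbit_climb[OF fin s] permutation_self_in_orbit[OF perm_s]
      by (cases z) (auto intro!: bexI[of _ "fst z"])
  qed (use finT sT uT uu c3 pw moved' in auto)
  let ?\<rho> = "s \<circ> t" and ?r = "?s \<circ> u"
  have p\<rho>: "?\<rho> permutes U" using t s by (rule permutes_compose)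
  have pr: "permutation ?r"
    using finT permutes_compose[OF uT sT] by (rule permutes_imp_permutation)
  have perm_\<rho>: "permutation ?\<rho>" using fin p\<rho> by (rule permutes_imp_permutation)
  define hc where "hc x = (if x \<in> Y then l + f else 0)" for x
  \<comment> \<open>Lists the points of a lengthened face in their cyclic order: of every loop only
    the odd end, then all the fixed points. For \<open>j = 0\<close> truncated subtraction yields
    level 0, the old point itself.\<close>
  define \<theta> where "\<theta> z = (case z of (y, j) \<Rightarrow> (y, if j \<le> l then 2 * j - 1 else l + j))" for z :: "'a \<times> nat"
  have inj\<theta>: "inj \<theta>"
    by (rule injI) (auto simp: \<theta>_def split: prod.splits if_splits)
  have semi: "?r (\<theta> (y, j)) = \<theta> (climb U hc ?\<rho> (y, j))" if y: "y \<in> U" "j \<le> hc y" for y j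
  proof (cases "y \<in> Y")
    case False
    then have "t y \<notin> Y" by (simp add: tX)
    then show ?thesis using False y by (simp add: hc_def \<theta>_def climb_def[of U hc] u0 s0 memU)
  next
    case True
    have j: "j \<le> l + f" using y True by (simp add: hc_def)
    consider "j = 0" | "1 \<le> j" "j \<le> l" | "l < j" "j < l + f" | "j = l + f" using j by linarith
    then show ?thesis
    proof cases
      case 1
      then show ?thesis using True y f s1[of y 0] X_props(3) by (auto simp: hc_def \<theta>_def climb_def[of U hc] u0)
    next
      case 2
      then have "?r (\<theta> (y, j)) = ?s (y, 2 * j)" using u1[of y "2 * j - 1"] True by (simp add: \<theta>_def)
      also have "\<dots> = (y, Suc (2 * j))" using 2 f True by (intro s1) auto
      also have "\<dots> = \<theta> (climb U hc ?\<rho> (y, j))"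
        using 2 f True y by (auto simp: \<theta>_def climb_def hc_def)
      finally show ?thesis .
    next
      case 3
      then have "?r (\<theta> (y, j)) = ?s (y, l + j)" using u3[of y "l + j"] True by (simp add: \<theta>_def hX)
      also have "\<dots> = (y, Suc (l + j))" using 3 True by (intro s1) auto
      also have "\<dots> = \<theta> (climb U hc ?\<rho> (y, j))"
        using 3 True y by (auto simp: \<theta>_def climb_def hc_def)
      finally show ?thesis .
    next
      case 4
      then have "?r (\<theta> (y, j)) = ?s (y, h y)" using u3[of y "l + j"] True f by (simp add: \<theta>_def hX mult_2 add.assoc)
      also have "\<dots> = (s y, 0)" using y by (intro stop)
      also have "\<dots> = \<theta> (climb U hc ?\<rho> (y, j))"
        using 4 True y f X_props(3) by (auto simp: \<theta>_def climb_def hc_def)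
      finally show ?thesis .
    qed
  qed
  have orbU': "orbit ?\<rho> x \<subseteq> U" if "x \<in> U" for x
    by (rule orbit_subset_closed) (use that in \<open>auto simp: memU\<close>)
  have orb_r: "orbit ?r (x, 0) = \<theta> ` Sigma (orbit ?\<rho> x) (\<lambda>y. {..hc y})" if x: "x \<in> U" for x
  proof -
    have "orbit ?r (\<theta> (x, 0)) = \<theta> ` orbit (climb U hc ?\<rho>) (x, 0)"
    proof (rule orbit_semiconj)
      fix z assume "z \<in> orbit (climb U hc ?\<rho>) (x, 0) \<or> z = (x, 0)"
      then show "?r (\<theta> z) = \<theta> (climb U hc ?\<rho> z)"
        unfolding orbit_climb[OF fin p\<rho> x] using semi orbU'[OF x] x by (cases z) auto
    qed
    then show ?thesis unfolding orbit_climb[OF fin p\<rho> x] by (simp add: \<theta>_def)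
  qed
  have finO: "finite (orbit p x)" if "permutation p" for p :: "'a \<Rightarrow> 'a" and x
    using finite_orbit[OF permutation_self_in_orbit[OF that]] .
  have sumX: "sum (\<lambda>x. if x \<in> Y then k else 0) V = card (Y \<inter> V) * k" if "finite V" for V k
    using that by (simp add: sum.If_cases Int_commute)
  have face: "card (orbit ?r (x, 0)) = m + l + f" if x: "x \<in> U" "?\<rho> x \<noteq> x" for x
  proof -
    have "card (orbit ?r (x, 0)) = card (orbit (climb U hc ?\<rho>) (x, 0))"
      unfolding orb_r[OF x(1)] orbit_climb[OF fin p\<rho> x(1)]
      using inj\<theta> by (intro card_image) (auto intro: inj_on_subset)
    also have "\<dots> = card (orbit ?\<rho> x) + sum hc (orbit ?\<rho> x)" by (rule card_orbit_climb[OF fin p\<rho> x(1)])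
    also have "sum hc (orbit ?\<rho> x) = l + f"
      using X_face[OF x(1)] x(2) unfolding hc_def by (subst sumX[OF finO[OF perm_\<rho>]]) simp
    also have "card (orbit ?\<rho> x) = m" using faces x by (auto simp: regular_cycles_def)
    finally show ?thesis by (simp add: comp_def add.assoc)
  qed
  have \<rho>X: "?\<rho> x \<noteq> x" if "x \<in> Y" for x using that X_props(3,4) by auto
  have faces': "regular_cycles ?T ?r (m + l + f)"
    unfolding regular_cycles_def
  proof (intro conjI ballI bexI)
    show "card (orbit ?r (B, 0)) = m + l + f" using AB(2) face_B by (rule face)
    show "(B, 0) \<in> ?T" using AB by simp
    fix z assume z: "z \<in> ?T"
    obtain x i where xi: "z = (x, i)" by (cases z)
    have x: "x \<in> U" "i \<le> h x" using z xi by auto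
    show "?r z = z \<or> card (orbit ?r z) = m + l + f"
    proof (cases "i = 0")
      case True
      then show ?thesis
        using face[OF x(1)] x \<rho>X[of x] xi by (cases "?\<rho> x = x") (auto simp: u0 climb_def[of U h] memU tX htX h_def)
    next
      case i0: False
      then have xX: "x \<in> Y" using x by (auto simp: h_def split: if_splits)
      show ?thesis
      proof (cases "even i \<and> i \<le> 2 * l")
        \<comment> \<open>The even end of a loop is the face of length 1 inside it. All other new
          points belong to the marked face.\<close>
        case True
        then have "?r z = z" using i0 xX xi f u2[of x i] s1[of x "i - 1"] True by auto
        then show ?thesis ..
      next
        case False
        define j where "j = (if i \<le> 2 * l then i div 2 + 1 else i - l)"
        have j: "j \<le> hc x" "\<theta> (x, j) = z"
          using False i0 x xX xi by (auto simp: j_def \<theta>_def hc_def h_def elim!: oddE)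
        have "z \<in> orbit ?r (x, 0)"
          unfolding orb_r[OF x(1)] using j permutation_self_in_orbit[OF perm_\<rho>, of x]
          by (intro image_eqI[of _ _ "(x, j)"]) auto
        then have "orbit ?r z = orbit ?r (x, 0)" by (rule orbit_eq_iff_mem[OF pr])
        then show ?thesis using face[OF x(1) \<rho>X[OF xX]] by simp
      qed
    qed
  qed
  have AX: "A \<notin> Y" "B \<notin> Y" using X_props(3) AB(3) tB A_ne_B by auto
  have card_vertex: "card (orbit ?s (x, 0)) = card (orbit s x) + d * (2 * l + f)"
    if "x \<in> U" "card (Y \<inter> orbit s x) = d" for x
    using that unfolding card_orbit_climb[OF fin s that(1)] h_def
    by (subst sumX[OF finO[OF perm_s]]) simp
  have "runged_diagram ?T ?s u ((\<lambda>x. (x, 0)) ` F) (a, 0) (b, 0) (c, 0) (A, 0) (B, 0)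
     (m + l + f) (n + d * (2 * l + f))"
  proof (intro runged_diagram.intro rung_diagram.intro D rung_diagram_axioms.intro runged_diagram_axioms.intro)
    show "orbit ?s (A, 0) \<inter> orbit ?s (B, 0) = {}"
      using orbits_AB(1) AB(1,2) by (auto simp: orbit_climb[OF fin s])
    show "card (orbit ?s (A, 0)) = n + d * (2 * l + f)" "card (orbit ?s (B, 0)) = n + d * (2 * l + f)"
      using card_vertex AB X_AB orbits_AB by simp_all
    fix z assume "z \<in> ?T"
    then obtain x i where xi: "z = (x, i)" "x \<in> U" "i \<le> h x" by (cases z) auto
    show "?s z = z \<or> z \<in> orbit ?s (A, 0) \<union> orbit ?s (B, 0)"
    proof (cases "x \<in> orbit s A \<union> orbit s B")
      case True then show ?thesis using xi AB by (auto simp: orbit_climb[OF fin s])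
    next
      case False
      then have "s x = x" "x \<notin> Y" using orbits_AB(4) xi X_cover by auto
      then show ?thesis using xi s0[of x] by (simp add: hN)
    qed
  next
    have free: "u (inv' ?s (x, 0)) = inv' ?s (x, 0)"
      if "x \<in> U" "t (inv' s x) = inv' s x" for x
      using that utop[of "inv' s x"] by (simp add: i0 memU)
    show "u (inv' ?s (A, 0)) = inv' ?s (A, 0)"
      "u (inv' ?s (B, 0)) = inv' ?s (B, 0)"
      using AB free_AB by (auto intro!: free)
  qed (use AB AX free_AB abc_AB faces' in \<open>auto simp: u0 s0 memU\<close>)
  then show ?thesis by blast
qed

end

section \<open>Ladders of faces with at least four sides\<close>

context runged_diagram
begin

text \<open>Two faces of length \<open>m\<close> are inserted, bounded by rungs joining level 0 to
  level \<open>m\<close>, 2 to 2, and \<open>m\<close> to 0. Equal levels at the ends of the middle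
  rung give the two faces the same length. All altered commutator cycles have length at most 2.
  Levels 1 and \<open>m - 1\<close> must stay free between the rungs, which requires
  \<open>m \<ge> 4\<close>.\<close>

theorem insert_cell:
  assumes m: "m \<ge> 4"
  shows "\<exists>U' s' t' F' a' b' c' A' B'. runged_diagram (U' :: ('a \<times> nat) set) s' t' F' a' b' c' A' B' m (n + m)"
proof -
  define h where "h x = (if x = A \<or> x = B then m else 0)" for x
  define e where "e i = (if i = 0 then m else if i = m then 0 else i)" for i :: nat
  let ?T = "tower U h" and ?s = "climb U h s"
  define u where "u z = (case z of (x, i) \<Rightarrow>
     if x \<in> {A, B} \<and> i \<in> {0, 2, m} then (t x, e i)
     else if x \<in> U \<and> i = 0 then (t x, 0) else (x, i))" for z :: "'a \<times> nat"
  have finT: "finite ?T" using fin by (rule finite_tower)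
  have sT: "?s permutes ?T" using s by (rule climb_permutes)
  have ps: "permutation ?s" using finT sT by (rule permutes_imp_permutation)
  have memU: "s x \<in> U \<longleftrightarrow> x \<in> U" "t x \<in> U \<longleftrightarrow> x \<in> U" "inv' s x \<in> U \<longleftrightarrow> x \<in> U" for x
    using permutes_in_image[OF s] permutes_in_image[OF t] permutes_in_image[OF permutes_inv[OF s]] by blast+
  have tAB: "t x = A \<longleftrightarrow> x = B" "t x = B \<longleftrightarrow> x = A" for x using AB(3) tB tt by metis+
  have tR: "t x \<in> {A, B} \<longleftrightarrow> x \<in> {A, B}" for x by (auto simp: tAB)
  have sR: "s x \<notin> {A, B}" "inv' s x \<notin> {A, B}" if "x \<in> {A, B}" for x
    using that free_AB AB(3) tB A_ne_B by auto
  have RU: "x \<in> U" if "x \<in> {A, B}" for x using that AB by auto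
  have hR: "h x = m" if "x \<in> {A, B}" for x using that by (auto simp: h_def)
  have hN: "h x = 0" if "x \<notin> {A, B}" for x using that by (auto simp: h_def)
  have u0: "u (x, 0) = (t x, 0)" if "x \<in> U" "x \<notin> {A, B}" for x using that by (simp add: u_def)
  have uR0: "u (x, 0) = (t x, m)" and uR2: "u (x, 2) = (t x, 2)" and uRm: "u (x, m) = (t x, 0)" if "x \<in> {A, B}" for x
    using that m by (auto simp: u_def e_def)
  have uRi: "u (x, i) = (x, i)" if "x \<in> {A, B}" "i \<noteq> 0" "i \<noteq> 2" "i \<noteq> m" for x i using that by (auto simp: u_def)
  have ee: "e (e i) = i" "e i \<in> {0, 2, m} \<longleftrightarrow> i \<in> {0, 2, m}" for i using m by (auto simp: e_def)
  have uu: "u (u z) = z" for z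
    using tR ee by (cases z) (auto simp: u_def memU tt simp del: insert_iff split: if_splits)
  have uT: "u permutes ?T"
  proof (rule involution_permutes[OF uu])
    show "u z = z" if "z \<notin> ?T" for z using that RU m by (cases z) (auto simp: u_def h_def)
  qed
  have s0: "?s (x, 0) = (s x, 0)" if "x \<in> U" "x \<notin> {A, B}" for x
    using that by (simp add: climb_def h_def)
  have s1: "?s (x, i) = (x, Suc i)" if "x \<in> {A, B}" "i < m" for x i
    using that RU[of x] by (auto simp: climb_def hR)
  have stop: "?s (x, m) = (s x, 0)" if "x \<in> {A, B}" for x
    using that RU[of x] by (auto simp: climb_def hR)
  have i0: "inv' ?s (x, 0) = (inv' s x, h (inv' s x))" if "x \<in> U" for x
    using inv_climb[OF s that, of 0 h] by simp
  have i1: "inv' ?s (x, i) = (x, i - 1)" if "x \<in> {A, B}" "0 < i" "i \<le> m" for x i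
    using inv_climb[OF s, of x i h] that RU[of x] by (simp add: hR)
  let ?E = "{A, B, s A, s B}"
  have gE: "comm s t A = B" "comm s t B = A" "comm s t (s A) = s B" "comm s t (s B) = s A"
    using free_AB AB(3) tB by (simp_all add: comm_eq)
  have g_out: "comm s t x \<notin> ?E" if "x \<in> U - ?E" for x
  proof
    assume "comm s t x \<in> ?E"
    then obtain y where "y \<in> ?E" "comm s t x = comm s t y" using gE by (metis insert_iff singletonD)
    then show False using that permutes_inj[OF comm_permutes] by (auto dest: injD)
  qed
  have g0: "comm ?s u (x, 0) = (comm s t x, 0)" if x: "x \<in> U - ?E" for x
  proof -
    let ?w = "inv' s (t x)"
    have w: "?w \<in> U" using x by (simp add: memU)
    have "?w \<notin> {A, B}"
    proof
      assume "?w \<in> {A, B}"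
      then have "t x \<in> {s A, s B}" using inv_s(2)[of "t x"] by auto
      then have "x \<in> {s A, s B}" using free_AB tt by (metis insert_iff singletonD)
      then show False using x by auto
    qed
    then show ?thesis using x w tR by (simp add: comm_def u0 s0 i0 memU hN)
  qed
  have gm: "comm ?s u (x, 0) = (t x, m)" "comm ?s u (x, m) = (t x, 0)"
    "comm ?s u (x, 1) = (s (t x), 0)" "comm ?s u (s x, 0) = (t x, 1)"
    "comm ?s u (x, 2) = (t x, 2)" "comm ?s u (x, 3) = (t x, 3)" if x: "x \<in> {A, B}" for x
  proof -
    note R = x tR[THEN iffD2, OF x]
    show "comm ?s u (x, 0) = (t x, m)"
      using R m by (simp add: comm_def uR0 i1 uRi s1 del: insert_iff)
    have i: "t (inv' s (t x)) = inv' s (t x)" using x free_AB AB(3) tB by auto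
    show "comm ?s u (x, m) = (t x, 0)"
      using R RU[OF R(2)] sR[OF R(2)] by (simp add: comm_def uRm i0 hN u0 s0 memU i del: insert_iff)
    show "comm ?s u (x, 1) = (s (t x), 0)"
      using R m by (simp add: comm_def uRi i1 uR0 stop del: insert_iff)
    have "t (s x) = s x" using x free_AB by auto
    then show "comm ?s u (s x, 0) = (t x, 1)"
      using R RU[OF R(1)] sR[OF R(1)] m by (simp add: comm_def u0 i0 memU hR uRm s1 del: insert_iff)
    show "comm ?s u (x, 2) = (t x, 2)"
      using R m by (simp add: comm_def uR2 i1 uRi s1 del: insert_iff)
    show "comm ?s u (x, 3) = (t x, 3)"
      using R m by (simp add: comm_def uR2 i1 uRi s1 del: insert_iff)
  qed
  have gi: "comm ?s u (x, i) = (x, i)" if "x \<in> {A, B}" "4 \<le> i" "i < m" for x i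
    using that by (simp add: comm_def uRi i1 s1 del: insert_iff)
  have pw: "(comm ?s u ^^ 2) z = z" if z: "z \<in> ?T" "z \<notin> (\<lambda>x. (x, 0)) ` (U - ?E)" for z
  proof -
    obtain x i where xi: "z = (x, i)" by (cases z)
    have x: "x \<in> U" "i \<le> h x" using z xi by auto
    consider "x \<in> {A, B}" "i = 0" | "x \<in> {A, B}" "i = 1" | "x \<in> {A, B}" "i = 2" | "x \<in> {A, B}" "i = 3" |
      "x \<in> {A, B}" "4 \<le> i" "i < m" | "x \<in> {A, B}" "i = m" | y where "y \<in> {A, B}" "x = s y" "i = 0"
    proof (cases "x \<in> {A, B}")
      case True
      then show ?thesis using that x(2) hR[OF True] by linarith
    next
      case False
      then have "i = 0" "x \<in> ?E" using x hN[OF False] z xi by auto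
      then show ?thesis using that(7) False by auto
    qed
    then show ?thesis
      unfolding xi
      by cases (use gm gi tR tt in \<open>simp_all add: numeral_2_eq_2 del: insert_iff\<close>)
  qed
  have "{z \<in> ?T. u z \<noteq> z} = (\<lambda>x. (x, 0)) ` {x \<in> U. t x \<noteq> x} \<union> {A, B} \<times> {2, m}"
  proof -
    have "(x, i) \<in> {z \<in> ?T. u z \<noteq> z} \<longleftrightarrow> (x, i) \<in> (\<lambda>x. (x, 0)) ` {x \<in> U. t x \<noteq> x} \<union> {A, B} \<times> {2, m}" for x i
    proof (cases "x \<in> {A, B}")
      case True
      then have "t x \<noteq> x" using AB(3) tB A_ne_B by auto
      then have "u (x, i) \<noteq> (x, i) \<longleftrightarrow> i \<in> {0, 2, m}" using True by (auto simp: u_def)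
      then show ?thesis using True RU[OF True] m \<open>t x \<noteq> x\<close> by (auto simp: hR simp del: insert_iff)
    next
      case False
      then show ?thesis by (auto simp: u_def h_def)
    qed
    then show ?thesis unfolding set_eq_iff split_paired_All by blast
  qed
  moreover have "card ((\<lambda>x. (x, 0 :: nat)) ` {x \<in> U. t x \<noteq> x} \<union> {A, B} \<times> {2, m}) = card {x \<in> U. t x \<noteq> x} + 4"
  proof -
    have "card ((\<lambda>x. (x, 0 :: nat)) ` {x \<in> U. t x \<noteq> x}) = card {x \<in> U. t x \<noteq> x}"
      by (rule card_image) (simp add: inj_on_def)
    moreover have "card ({A, B} \<times> {2, m}) = 4"
      unfolding card_cartesian_product using m A_ne_B by simp
    moreover have "((\<lambda>x. (x, 0 :: nat)) ` {x \<in> U. t x \<noteq> x}) \<inter> ({A, B} \<times> {2, m}) = {}" using m by auto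
    ultimately show ?thesis using fin by (subst card_Un_disjoint) simp_all
  qed
  ultimately have moved': "4 dvd card {z \<in> ?T. u z \<noteq> z}" using moved by simp
  have D: "coset_diagram ?T ?s u ((\<lambda>x. (x, 0)) ` F) (a, 0) (b, 0) (c, 0)"
  proof (rule extend[where E = ?E and k = 2])
    show "inj (\<lambda>x. (x, 0 :: nat))" by (simp add: inj_on_def)
    show "(\<lambda>x. (x, 0)) ` U \<subseteq> ?T" by auto
    have FR: "x \<notin> {A, B}" if "x \<in> F" for x using that AB(4,5) by auto
    show "?s (x, 0) = (s x, 0)" if "x \<in> F" for x using that FR FU by (intro s0) auto
    show "u (x, 0) = (t x, 0)" if "x \<in> F" for x using that FR FU by (intro u0) auto
    show "u (a, 0) = (c, 0)" using u0[of a] abc abc_AB ta by auto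
    show "{a, b, c} \<inter> ?E = {}" by (rule abc_AB)
    show "(s x, 0) \<in> orbit ?s (x, 0)" if "x \<in> U" for x
      unfolding orbit_climb[OF fin s that] by (auto intro: orbit.base)
    show "(t x, 0) \<in> orbit ?s (u (x, 0))" if x: "x \<in> U" for x
    proof (cases "x \<in> {A, B}")
      case True
      then have "(t x, m) \<in> orbit ?s (t x, 0)"
        using tR[THEN iffD2, OF True] x permutation_self_in_orbit[OF perm_s]
        by (simp add: orbit_climb[OF fin s] memU hR del: insert_iff)
      then show ?thesis unfolding uR0[OF True] by (rule orbit_sym[OF ps])
    next
      case False
      then show ?thesis unfolding u0[OF x False] by (intro permutation_self_in_orbit[OF ps])
    qed
    show "\<exists>x\<in>U. z \<in> orbit ?s (x, 0)" if "z \<in> ?T" for z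
      using that orbit_climb[OF fin s] permutation_self_in_orbit[OF perm_s]
      by (cases z) (auto intro!: bexI[of _ "fst z"])
    show "\<not> 3 dvd (2 :: nat)" by simp
  qed (fact finT sT uT uu g_out g0 pw moved')+
  let ?\<rho> = "s \<circ> t" and ?r = "?s \<circ> u"
  \<comment> \<open>The two outer rungs end at tops of columns, from where \<open>?s\<close>
    continues to the old successor; so the old face cycles are unchanged.\<close>
  have \<rho>0: "?r (x, 0) = (?\<rho> x, 0)" if "x \<in> U" for x
    using that tR[of x] by (cases "x \<in> {A, B}") (auto simp: uR0 stop u0 s0 memU simp del: insert_iff)
  have \<rho>U: "orbit ?\<rho> x \<subseteq> U" if "x \<in> U" for x
    by (rule orbit_subset_closed) (use that in \<open>auto simp: memU\<close>)
  have orb_old: "orbit ?r (x, 0) = (\<lambda>y. (y, 0)) ` orbit ?\<rho> x" if "x \<in> U" for x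
    by (rule orbit_semiconj) (use \<rho>0 \<rho>U[OF that] that in blast)
  have card_old: "card (orbit ?r (x, 0)) = card (orbit ?\<rho> x)" if "x \<in> U" for x
    unfolding orb_old[OF that] by (rule card_image) (simp add: inj_on_def)
  have new_face: "card (orbit ?r z) = m" if x: "x \<in> {A, B}" and z: "z \<in> {x} \<times> {1, 2} \<union> {t x} \<times> {3..m}" for x z
  proof -
    \<comment> \<open>The new face takes levels 1 and 2 of one column, crosses the middle rung and
      goes on at level 3 of the other column up to its top. Index \<open>i\<close> stands for level
      \<open>Suc i\<close>.\<close>
    define \<phi> where "\<phi> i = (if i < 2 then (x, Suc i) else (t x, Suc i))" for i :: nat
    have tx: "t x \<in> {A, B}" "t x \<noteq> x" using tR[THEN iffD2, OF x] x tB AB(3) A_ne_B by auto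
    have step: "?r (\<phi> j) = \<phi> (Suc j mod m)" if j: "j < m" for j
    proof -
      consider "j = 0" | "j = 1" | "2 \<le> j" "j < m - 1" | "j = m - 1" using j by linarith
      then show ?thesis
      proof cases
        case 3
        then show ?thesis using tx m by (simp add: \<phi>_def uRi s1 del: insert_iff)
      next
        case 4
        then have "Suc j = m" "\<not> j < 2" using m by simp_all
        then show ?thesis using x tx m by (simp add: \<phi>_def uRm tt s1 del: insert_iff)
      qed (use x tx m in \<open>simp_all add: \<phi>_def uRi uR2 s1 numeral_2_eq_2[symmetric] numeral_3_eq_3[symmetric] del: insert_iff\<close>)
    qed
    obtain i where i: "i < m" "z = \<phi> i"
    proof -
      have "z = \<phi> (snd z - 1)" "snd z - 1 < m" using z m by (auto simp: \<phi>_def)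
      then show ?thesis using that by blast
    qed
    have "orbit ?r z = \<phi> ` {..<m}"
      unfolding i(2) by (rule orbit_of_indexed_cycle[where f = ?r and \<phi> = \<phi> and l = m]) (use m step i in auto)
    moreover have "inj \<phi>" using tx(2) by (intro injI) (auto simp: \<phi>_def split: if_splits)
    ultimately show ?thesis by (simp add: card_image inj_on_subset)
  qed
  have faces': "regular_cycles ?T ?r m"
    unfolding regular_cycles_def
  proof (intro conjI ballI)
    have "(A, 1) \<in> ?T" "card (orbit ?r (A, 1)) = m" using AB m new_face[of A "(A, 1)"] by (auto simp: h_def)
    then show "\<exists>z\<in>?T. card (orbit ?r z) = m" by blast
    fix z assume z: "z \<in> ?T"
    obtain x i where xi: "z = (x, i)" by (cases z)
    show "?r z = z \<or> card (orbit ?r z) = m"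
    proof (cases "i = 0")
      case True
      then show ?thesis
        using z xi card_old[of x] \<rho>0[of x] faces by (auto simp: regular_cycles_def simp del: comp_apply)
    next
      case False
      then have x: "x \<in> {A, B}" "i \<le> m" using z xi by (auto simp: h_def split: if_splits)
      then have "i \<in> {1, 2} \<or> i \<in> {3..m}" using False by auto
      then show ?thesis
        using new_face[OF x(1), of z] new_face[OF tR[THEN iffD2, OF x(1)], of z] xi tt by auto
    qed
  qed
  have "runged_diagram ?T ?s u ((\<lambda>x. (x, 0)) ` F) (a, 0) (b, 0) (c, 0) (A, m) (B, 0) m (n + m)"
  proof (intro runged_diagram.intro rung_diagram_climb D runged_diagram_axioms.intro)
    show "h x = (if x = A \<or> x = B then m else 0)" for x by (rule h_def)
    show "u (A, m) = (B, 0)" using uRm[of A] AB by simp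
    show "(A, m) \<notin> (\<lambda>x. (x, 0)) ` F" "(B, 0) \<notin> (\<lambda>x. (x, 0)) ` F" using AB m by auto
    show "u (?s (A, m)) = ?s (A, m)"
      using stop[of A] u0[of "s A"] sR[of A] AB free_AB memU by auto
    show "u (?s (B, 0)) = ?s (B, 0)"
      using s1[of B 0] uRi[of B 1] m by auto
    show "u (inv' ?s (A, m)) = inv' ?s (A, m)"
      using i1[of A m] uRi[of A "m - 1"] m by simp
    show "u (inv' ?s (B, 0)) = inv' ?s (B, 0)"
      using i0[of B] hN[of "inv' s B"] u0[of "inv' s B"] sR[of B] AB free_AB memU by auto
    show "{(a, 0), (b, 0), (c, 0)} \<inter> {(A, m), (B, 0), ?s (A, m), ?s (B, 0)} = {}"
      using stop[of A] s1[of B 0] abc_AB m by auto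
  qed (rule faces')
  then show ?thesis by blast
qed

end

section \<open>Ladders of triangles\<close>

locale triangle_diagram = rung_diagram U s t F a b c A B n
  for U :: "'a set" and s t F a b c A B and x1 x2 x3 y0 z1 z2 y1 w1 y2 w2 v1 v2 :: 'a and n :: nat +
  assumes distinct: "distinct [A, B, x1, x2, x3, y0, z1, z2, y1, w1, y2, w2]"
    and s_local: "s A = x1" "s x1 = x2" "s x2 = x3" "s y0 = B" "s B = z1" "s z1 = z2" "s z2 = y1"
      "s w1 = A" "s v1 = w1" "s y1 = y2" "s v2 = w2"
    and t_local: "t x1 = x1" "t x2 = y0" "t x3 = x3" "t z1 = z2" "t y1 = w1" "t v1 = v1" "t y2 = w2" "t v2 = v2"
    and abc_local: "{a, b, c} \<inter> {A, B, x1, x3, z1, z2, y1, w1, y2, w2} = {}"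
    and faces: "regular_cycles U (s \<circ> t) 3"
begin

lemma t_local': "t B = A" "t y0 = x2" "t z2 = z1" "t w1 = y1" "t w2 = y2"
  using AB(3) t_local tt by metis+

text \<open>For triangles no levels between the rungs can stay free, so a larger neighbourhood of
  the rung has to be controlled. The points of \<open>?E\<close> form two commutator cycles of
  length 5. After the insertion, the eight of them other than \<open>A\<close> and \<open>B\<close>
  form four cycles of length 5 together with the twelve points of the two columns. The space is
  filled by three triangles and one loop, and the same neighbourhood reappears at the new
  rung.\<close>

theorem insert_cell:
  "\<exists>U' s' t' F' a' b' c' A' B' x1' x2' x3' y0' z1' z2' y1' w1' y2' w2' v1' v2'. 
     triangle_diagram (U' :: ('a \<times> nat) set) s' t' F' a' b' c' A' B' x1' x2' x3' y0' z1' z2' y1' w1' y2' w2' v1' v2' (n + 5)"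
proof -
  define h where "h x = (if x = A \<or> x = B then 5 else 0 :: nat)" for x
  let ?T = "tower U h" and ?s = "climb U h s"
  define u where "u z =
    (if z = (A, 0) then (B, 5) else if z = (B, 5) then (A, 0)
     else if z = (A, 2) then (B, 4) else if z = (B, 4) then (A, 2)
     else if z = (A, 4) then (B, 3) else if z = (B, 3) then (A, 4)
     else if z = (A, 5) then (B, 0) else if z = (B, 0) then (A, 5)
     else if z = (B, 1) then (B, 2) else if z = (B, 2) then (B, 1)
     else if fst z \<in> U \<and> snd z = 0 then (t (fst z), 0) else z)" for z :: "'a \<times> nat"
  have ne: "A \<noteq> B" "B \<noteq> A" using distinct by auto
  have finT: "finite ?T" using fin by (rule finite_tower)
  have sT: "?s permutes ?T" using s by (rule climb_permutes)
  have ps: "permutation ?s" using finT sT by (rule permutes_imp_permutation)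
  have memU: "s x \<in> U \<longleftrightarrow> x \<in> U" "t x \<in> U \<longleftrightarrow> x \<in> U" "inv' s x \<in> U \<longleftrightarrow> x \<in> U" for x
    using permutes_in_image[OF s] permutes_in_image[OF t] permutes_in_image[OF permutes_inv[OF s]] by blast+
  have tAB: "t x = A \<longleftrightarrow> x = B" "t x = B \<longleftrightarrow> x = A" for x using AB(3) t_local'(1) tt by metis+
  have tR: "t x \<in> {A, B} \<longleftrightarrow> x \<in> {A, B}" for x by (auto simp: tAB)
  have hA: "h A = 5" "h B = 5" by (auto simp: h_def)
  have hN: "h x = 0" if "x \<notin> {A, B}" for x using that by (auto simp: h_def)
  have u0: "u (x, 0) = (t x, 0)" if "x \<in> U" "x \<notin> {A, B}" for x using that by (simp add: u_def)
  have uA: "u (A, 0) = (B, 5)" "u (A, Suc 0) = (A, Suc 0)" "u (A, 2) = (B, 4)" "u (A, 3) = (A, 3)"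
      "u (A, 4) = (B, 3)" "u (A, 5) = (B, 0)"
    and uB: "u (B, 0) = (A, 5)" "u (B, Suc 0) = (B, 2)" "u (B, 2) = (B, Suc 0)" "u (B, 3) = (A, 4)"
      "u (B, 4) = (A, 2)" "u (B, 5) = (A, 0)"
    using ne by (auto simp: u_def)
  have inT: "(A, i) \<in> ?T" "(B, i) \<in> ?T" if "i \<le> 5" for i using AB(1,2) that by (simp_all add: hA)
  have u_out: "u z = z" if "z \<notin> ?T" for z
  proof -
    have out: "z \<noteq> (A, i)" "z \<noteq> (B, i)" if "i \<le> 5" for i
      using inT[OF that] \<open>z \<notin> ?T\<close> by auto
    have "z \<noteq> (A, 0)" "z \<noteq> (A, 2)" "z \<noteq> (A, 4)" "z \<noteq> (A, 5)" "z \<noteq> (B, 0)" "z \<noteq> (B, 1)" "z \<noteq> (B, 2)"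
      "z \<noteq> (B, 3)" "z \<noteq> (B, 4)" "z \<noteq> (B, 5)"
      using out[of 0] out[of 1] out[of 2] out[of 3] out[of 4] out[of 5] by simp_all
    moreover have "\<not> (fst z \<in> U \<and> snd z = 0)" using that by (cases z) auto
    ultimately show ?thesis unfolding u_def by (simp only: if_False)
  qed
  have heights: "i = 0 \<or> i = Suc 0 \<or> i = 2 \<or> i = 3 \<or> i = 4 \<or> i = 5" if "i \<le> 5" for i :: nat
    using that by linarith
  have cases_T: thesis if z: "z \<in> ?T"
    and old: "\<And>x. z = (x, 0) \<Longrightarrow> x \<in> U \<Longrightarrow> x \<notin> {A, B} \<Longrightarrow> thesis"
    and new: "z \<in> {A, B} \<times> {0, Suc 0, 2, 3, 4, 5} \<Longrightarrow> thesis" for z thesis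
  proof -
    obtain x i where xi: "z = (x, i)" "x \<in> U" "i \<le> h x" using z by (cases z) auto
    show thesis
    proof (cases "x \<in> {A, B}")
      case True
      then have "i \<le> 5" using xi(3) by (auto simp: h_def)
      then show thesis using heights[of i] True xi(1) by (intro new) auto
    next
      case False
      then show thesis using old xi hN[OF False] by simp
    qed
  qed
  have uu: "u (u z) = z" for z
  proof (cases "z \<in> ?T")
    case True
    then show ?thesis
    proof (rule cases_T)
      fix x assume "z = (x, 0)" "x \<in> U" "x \<notin> {A, B}"
      then show ?thesis using tR[of x] by (simp add: u0 memU tt del: insert_iff)
    next
      assume "z \<in> {A, B} \<times> {0, Suc 0, 2, 3, 4, 5}"
      then show ?thesis by (elim SigmaE insertE emptyE) (simp_all add: uA uB)
    qed
  qed (simp add: u_out)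
  have uT: "u permutes ?T" by (rule involution_permutes[OF uu u_out])
  have s0: "?s (x, 0) = (s x, 0)" if "x \<in> U" "x \<notin> {A, B}" for x
    using that by (simp add: climb_def h_def)
  have sA: "?s (A, 0) = (A, Suc 0)" "?s (A, Suc 0) = (A, 2)" "?s (A, 2) = (A, 3)" "?s (A, 3) = (A, 4)"
      "?s (A, 4) = (A, 5)" "?s (A, 5) = (x1, 0)"
    and sB: "?s (B, 0) = (B, Suc 0)" "?s (B, Suc 0) = (B, 2)" "?s (B, 2) = (B, 3)" "?s (B, 3) = (B, 4)"
      "?s (B, 4) = (B, 5)" "?s (B, 5) = (z1, 0)"
    using AB(1,2) s_local by (simp_all add: climb_def hA)
  have i0: "inv' ?s (x, 0) = (inv' s x, h (inv' s x))" if "x \<in> U" for x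
    using inv_climb[OF s that, of 0 h] by simp
  have locU: "x1 \<in> U" "x2 \<in> U" "x3 \<in> U" "y0 \<in> U" "z1 \<in> U" "z2 \<in> U" "y1 \<in> U" "w1 \<in> U" "y2 \<in> U" "w2 \<in> U"
    "v1 \<in> U" "v2 \<in> U"
  proof -
    show 1: "x1 \<in> U" "x2 \<in> U" "x3 \<in> U" "z1 \<in> U" "z2 \<in> U" "y1 \<in> U" "y2 \<in> U"
      using memU(1) AB(1,2) s_local by metis+
    show 2: "y0 \<in> U" "w1 \<in> U" "w2 \<in> U" using memU(2) 1 t_local by metis+
    show "v1 \<in> U" "v2 \<in> U" using memU(1) 2 s_local by metis+
  qed
  have v: "v1 \<notin> {A, B}" "v2 \<notin> {A, B}" using t_local(6,8) AB(3) t_local'(1) ne by auto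
  have notAB: "x1 \<notin> {A, B}" "x2 \<notin> {A, B}" "x3 \<notin> {A, B}" "y0 \<notin> {A, B}" "z1 \<notin> {A, B}" "z2 \<notin> {A, B}"
    "y1 \<notin> {A, B}" "w1 \<notin> {A, B}" "y2 \<notin> {A, B}" "w2 \<notin> {A, B}"
    using distinct by auto
  have sv: "?s (x1, 0) = (x2, 0)" "?s (x2, 0) = (x3, 0)" "?s (y0, 0) = (B, 0)" "?s (z1, 0) = (z2, 0)"
    "?s (z2, 0) = (y1, 0)" "?s (w1, 0) = (A, 0)" "?s (v1, 0) = (w1, 0)" "?s (y1, 0) = (y2, 0)" "?s (v2, 0) = (w2, 0)"
    using s0 locU notAB v s_local by simp_all
  have uv: "u (x1, 0) = (x1, 0)" "u (x2, 0) = (y0, 0)" "u (y0, 0) = (x2, 0)" "u (x3, 0) = (x3, 0)"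
    "u (z1, 0) = (z2, 0)" "u (z2, 0) = (z1, 0)" "u (y1, 0) = (w1, 0)" "u (w1, 0) = (y1, 0)"
    "u (v1, 0) = (v1, 0)" "u (y2, 0) = (w2, 0)" "u (w2, 0) = (y2, 0)" "u (v2, 0) = (v2, 0)"
    using u0 locU notAB v t_local t_local' by simp_all
  note loc = sA sB sv uA uB uv
  \<comment> \<open>The commutator at \<open>z\<close> is evaluated by exhibiting the point
    \<open>y\<close> before \<open>u z\<close>, so that the inverse of \<open>?s\<close> need not be
    computed.\<close>
  have G: "comm ?s u z = ?s (u y)" if "?s y = u z" for y z
    unfolding comm_def comp_apply that[symmetric] permutes_inverses[OF sT] ..
  have G1: "comm ?s u (x1, 0) = (B, Suc 0)" "comm ?s u (B, Suc 0) = (B, 3)" "comm ?s u (B, 3) = (A, 4)"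
    "comm ?s u (A, 4) = (B, 2)" "comm ?s u (B, 2) = (x1, 0)"
    using G[of "(A, 5)" "(x1, 0)"] G[of "(B, Suc 0)" "(B, Suc 0)"] G[of "(A, 3)" "(B, 3)"]
      G[of "(B, 2)" "(A, 4)"] G[of "(B, 0)" "(B, 2)"] by (simp_all add: loc)
  have G2: "comm ?s u (A, 0) = (A, 3)" "comm ?s u (A, 3) = (B, 5)" "comm ?s u (B, 5) = (y2, 0)"
    "comm ?s u (y2, 0) = (w2, 0)" "comm ?s u (w2, 0) = (A, 0)"
    using G[of "(B, 4)" "(A, 0)"] G[of "(A, 2)" "(A, 3)"] G[of "(w1, 0)" "(B, 5)"]
      G[of "(v2, 0)" "(y2, 0)"] G[of "(y1, 0)" "(w2, 0)"] by (simp_all add: loc)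
  have G3: "comm ?s u (B, 0) = (B, 4)" "comm ?s u (B, 4) = (A, 2)" "comm ?s u (A, 2) = (A, 5)"
    "comm ?s u (A, 5) = (x3, 0)" "comm ?s u (x3, 0) = (B, 0)"
    using G[of "(A, 4)" "(B, 0)"] G[of "(A, Suc 0)" "(B, 4)"] G[of "(B, 3)" "(A, 2)"]
      G[of "(y0, 0)" "(A, 5)"] G[of "(x2, 0)" "(x3, 0)"] by (simp_all add: loc)
  have G4: "comm ?s u (A, Suc 0) = (z1, 0)" "comm ?s u (z1, 0) = (y1, 0)" "comm ?s u (y1, 0) = (w1, 0)"
    "comm ?s u (w1, 0) = (z2, 0)" "comm ?s u (z2, 0) = (A, Suc 0)"
    using G[of "(A, 0)" "(A, Suc 0)"] G[of "(z1, 0)" "(z1, 0)"] G[of "(v1, 0)" "(y1, 0)"]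
      G[of "(z2, 0)" "(w1, 0)"] G[of "(B, 5)" "(z2, 0)"] by (simp_all add: loc)
  let ?E = "{A, B, x1, x3, z1, z2, y1, w1, y2, w2}"
  have H: "comm s t z = s (t y)" if "s y = t z" for y z
    unfolding comm_def comp_apply that[symmetric] permutes_inverses[OF s] ..
  have gE: "comm s t x1 = z1" "comm s t z1 = y1" "comm s t y1 = w1" "comm s t w1 = z2" "comm s t z2 = x1"
    "comm s t B = y2" "comm s t y2 = w2" "comm s t w2 = A" "comm s t A = x3" "comm s t x3 = B"
    using H[of A x1] H[of z1 z1] H[of v1 y1] H[of z2 w1] H[of B z2] H[of w1 B] H[of v2 y2] H[of y1 w2]
      H[of y0 A] H[of x2 x3] by (simp_all add: s_local t_local t_local' AB(3))
  have g_out: "comm s t x \<notin> ?E" if "x \<in> U - ?E" for x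
  proof
    assume "comm s t x \<in> ?E"
    moreover have "?E \<subseteq> comm s t ` ?E" by (simp add: gE)
    ultimately obtain y where "y \<in> ?E" "comm s t x = comm s t y" by blast
    then show False using that permutes_inj[OF comm_permutes] by (auto dest: injD)
  qed
  have g0: "comm ?s u (x, 0) = (comm s t x, 0)" if x: "x \<in> U - ?E" for x
  proof -
    let ?w = "inv' s (t x)"
    have w: "?w \<in> U" using x by (simp add: memU)
    have "?w \<notin> {A, B}"
    proof
      assume "?w \<in> {A, B}"
      then have "t x = s A \<or> t x = s B" using inv_s(2)[of "t x"] by (metis insert_iff singletonD)
      then have "t x = x1 \<or> t x = z1" unfolding s_local .
      then have "x = x1 \<or> x = z2" using t_local tt by metis
      then show False using x by auto
    qed
    moreover have "x \<notin> {A, B}" using x by auto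
    ultimately show ?thesis using x w tR by (simp add: comm_def u0 s0 i0 memU hN del: insert_iff)
  qed
  have f5: "(f ^^ 5) x = f (f (f (f (f x))))" for f :: "'a \<times> nat \<Rightarrow> 'a \<times> nat" and x
    by (simp add: numeral_eq_Suc)
  have pw: "(comm ?s u ^^ 5) z = z" if z: "z \<in> ?T" "z \<notin> (\<lambda>x. (x, 0)) ` (U - ?E)" for z
    using z(1)
  proof (rule cases_T)
    fix x assume x: "z = (x, 0)" "x \<in> U" "x \<notin> {A, B}"
    then have "x \<in> {x1, x3, z1, z2, y1, w1, y2, w2}" using z(2) by auto
    then show ?thesis
      unfolding x(1) by (elim insertE emptyE) (simp_all add: f5 G1 G2 G3 G4)
  next
    assume "z \<in> {A, B} \<times> {0, Suc 0, 2, 3, 4, 5}"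
    then show ?thesis
      by (elim SigmaE insertE emptyE) (simp_all add: f5 G1 G2 G3 G4)
  qed
  have "{z \<in> ?T. u z \<noteq> z} = (\<lambda>x. (x, 0)) ` {x \<in> U. t x \<noteq> x} \<union>
    ({A} \<times> {2, 4, 5} \<union> {B} \<times> {Suc 0, 2, 3, 4, 5})"
  proof -
    have "z \<in> {z \<in> ?T. u z \<noteq> z} \<longleftrightarrow> z \<in> (\<lambda>x. (x, 0)) ` {x \<in> U. t x \<noteq> x} \<union>
      ({A} \<times> {2, 4, 5} \<union> {B} \<times> {Suc 0, 2, 3, 4, 5})" if "z \<in> ?T" for z
      using that
    proof (rule cases_T)
      fix x assume "z = (x, 0)" "x \<in> U" "x \<notin> {A, B}"
      then show ?thesis by (auto simp: u0)
    next
      assume "z \<in> {A, B} \<times> {0, Suc 0, 2, 3, 4, 5}"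
      then show ?thesis
        by (elim SigmaE insertE emptyE) (simp_all add: uA uB AB(1-3) t_local' image_iff hA ne)
    qed
    moreover have "z \<in> ?T" if "z \<in> (\<lambda>x. (x, 0)) ` {x \<in> U. t x \<noteq> x} \<union>
      ({A} \<times> {2, 4, 5} \<union> {B} \<times> {Suc 0, 2, 3, 4, 5})" for z
      using that AB(1,2) by (auto simp: hA)
    ultimately show ?thesis by blast
  qed
  moreover have "card ((\<lambda>x. (x, 0 :: nat)) ` {x \<in> U. t x \<noteq> x} \<union>
    ({A} \<times> {2, 4, 5} \<union> {B} \<times> {Suc 0, 2, 3, 4, 5})) = card {x \<in> U. t x \<noteq> x} + 8"
  proof -
    have "card ((\<lambda>x. (x, 0 :: nat)) ` {x \<in> U. t x \<noteq> x}) = card {x \<in> U. t x \<noteq> x}"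
      by (rule card_image) (simp add: inj_on_def)
    moreover have "card ({A} \<times> {2, 4, 5 :: nat} \<union> {B} \<times> {Suc 0, 2, 3, 4, 5}) = 8"
      using ne by (subst card_Un_disjoint) (auto simp: card_cartesian_product)
    moreover have "((\<lambda>x. (x, 0 :: nat)) ` {x \<in> U. t x \<noteq> x}) \<inter>
      ({A} \<times> {2, 4, 5} \<union> {B} \<times> {Suc 0, 2, 3, 4, 5}) = {}" by auto
    ultimately show ?thesis using fin by (subst card_Un_disjoint) simp_all
  qed
  ultimately have moved': "4 dvd card {z \<in> ?T. u z \<noteq> z}" using moved by simp
  have D: "coset_diagram ?T ?s u ((\<lambda>x. (x, 0)) ` F) (a, 0) (b, 0) (c, 0)"
  proof (rule extend[where E = ?E and k = 5])
    show "inj (\<lambda>x. (x, 0 :: nat))" by (simp add: inj_on_def)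
    show "(\<lambda>x. (x, 0)) ` U \<subseteq> ?T" by auto
    have FR: "x \<notin> {A, B}" if "x \<in> F" for x using that AB(4,5) by auto
    show "?s (x, 0) = (s x, 0)" if "x \<in> F" for x using that FR FU by (intro s0) auto
    show "u (x, 0) = (t x, 0)" if "x \<in> F" for x using that FR FU by (intro u0) auto
    show "u (a, 0) = (c, 0)" using u0[of a] abc abc_local ta by auto
    show "{a, b, c} \<inter> ?E = {}" by (rule abc_local)
    show "(s x, 0) \<in> orbit ?s (x, 0)" if "x \<in> U" for x
      unfolding orbit_climb[OF fin s that] by (auto intro: orbit.base)
    show "(t x, 0) \<in> orbit ?s (u (x, 0))" if x: "x \<in> U" for x
    proof (cases "x \<in> {A, B}")
      case True
      then have ux: "u (x, 0) = (t x, 5)" using uA(1) uB(1) AB(3) t_local'(1) by (metis insert_iff singletonD)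
      have "h (t x) = 5" using True tAB[of x] hA by (metis insert_iff singletonD)
      then have "(t x, 5) \<in> orbit ?s (t x, 0)"
        using x permutation_self_in_orbit[OF perm_s] by (simp add: orbit_climb[OF fin s] memU)
      then show ?thesis unfolding ux by (rule orbit_sym[OF ps])
    next
      case False
      then show ?thesis unfolding u0[OF x False] by (intro permutation_self_in_orbit[OF ps])
    qed
    show "\<exists>x\<in>U. z \<in> orbit ?s (x, 0)" if "z \<in> ?T" for z
      using that orbit_climb[OF fin s] permutation_self_in_orbit[OF perm_s]
      by (cases z) (auto intro!: bexI[of _ "fst z"])
    show "\<not> 3 dvd (5 :: nat)" by simp
  qed (fact finT sT uT uu g_out g0 pw moved')+
  let ?\<rho> = "s \<circ> t" and ?r = "?s \<circ> u"
  have \<rho>0: "?r (x, 0) = (?\<rho> x, 0)" if "x \<in> U" for x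
  proof (cases "x \<in> {A, B}")
    case True
    then show ?thesis using uA(1) uB(1) sA(6) sB(6) AB(3) t_local' s_local by auto
  next
    case False
    then show ?thesis using that tR[of x] by (simp add: u0 s0 memU del: insert_iff)
  qed
  have \<rho>U: "orbit ?\<rho> x \<subseteq> U" if "x \<in> U" for x
    by (rule orbit_subset_closed) (use that in \<open>auto simp: memU\<close>)
  have orb_old: "orbit ?r (x, 0) = (\<lambda>y. (y, 0)) ` orbit ?\<rho> x" if "x \<in> U" for x
    by (rule orbit_semiconj) (use \<rho>0 \<rho>U[OF that] that in blast)
  have card_old: "card (orbit ?r (x, 0)) = card (orbit ?\<rho> x)" if "x \<in> U" for x
    unfolding orb_old[OF that] by (rule card_image) (simp add: inj_on_def)
  have triangle: "card (orbit f z) = 3"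
    if f: "f p = q" "f q = r" "f r = p" and d: "p \<noteq> q" "q \<noteq> r" "p \<noteq> r" and z: "z \<in> {p, q, r}"
    for f :: "'a \<times> nat \<Rightarrow> 'a \<times> nat" and p q r z
  proof -
    define \<phi> where "\<phi> i = (if i = 0 then p else if i = 1 then q else r)" for i :: nat
    have step: "f (\<phi> j) = \<phi> (Suc j mod 3)" if "j < 3" for j
    proof -
      have "j = 0 \<or> j = 1 \<or> j = 2" using that by linarith
      then show ?thesis by (elim disjE) (simp_all add: \<phi>_def f)
    qed
    have "\<phi> 0 = p" "\<phi> 1 = q" "\<phi> 2 = r" by (simp_all add: \<phi>_def)
    then have "z = \<phi> 0 \<or> z = \<phi> 1 \<or> z = \<phi> 2" using z by simp
    then obtain i where i: "i < 3" "z = \<phi> i"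
      by (elim disjE) (use that[of 0] that[of 1] that[of 2] in simp_all)
    have "orbit f z = \<phi> ` {..<3}"
      unfolding i(2) by (rule orbit_of_indexed_cycle[where f = f and \<phi> = \<phi> and l = 3]) (use step i in auto)
    also have "\<dots> = {p, q, r}"
    proof -
      have "{..<3 :: nat} = {0, 1, 2}" by auto
      then show ?thesis by (auto simp: \<phi>_def)
    qed
    finally show ?thesis using d by simp
  qed
  have faces': "regular_cycles ?T ?r 3"
    unfolding regular_cycles_def
  proof (intro conjI ballI)
    \<comment> \<open>The ten points at levels 1 to 5 make up three triangles and the face
      \<open>(B, 2)\<close> of length 1, which lies inside the loop between levels 1 and 2.\<close>
    have new: "?r (B, 2) = (B, 2)" "card (orbit ?r z) = 3"
      if "z \<in> {A, B} \<times> {Suc 0, 2, 3, 4, 5} - {(B, 2)}" for z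
    proof -
      show "?r (B, 2) = (B, 2)" by (simp add: loc)
      have "z \<in> {(B, 5), (A, Suc 0), (A, 2)} \<or> z \<in> {(B, 4), (A, 3), (A, 4)} \<or> z \<in> {(B, 3), (A, 5), (B, Suc 0)}"
        using that by auto
      then show "card (orbit ?r z) = 3"
      proof (elim disjE)
        assume "z \<in> {(B, 5), (A, Suc 0), (A, 2)}"
        from this[THEN triangle[rotated -1]] show ?thesis by (simp add: loc ne)
      next
        assume "z \<in> {(B, 4), (A, 3), (A, 4)}"
        from this[THEN triangle[rotated -1]] show ?thesis by (simp add: loc ne)
      next
        assume "z \<in> {(B, 3), (A, 5), (B, Suc 0)}"
        from this[THEN triangle[rotated -1]] show ?thesis by (simp add: loc ne)
      qed
    qed
    have "(A, 2) \<in> ?T" using AB by (simp add: hA)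
    then show "\<exists>z\<in>?T. card (orbit ?r z) = 3" using new(2)[of "(A, 2)"] ne by auto
    have old: "?r (x, 0) = (x, 0) \<or> card (orbit ?r (x, 0)) = 3" if "x \<in> U" for x
      unfolding \<rho>0[OF that] card_old[OF that] using faces that by (auto simp: regular_cycles_def)
    fix z assume "z \<in> ?T"
    then show "?r z = z \<or> card (orbit ?r z) = 3"
    proof (rule cases_T)
      fix x assume "z = (x, 0)" "x \<in> U"
      then show ?thesis using old by blast
    next
      assume z: "z \<in> {A, B} \<times> {0, Suc 0, 2, 3, 4, 5}"
      show ?thesis
      proof (cases "z \<in> {(A, 0), (B, 0), (B, 2)}")
        case True then show ?thesis using old AB(1,2) new(1)[of "(A, 2)"] ne by auto
      next
        case False then show ?thesis using z by (intro disjI2 new(2)) auto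
      qed
    qed
  qed
  \<comment> \<open>On one side the old points \<open>x1\<close>, \<open>x2\<close>,
    \<open>x3\<close>, \<open>y0\<close> keep their roles; all other roles near the new rung pass to
    points of the columns.\<close>
  have "triangle_diagram ?T ?s u ((\<lambda>x. (x, 0)) ` F) (a, 0) (b, 0) (c, 0) (A, 5) (B, 0)
     (x1, 0) (x2, 0) (x3, 0) (y0, 0) (B, Suc 0) (B, 2) (B, 3) (A, 4) (B, 4) (A, 2) (A, 3) (A, Suc 0) (n + 5)"
  proof (intro triangle_diagram.intro rung_diagram_climb D triangle_diagram_axioms.intro)
    show "h x = (if x = A \<or> x = B then 5 else 0)" for x by (rule h_def)
    show "u (A, 5) = (B, 0)" by (rule uA)
    show "(A, 5) \<notin> (\<lambda>x. (x, 0)) ` F" "(B, 0) \<notin> (\<lambda>x. (x, 0)) ` F" using AB by auto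
    show "distinct [(A, 5), (B, 0), (x1, 0), (x2, 0), (x3, 0), (y0, 0), (B, Suc 0), (B, 2), (B, 3), (A, 4), (B, 4), (A, 2)]"
      using distinct by auto
    show "{(a, 0), (b, 0), (c, 0)} \<inter> {(A, 5), (B, 0), (x1, 0), (x3, 0), (B, Suc 0), (B, 2), (B, 3), (A, 4), (B, 4), (A, 2)} = {}"
      using abc_local by auto
  qed (simp_all add: loc faces')
  then show ?thesis by (intro exI)
qed

end

section \<open>Relabelling diagrams by conjugation\<close>

lemma conj_perm_apply: "bij f \<Longrightarrow> (f \<circ> s \<circ> inv' f) (f x) = f (s x)"
  by (simp add: bij_is_inj)

lemma conj_perm_permutes:
  assumes f: "bij f" and s: "s permutes U"
  shows "f \<circ> s \<circ> inv' f permutes f ` U"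
proof -
  have "bij (f \<circ> s \<circ> inv' f)"
    using f permutes_bij[OF s] by (intro bij_comp bij_imp_bij_inv)
  moreover have "(f \<circ> s \<circ> inv' f) z = z" if "z \<notin> f ` U" for z
  proof -
    obtain x where "z = f x" using f by (metis bij_pointE)
    then have "x \<notin> U" using that by blast
    then show ?thesis unfolding \<open>z = f x\<close> conj_perm_apply[OF f] by (simp add: permutes_not_in[OF s])
  qed
  ultimately show ?thesis unfolding permutes_def by (metis bij_pointE)
qed

lemma inv_conj_perm:
  assumes "bij f" "bij s"
  shows "inv' (f \<circ> s \<circ> inv' f) (f x) = f (inv' s x)"
proof (rule inv_f_eq)
  show "inj (f \<circ> s \<circ> inv' f)" using assms by (intro bij_is_inj bij_comp bij_imp_bij_inv)
  show "(f \<circ> s \<circ> inv' f) (f (inv' s x)) = f x"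
    unfolding conj_perm_apply[OF assms(1)] by (simp add: assms(2) bij_is_surj surj_f_inv_f)
qed

lemma orbit_conj_perm: "bij f \<Longrightarrow> orbit (f \<circ> s \<circ> inv' f) (f x) = f ` orbit s x"
  by (rule orbit_semiconj) (rule conj_perm_apply)

lemma regular_cycles_conj:
  assumes f: "bij f" and r: "regular_cycles U s m"
  shows "regular_cycles (f ` U) (f \<circ> s \<circ> inv' f) m"
proof -
  have card: "card (orbit (f \<circ> s \<circ> inv' f) (f x)) = card (orbit s x)" for x
    unfolding orbit_conj_perm[OF f] using f by (intro card_image) (auto simp: bij_def inj_on_def)
  have "f (s x) = f x \<longleftrightarrow> s x = x" for x using f by (auto dest: bij_is_inj injD)
  then show ?thesis
    using r conj_perm_apply[OF f, of s] unfolding regular_cycles_def ball_simps bex_simps card by simp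
qed

lemma conj_perm_comp:
  "bij f \<Longrightarrow> (f \<circ> s \<circ> inv' f) \<circ> (f \<circ> t \<circ> inv' f) = f \<circ> (s \<circ> t) \<circ> inv' f"
  by (simp add: fun_eq_iff bij_is_inj)

text \<open>The case of \<open>extend\<close> in which nothing is inserted: no commutator cycle is
  altered, so \<open>E\<close> is empty and the exponent is 1.\<close>

lemma (in coset_diagram) transport:
  assumes f: "bij f"
  shows "coset_diagram (f ` U) (f \<circ> s \<circ> inv' f) (f \<circ> t \<circ> inv' f) (f ` F) (f a) (f b) (f c)"
proof (rule extend[where E = "{}" and k = 1])
  let ?s = "f \<circ> s \<circ> inv' f" and ?t = "f \<circ> t \<circ> inv' f"
  note [simp] = conj_perm_apply[OF f, unfolded comp_apply]
  show "inj f" using f by (rule bij_is_inj)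
  have bs: "bij s" using s by (rule permutes_bij)
  have ps: "permutation ?s"
    by (rule permutes_imp_permutation[OF finite_imageI[OF fin] conj_perm_permutes[OF f s]])
  show "?s permutes f ` U" "?t permutes f ` U" using f s t by (auto intro: conj_perm_permutes)
  show "?t (?t z) = z" for z
  proof -
    obtain x where "z = f x" using f by (metis bij_pointE)
    then show ?thesis by (simp add: tt)
  qed
  show "comm ?s ?t (f x) = f (comm s t x)" for x
  proof -
    have "comm ?s ?t (f x) = ?s (?t (inv' ?s (?t (f x))))" by (simp only: comm_def comp_apply)
    also have "\<dots> = f (comm s t x)" unfolding conj_perm_apply[OF f] inv_conj_perm[OF f bs] by (simp add: comm_def)
    finally show ?thesis .
  qed
  show "f (s x) \<in> orbit ?s (f x)" "f (t x) \<in> orbit ?s (?t (f x))" for x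
    using permutation_self_in_orbit[OF perm_s] unfolding orbit_conj_perm[OF f] conj_perm_apply[OF f]
    by (auto intro: orbit.base)
  show "\<exists>x\<in>U. z \<in> orbit ?s (f x)" if "z \<in> f ` U" for z
    using that permutation_self_in_orbit[OF ps] by blast
  have "{z \<in> f ` U. ?t z \<noteq> z} = f ` {x \<in> U. t x \<noteq> x}" using \<open>inj f\<close> by (auto dest: injD)
  then have "card {z \<in> f ` U. ?t z \<noteq> z} = card {x \<in> U. t x \<noteq> x}"
    using \<open>inj f\<close> by (simp add: card_image inj_on_subset)
  then show "4 dvd card {z \<in> f ` U. ?t z \<noteq> z}" using moved by simp
qed (use fin ta f in \<open>auto simp: conj_perm_apply[unfolded comp_apply]\<close>)

lemma (in rung_diagram) transport_rung:
  assumes f: "bij f"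
  shows "rung_diagram (f ` U) (f \<circ> s \<circ> inv' f) (f \<circ> t \<circ> inv' f) (f ` F) (f a) (f b) (f c) (f A) (f B) n"
proof (intro rung_diagram.intro transport[OF f] rung_diagram_axioms.intro)
  note app = conj_perm_apply[OF f]
  have inj: "inj f" using f by (rule bij_is_inj)
  show "f A \<in> f ` U" "f B \<in> f ` U" using AB by auto
  show "f A \<notin> f ` F" "f B \<notin> f ` F" using AB inj by (auto dest: injD)
  show "(f \<circ> t \<circ> inv' f) (f A) = f B" unfolding app AB(3) ..
  show "orbit (f \<circ> s \<circ> inv' f) (f A) \<inter> orbit (f \<circ> s \<circ> inv' f) (f B) = {}"
    unfolding orbit_conj_perm[OF f] using orbits_AB(1) inj by (auto dest: injD)
  show "card (orbit (f \<circ> s \<circ> inv' f) (f A)) = n" "card (orbit (f \<circ> s \<circ> inv' f) (f B)) = n"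
    unfolding orbit_conj_perm[OF f] using orbits_AB(2,3) inj by (simp_all add: card_image inj_on_subset)
  show "(f \<circ> s \<circ> inv' f) z = z \<or> z \<in> orbit (f \<circ> s \<circ> inv' f) (f A) \<union> orbit (f \<circ> s \<circ> inv' f) (f B)"
    if z: "z \<in> f ` U" for z
  proof -
    obtain x where x: "x \<in> U" "z = f x" using z by blast
    show ?thesis using orbits_AB(4)[OF x(1)] unfolding x(2) orbit_conj_perm[OF f] app by auto
  qed
qed

lemma (in runged_diagram) transport_runged:
  assumes f: "bij f"
  shows "runged_diagram (f ` U) (f \<circ> s \<circ> inv' f) (f \<circ> t \<circ> inv' f) (f ` F) (f a) (f b) (f c)
    (f A) (f B) m n"
proof (intro runged_diagram.intro transport_rung[OF f] runged_diagram_axioms.intro)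
  note app = conj_perm_apply[OF f]
  have inj: "inj f" using f by (rule bij_is_inj)
  have bs: "bij s" using s by (rule permutes_bij)
  show "(f \<circ> t \<circ> inv' f) ((f \<circ> s \<circ> inv' f) (f A)) = (f \<circ> s \<circ> inv' f) (f A)"
    "(f \<circ> t \<circ> inv' f) ((f \<circ> s \<circ> inv' f) (f B)) = (f \<circ> s \<circ> inv' f) (f B)"
    "(f \<circ> t \<circ> inv' f) (inv' (f \<circ> s \<circ> inv' f) (f A)) = inv' (f \<circ> s \<circ> inv' f) (f A)"
    "(f \<circ> t \<circ> inv' f) (inv' (f \<circ> s \<circ> inv' f) (f B)) = inv' (f \<circ> s \<circ> inv' f) (f B)"
    unfolding inv_conj_perm[OF f bs] app free_AB by (rule refl)+
  show "{f a, f b, f c} \<inter> {f A, f B, (f \<circ> s \<circ> inv' f) (f A), (f \<circ> s \<circ> inv' f) (f B)} = {}"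
    unfolding app using abc_AB inj by (auto dest: injD)
  show "regular_cycles (f ` U) ((f \<circ> s \<circ> inv' f) \<circ> (f \<circ> t \<circ> inv' f)) m"
    unfolding conj_perm_comp[OF f] using f faces by (rule regular_cycles_conj)
qed

lemma (in triangle_diagram) transport_triangle:
  assumes f: "bij f"
  shows "triangle_diagram (f ` U) (f \<circ> s \<circ> inv' f) (f \<circ> t \<circ> inv' f) (f ` F) (f a) (f b) (f c)
    (f A) (f B) (f x1) (f x2) (f x3) (f y0) (f z1) (f z2) (f y1) (f w1) (f y2) (f w2) (f v1) (f v2) n"
proof (intro triangle_diagram.intro transport_rung[OF f] triangle_diagram_axioms.intro)
  note app = conj_perm_apply[OF f]
  have inj: "inj f" using f by (rule bij_is_inj)
  show "distinct [f A, f B, f x1, f x2, f x3, f y0, f z1, f z2, f y1, f w1, f y2, f w2]"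
    using distinct inj by (simp add: inj_eq)
  have "{f a, f b, f c} \<inter> f ` S = {}" if "{a, b, c} \<inter> S = {}" for S using that inj by (auto dest: injD)
  from this[OF abc_local]
  show "{f a, f b, f c} \<inter> {f A, f B, f x1, f x3, f z1, f z2, f y1, f w1, f y2, f w2} = {}" by simp
  show "regular_cycles (f ` U) ((f \<circ> s \<circ> inv' f) \<circ> (f \<circ> t \<circ> inv' f)) 3"
    unfolding conj_perm_comp[OF f] using f faces by (rule regular_cycles_conj)
qed (simp_all only: conj_perm_apply[OF f] s_local t_local AB(3))

text \<open>An insertion turns points into pairs. Coding them back by \<open>prod_encode\<close>
  keeps the statement over \<open>nat\<close>, so that insertions can be iterated.\<close>

definition runged :: "nat \<Rightarrow> nat \<Rightarrow> bool" where
  "runged m n \<longleftrightarrow> (\<exists>(U :: nat set) s t F a b c A B. runged_diagram U s t F a b c A B m n)"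

definition marked :: "nat \<Rightarrow> nat \<Rightarrow> nat \<Rightarrow> bool" where
  "marked m n d \<longleftrightarrow> (\<exists>(U :: nat set) s t F a b c A B Y. marked_diagram U s t F a b c A B m n Y d)"

definition triangular :: "nat \<Rightarrow> bool" where
  "triangular n \<longleftrightarrow> (\<exists>(U :: nat set) s t F a b c A B x1 x2 x3 y0 z1 z2 y1 w1 y2 w2 v1 v2.
     triangle_diagram U s t F a b c A B x1 x2 x3 y0 z1 z2 y1 w1 y2 w2 v1 v2 n)"

lemma runged_of_pairs:
  fixes U :: "(nat \<times> nat) set"
  assumes "runged_diagram U s t F a b c A B m n"
  shows "runged m n"
  using runged_diagram.transport_runged[OF assms bij_prod_encode] unfolding runged_def by (intro exI)

lemma runged_add_cell:
  assumes "runged m n" "m \<ge> 4" shows "runged m (n + m)"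
proof -
  obtain U :: "nat set" and s t F a b c A B where "runged_diagram U s t F a b c A B m n"
    using assms(1) unfolding runged_def by blast
  then interpret runged_diagram U s t F a b c A B m n .
  from insert_cell[OF assms(2)] show ?thesis by (elim exE) (rule runged_of_pairs)
qed

lemma marked_imp_runged: "marked m n d \<Longrightarrow> runged m n"
  unfolding marked_def runged_def by (blast dest: marked_diagram.axioms)

lemma marked_insert_chunks:
  assumes "marked m n d" "f \<ge> 1" "\<not> 3 dvd 2 * l + 1"
  shows "runged (m + l + f) (n + d * (2 * l + f))"
proof -
  obtain U :: "nat set" and s t F a b c A B Y where "marked_diagram U s t F a b c A B m n Y d"
    using assms(1) unfolding marked_def by blast
  then interpret marked_diagram U s t F a b c A B m n Y d .
  from insert_chunks[OF assms(2,3)] show ?thesis by (elim exE) (rule runged_of_pairs)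
qed

lemma triangular_add_5:
  assumes "triangular n" shows "triangular (n + 5)"
proof -
  obtain U :: "nat set" and s t F a b c A B x1 x2 x3 y0 z1 z2 y1 w1 y2 w2 v1 v2
    where "triangle_diagram U s t F a b c A B x1 x2 x3 y0 z1 z2 y1 w1 y2 w2 v1 v2 n"
    using assms unfolding triangular_def by (elim exE)
  then interpret triangle_diagram U s t F a b c A B x1 x2 x3 y0 z1 z2 y1 w1 y2 w2 v1 v2 n .
  show ?thesis using insert_cell
    by (elim exE) (unfold triangular_def, intro exI, erule triangle_diagram.transport_triangle, rule bij_prod_encode)
qed

lemma chiral_alternating_of_runged': "runged m n \<Longrightarrow> chiral_alternating m n"
  unfolding runged_def by (elim exE) (rule chiral_alternating_of_runged)

lemma chiral_alternating_of_triangular: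
  assumes "triangular n" shows "chiral_alternating 3 n"
proof -
  obtain U :: "nat set" and s t F a b c A B x1 x2 x3 y0 z1 z2 y1 w1 y2 w2 v1 v2
    where "triangle_diagram U s t F a b c A B x1 x2 x3 y0 z1 z2 y1 w1 y2 w2 v1 v2 n"
    using assms unfolding triangular_def by (elim exE)
  then interpret triangle_diagram U s t F a b c A B x1 x2 x3 y0 z1 z2 y1 w1 y2 w2 v1 v2 n .
  show ?thesis
    by (rule chiral_alternating_of_diagram[OF coset_diagram_axioms vertices evenperm_s faces])
qed

section \<open>Verified tables of coset diagrams\<close>

definition rot :: "nat \<Rightarrow> nat \<Rightarrow> nat \<Rightarrow> nat" where
  "rot n k x = (if x < n * k then n * (x div n) + Suc x mod n else x)"

text \<open>The inverse of \<open>rot\<close> in a form that can be evaluated. Adding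
  \<open>n - 1\<close> in place of subtracting 1 avoids truncation at the start of a block.\<close>

definition unrot :: "nat \<Rightarrow> nat \<Rightarrow> nat \<Rightarrow> nat" where
  "unrot n k x = (if x < n * k then n * (x div n) + (x + (n - 1)) mod n else x)"

lemma block_index:
  assumes "c < k" "i < n" shows "n * c + i < n * (k :: nat)"
proof -
  have "n * c + i < n * Suc c" using assms by simp
  also have "\<dots> \<le> n * k" using assms by (intro mult_le_mono2) simp
  finally show ?thesis .
qed

lemma block_cases:
  assumes "x < n * (k :: nat)"
  obtains c i where "x = n * c + i" "c < k" "i < n"
proof
  have "n > 0" using assms by (cases n) auto
  then show "x mod n < n" by simp
  show "x = n * (x div n) + x mod n" by simp
  show "x div n < k" using assms by (simp add: less_mult_imp_div_less mult.commute)
qed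

lemma rot_block: "c < k \<Longrightarrow> i < n \<Longrightarrow> rot n k (n * c + i) = n * c + Suc i mod n"
  using block_index[of c k i n] mod_mult_self4[of n c "Suc i"] by (simp add: rot_def)

lemma unrot_block: "c < k \<Longrightarrow> i < n \<Longrightarrow> unrot n k (n * c + i) = n * c + (i + (n - 1)) mod n"
  using block_index[of c k i n] mod_mult_self4[of n c "i + (n - 1)"] by (simp add: unrot_def add.assoc)

lemma rot_unrot: "rot n k (unrot n k x) = x" "unrot n k (rot n k x) = x"
proof -
  have "rot n k (unrot n k x) = x \<and> unrot n k (rot n k x) = x"
  proof (cases "x < n * k")
    case True
    then obtain c i where x: "x = n * c + i" "c < k" "i < n" by (rule block_cases)
    have "(Suc i mod n + (n - 1)) mod n = (Suc i + (n - 1)) mod n" by (rule mod_add_left_eq)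
    moreover have "Suc i + (n - 1) = i + n" using x(3) by simp
    ultimately have *: "Suc ((i + (n - 1)) mod n) mod n = i" "(Suc i mod n + (n - 1)) mod n = i"
      using x(3) by (simp_all add: mod_Suc_eq)
    have "rot n k (n * c + (i + (n - 1)) mod n) = n * c + i"
      using x rot_block[of c k "(i + (n - 1)) mod n" n] * by simp
    moreover have "unrot n k (n * c + Suc i mod n) = n * c + i"
      using x unrot_block[of c k "Suc i mod n" n] * by simp
    ultimately show ?thesis unfolding x(1) rot_block[OF x(2,3)] unrot_block[OF x(2,3)] by blast
  qed (simp add: rot_def unrot_def)
  then show "rot n k (unrot n k x) = x" "unrot n k (rot n k x) = x" by blast+
qed

lemma rot_permutes: "rot n k permutes {..<n * k}"
proof -
  have "bij (rot n k)" using rot_unrot by (metis bijI')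
  moreover have "rot n k x = x" if "x \<notin> {..<n * k}" for x using that by (simp add: rot_def)
  ultimately show ?thesis unfolding permutes_def by (metis bij_pointE)
qed

lemma inv_rot: "inv' (rot n k) = unrot n k"
  by (rule inv_unique_comp) (simp_all add: fun_eq_iff rot_unrot)

lemma orbit_rot:
  assumes "c < k" "i < n" shows "orbit (rot n k) (n * c + i) = {n * c..<n * c + n}"
proof -
  have "orbit (rot n k) (n * c + i) = (\<lambda>j. n * c + j) ` {..<n}"
    by (rule orbit_of_indexed_cycle[where f = "rot n k" and \<phi> = "\<lambda>j. n * c + j"])
      (use assms rot_block in auto)
  then show ?thesis by (simp add: lessThan_atLeast0 add.commute)
qed

text \<open>Squares are even. For odd \<open>n\<close> the rotation is the square of one of its own
  powers; for even \<open>k\<close> the blocks are paired, and the rotation of a pair is the square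
  of a cycle of length \<open>2 * n\<close>.\<close>

lemma evenperm_rot:
  assumes "odd n \<or> even k" shows "evenperm (rot n k)"
proof -
  have perm: "permutation (rot n k)" by (rule permutes_imp_permutation[OF _ rot_permutes]) simp
  have square: "evenperm (q \<circ> q)" if "permutation q" for q :: "nat \<Rightarrow> nat"
    using evenperm_comp[OF that that] by simp
  show ?thesis using assms
  proof
    assume "odd n"
    then obtain j where j: "n = 2 * j + 1" by (rule oddE)
    have pow: "(rot n k ^^ n) x = x" for x
    proof (cases "x < n * k")
      case True
      then obtain c i where x: "x = n * c + i" "c < k" "i < n" by (rule block_cases)
      then show ?thesis
        unfolding x(1) using rot_block
        by (intro funpow_of_indexed_cycle[where f = "rot n k" and \<phi> = "\<lambda>j. n * c + j"]) auto
    next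
      case False
      then have "rot n k x = x" by (simp add: rot_def)
      then have "(rot n k ^^ l) x = x" for l by (induction l) auto
      then show ?thesis .
    qed
    define q where "q = rot n k ^^ Suc j"
    have "q \<circ> q = rot n k \<circ> rot n k ^^ n"
    proof -
      have "Suc j + Suc j = Suc n" using j by simp
      then show ?thesis unfolding q_def funpow_add[symmetric] by (simp only: funpow.simps(2))
    qed
    then have "q \<circ> q = rot n k" using pow by (simp add: fun_eq_iff)
    moreover have "q permutes {..<n * k}" unfolding q_def using rot_permutes by (rule permutes_funpow)
    ultimately show ?thesis using square[of q] permutes_imp_permutation[of "{..<n * k}" q] by simp
  next
    assume k: "even k"
    \<comment> \<open>Alternates between the two blocks of a pair and advances by one on each way
      back, so that two steps rotate either block by one.\<close>
    define q where "q x = (if x < n * k then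
       if even (x div n) then n * Suc (x div n) + x mod n else n * (x div n - 1) + Suc x mod n else x)" for x
    have qb: "q (n * c + i) = (if even c then n * Suc c + i else n * (c - 1) + Suc i mod n)"
      if "c < k" "i < n" for c i
      using that block_index[of c k i n] mod_mult_self4[of n c "Suc i"] by (simp add: q_def)
    have qq: "q (q x) = rot n k x" for x
    proof (cases "x < n * k")
      case True
      then obtain c i where x: "x = n * c + i" "c < k" "i < n" by (rule block_cases)
      show ?thesis
      proof (cases "even c")
        case True
        then have "Suc c \<noteq> k" using k by auto
        then show ?thesis using x True qb[of "Suc c" i] by (simp add: qb rot_block)
      next
        case False
        then show ?thesis
          using x qb[of "c - 1" "Suc i mod n"] odd_pos[OF False] by (simp add: qb rot_block)
      qed
    qed (simp add: q_def rot_def)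
    have "bij q"
    proof (rule bijI)
      show "inj q"
      proof (rule injI)
        fix x y assume "q x = q y"
        then have "rot n k x = rot n k y" unfolding qq[symmetric] by simp
        from arg_cong[OF this, of "unrot n k"] show "x = y" unfolding rot_unrot .
      qed
      show "surj q" by (rule surjI[of _ "\<lambda>x. q (unrot n k x)"]) (simp add: qq rot_unrot)
    qed
    moreover have "q x = x" if "x \<notin> {..<n * k}" for x using that by (simp add: q_def)
    ultimately have "q permutes {..<n * k}" unfolding permutes_def by (metis bij_pointE)
    moreover have "q \<circ> q = rot n k" using qq by (simp add: fun_eq_iff)
    ultimately show ?thesis using square[of q] permutes_imp_permutation[of "{..<n * k}" q] by simp
  qed
qed

fun swaps :: "(nat \<times> nat) list \<Rightarrow> nat \<Rightarrow> nat" where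
  "swaps [] x = x"
| "swaps ((p, q) # ts) x = (if x = p then q else if x = q then p else swaps ts x)"

lemma swaps_not_in: "x \<notin> set (map fst ts @ map snd ts) \<Longrightarrow> swaps ts x = x"
  by (induction ts x rule: swaps.induct) auto

lemma swaps_in: "x \<in> set (map fst ts @ map snd ts) \<Longrightarrow> swaps ts x \<in> set (map fst ts @ map snd ts)"
  by (induction ts x rule: swaps.induct) auto

lemma swaps_moves:
  "distinct (map fst ts @ map snd ts) \<Longrightarrow> x \<in> set (map fst ts @ map snd ts) \<Longrightarrow> swaps ts x \<noteq> x"
  by (induction ts x rule: swaps.induct) auto

lemma swaps_swaps:
  "distinct (map fst ts @ map snd ts) \<Longrightarrow> swaps ts (swaps ts x) = x"
proof (induction ts x rule: swaps.induct)
  case (2 p q ts x)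
  have "swaps ts x \<noteq> p \<and> swaps ts x \<noteq> q" if "x \<noteq> p" "x \<noteq> q"
  proof (cases "x \<in> set (map fst ts @ map snd ts)")
    case True
    then show ?thesis using swaps_in[OF True] 2(2) by auto
  qed (use that swaps_not_in in auto)
  then show ?case using 2 by auto
qed simp

section \<open>Certificates as executable checks\<close>

fun act :: "('a \<Rightarrow> 'a) \<Rightarrow> ('a \<Rightarrow> 'a) \<Rightarrow> ('a \<Rightarrow> 'a) \<Rightarrow> letter list \<Rightarrow> 'a \<Rightarrow> 'a" where
  "act s s' t [] x = x"
| "act s s' t (Fwd # w) x = act s s' t w (s x)"
| "act s s' t (Bwd # w) x = act s s' t w (s' x)"
| "act s s' t (Flip # w) x = act s s' t w (t x)"

lemma act_eq_word_perm: "act s (inv' s) t w x = word_perm s t w x"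
  by (induction s "inv' s" t w x rule: act.induct) simp_all

text \<open>Evaluates a word along a path and yields \<open>None\<close> if a step uses a point
  outside \<open>P\<close>. The condition on the end point is checked separately.\<close>

fun walk :: "('a \<Rightarrow> 'a) \<Rightarrow> ('a \<Rightarrow> 'a) \<Rightarrow> ('a \<Rightarrow> 'a) \<Rightarrow> ('a \<Rightarrow> bool) \<Rightarrow> letter list \<Rightarrow> 'a \<Rightarrow> 'a option" where
  "walk s s' t P [] x = Some x"
| "walk s s' t P (Fwd # w) x = (if P x then walk s s' t P w (s x) else None)"
| "walk s s' t P (Bwd # w) x = (if P (s' x) then walk s s' t P w (s' x) else None)"
| "walk s s' t P (Flip # w) x = (if P x then walk s s' t P w (t x) else None)"

lemma trail_of_walk:
  assumes "walk s s' t P w x = Some y" "P y" "\<And>z. s (s' z) = z"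
  shows "\<exists>p. trail s t {z. P z} w (x # p) \<and> last (x # p) = y"
  using assms
proof (induction s s' t P w x rule: walk.induct)
  case (1 s s' t P x)
  then show ?case by (intro exI[of _ "[]"]) simp
next
  case (2 s s' t P w x)
  then obtain p where "trail s t {z. P z} w (s x # p)" "last (s x # p) = y" by (auto split: if_splits)
  then show ?case using 2(2) by (intro exI[of _ "s x # p"]) (auto split: if_splits)
next
  case (3 s s' t P w x)
  then obtain p where "trail s t {z. P z} w (s' x # p)" "last (s' x # p) = y" by (auto split: if_splits)
  then show ?case using 3(2,4) by (intro exI[of _ "s' x # p"]) (auto split: if_splits)
next
  case (4 s s' t P w x)
  then obtain p where "trail s t {z. P z} w (t x # p)" "last (t x # p) = y" by (auto split: if_splits)
  then show ?case using 4(2) by (intro exI[of _ "t x # p"]) (auto split: if_splits)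
qed

lemma near_walk:
  assumes "near s t {z. P z} a b c x y" "walk s s' t P w x = Some x'" "walk s s' t P w y = Some y'"
    and "\<And>z. s (s' z) = z"
  shows "near s t {z. P z} a b c x' y'"
  using assms(1-3)
proof (induction w arbitrary: x y)
  case (Cons l w)
  show ?case
  proof (cases l)
    case Fwd
    then have P: "P x" "P y" using Cons.prems by (auto split: if_splits)
    have "near s t {z. P z} a b c (s x) (s y)" using near_s[OF Cons.prems(1)] P by simp
    then show ?thesis using Cons.IH Cons.prems Fwd P by simp
  next
    case Bwd
    then have P: "P (s' x)" "P (s' y)" using Cons.prems by (auto split: if_splits)
    have "near s t {z. P z} a b c (s (s' x)) (s (s' y))" using Cons.prems(1) by (simp add: assms(4))
    from near_s_back[OF this] have "near s t {z. P z} a b c (s' x) (s' y)" using P by simp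
    then show ?thesis using Cons.IH Cons.prems Bwd P by simp
  next
    case Flip
    then have P: "P x" "P y" using Cons.prems by (auto split: if_splits)
    have "near s t {z. P z} a b c (t x) (t y)" using near_t[OF Cons.prems(1)] P by simp
    then show ?thesis using Cons.IH Cons.prems Flip P by simp
  qed
qed simp

text \<open>Replays a derivation of \<open>near\<close>, with \<open>L\<close> collecting points
  known to be near \<open>a\<close>. An entry moves two known points by one word; if the image of
  the first is already known, the image of the second may be added. An invalid entry yields the
  empty list, for which every later test fails.\<close>

fun joins :: "('a \<Rightarrow> 'a) \<Rightarrow> ('a \<Rightarrow> 'a) \<Rightarrow> ('a \<Rightarrow> 'a) \<Rightarrow> ('a \<Rightarrow> bool) \<Rightarrow> (letter list \<times> 'a \<times> 'a) list \<Rightarrow> 'a list \<Rightarrow> 'a list" where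
  "joins s s' t P [] L = L"
| "joins s s' t P ((w, x, y) # js) L = (if x \<in> set L \<and> y \<in> set L then
     (case walk s s' t P w x of None \<Rightarrow> [] | Some x' \<Rightarrow> if x' \<in> set L then
       (case walk s s' t P w y of None \<Rightarrow> [] | Some y' \<Rightarrow> joins s s' t P js (y' # L)) else []) else [])"

lemma near_joins:
  assumes "\<forall>x\<in>set L. near s t {z. P z} a b c a x" "\<And>z. s (s' z) = z"
  shows "\<forall>x\<in>set (joins s s' t P js L). near s t {z. P z} a b c a x"
  using assms(1)
proof (induction js arbitrary: L)
  case (Cons j js)
  obtain w x y where j: "j = (w, x, y)" by (cases j)
  show ?case
  proof (cases "joins s s' t P (j # js) L = []")
    case False
    then obtain x' y' where xy: "x \<in> set L" "y \<in> set L" "walk s s' t P w x = Some x'" "x' \<in> set L"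
      "walk s s' t P w y = Some y'"
      unfolding j by (auto split: if_splits option.splits)
    have "near s t {z. P z} a b c x y"
      using Cons(2) xy(1,2) by (meson near_sym near_trans)
    from near_walk[OF this xy(3,5) assms(2)] have "near s t {z. P z} a b c a y'"
      using Cons(2) xy(4) by (meson near_trans)
    then have "\<forall>x\<in>set (joins s s' t P js (y' # L)). near s t {z. P z} a b c a x"
      using Cons by (intro Cons.IH) auto
    then show ?thesis using xy unfolding j by simp
  qed simp
qed simp

fun trace :: "('a \<Rightarrow> 'a) \<Rightarrow> nat \<Rightarrow> 'a \<Rightarrow> 'a list" where
  "trace f 0 x = []"
| "trace f (Suc l) x = x # trace f l (f x)"

lemma trace_eq_map: "trace f l x = map (\<lambda>i. (f ^^ i) x) [0..<l]"
  by (induction l arbitrary: x) (simp_all add: upt_conv_Cons map_Suc_upt[symmetric] funpow_swap1 del: upt_Suc)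

definition cycle_ok :: "('a \<Rightarrow> 'a) \<Rightarrow> nat \<Rightarrow> 'a \<Rightarrow> bool" where
  "cycle_ok f l x \<longleftrightarrow> distinct (trace f l x) \<and> f (last (trace f l x)) = x \<and> l > 0"

lemma cycle_ok_imp:
  assumes "cycle_ok f l x"
  shows "orbit f x = set (trace f l x)" "card (orbit f x) = l" "y \<in> set (trace f l x) \<Longrightarrow> (f ^^ l) y = y"
proof -
  have l: "l > 0" using assms by (simp add: cycle_ok_def)
  define \<phi> where "\<phi> i = (f ^^ i) x" for i
  have tr: "trace f l x = map \<phi> [0..<l]" by (simp add: trace_eq_map \<phi>_def)
  have "last (trace f l x) = \<phi> (l - 1)" using l by (simp add: tr last_map)
  then have closed: "f (\<phi> (l - 1)) = \<phi> 0" using assms by (simp add: cycle_ok_def \<phi>_def)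
  have step: "f (\<phi> j) = \<phi> (Suc j mod l)" if "j < l" for j
  proof (cases "Suc j = l")
    case True
    then show ?thesis using closed by auto
  next
    case False
    then show ?thesis using that by (simp add: \<phi>_def)
  qed
  have "orbit f (\<phi> 0) = \<phi> ` {..<l}"
    by (rule orbit_of_indexed_cycle[where f = f and \<phi> = \<phi>]) (use l step in auto)
  then show o: "orbit f x = set (trace f l x)" by (simp add: tr \<phi>_def lessThan_atLeast0)
  have "length (trace f l x) = l" by (simp add: tr)
  then show "card (orbit f x) = l" unfolding o using assms by (simp add: cycle_ok_def distinct_card)
  assume "y \<in> set (trace f l x)"
  then obtain i where "i < l" "y = \<phi> i" unfolding tr by auto
  then show "(f ^^ l) y = y"
    using funpow_of_indexed_cycle[where f = f and \<phi> = \<phi> and l = l and i = i] l step by auto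
qed

fun elem :: "nat \<Rightarrow> nat list \<Rightarrow> bool" where
  "elem x [] \<longleftrightarrow> False"
| "elem x (y # ys) \<longleftrightarrow> x = y \<or> elem x ys"

lemma elem_iff [simp]: "elem x ys \<longleftrightarrow> x \<in> set ys"
  by (induction ys) auto

declare elem_iff [simp del]

fun traces :: "(nat \<Rightarrow> nat) \<Rightarrow> (nat \<times> nat) list \<Rightarrow> nat list" where
  "traces f [] = []"
| "traces f ((x, l) # rs) = trace f l x @ traces f rs"

fun covers :: "(nat \<Rightarrow> nat) \<Rightarrow> nat list \<Rightarrow> nat list \<Rightarrow> bool" where
  "covers f cs [] \<longleftrightarrow> True"
| "covers f cs (x # xs) \<longleftrightarrow> (f x = x \<or> elem x cs) \<and> covers f cs xs"

fun all_cycles :: "(nat \<Rightarrow> nat) \<Rightarrow> (nat \<times> nat) list \<Rightarrow> bool" where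
  "all_cycles f [] \<longleftrightarrow> True"
| "all_cycles f ((x, l) # rs) \<longleftrightarrow> cycle_ok f l x \<and> all_cycles f rs"

lemma covers_iff: "covers f cs xs \<longleftrightarrow> (\<forall>x\<in>set xs. f x = x \<or> x \<in> set cs)"
  by (induction xs) (auto simp: elem_iff)

lemma all_cycles_iff: "all_cycles f rs \<longleftrightarrow> (\<forall>(x, l)\<in>set rs. cycle_ok f l x)"
  by (induction f rs rule: all_cycles.induct) auto

lemma set_traces: "set (traces f rs) = (\<Union>(x, l)\<in>set rs. set (trace f l x))"
  by (induction f rs rule: traces.induct) auto

definition face :: "nat \<Rightarrow> nat \<Rightarrow> (nat \<times> nat) list \<Rightarrow> nat \<Rightarrow> nat" where
  "face n k ts x = rot n k (swaps ts x)"

definition wordmap :: "nat \<Rightarrow> nat \<Rightarrow> (nat \<times> nat) list \<Rightarrow> letter list \<Rightarrow> nat \<Rightarrow> nat" where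
  "wordmap n k ts w x = act (rot n k) (unrot n k) (swaps ts) w x"

definition faces_ok :: "(nat \<Rightarrow> nat) \<Rightarrow> nat \<Rightarrow> nat \<Rightarrow> nat list \<Rightarrow> bool" where
  "faces_ok f N m rs \<longleftrightarrow> rs \<noteq> [] \<and> hd rs < N \<and> all_cycles f (map (\<lambda>r. (r, m)) rs) \<and>
     covers f (traces f (map (\<lambda>r. (r, m)) rs)) [0..<N]"

lemma regular_cycles_of_faces_ok:
  assumes "permutation f" "faces_ok f N m rs"
  shows "regular_cycles {..<N} f m"
proof -
  have ok: "cycle_ok f m r" if "r \<in> set rs" for r
    using assms(2) that by (auto simp: faces_ok_def all_cycles_iff)
  have "card (orbit f x) = m" if x: "x < N" "f x \<noteq> x" for x
  proof -
    obtain r where r: "r \<in> set rs" "x \<in> set (trace f m r)"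
      using assms(2) x by (auto simp: faces_ok_def covers_iff set_traces)
    then have "x \<in> orbit f r" using cycle_ok_imp(1)[OF ok] by blast
    then show ?thesis
      using orbit_eq_iff_mem[OF assms(1)] cycle_ok_imp(2)[OF ok[OF r(1)]] by simp
  qed
  moreover have "hd rs \<in> {..<N}" "card (orbit f (hd rs)) = m"
    using assms(2) cycle_ok_imp(2)[OF ok, of "hd rs"] by (auto simp: faces_ok_def)
  ultimately show ?thesis unfolding regular_cycles_def by blast
qed

text \<open>The list gives a starting point and the length of each nontrivial cycle off
  \<open>Q\<close>. No length is divisible by 3, so the product of the lengths is a suitable
  exponent.\<close>

definition power_ok :: "(nat \<Rightarrow> nat) \<Rightarrow> nat \<Rightarrow> nat list \<Rightarrow> (nat \<times> nat) list \<Rightarrow> bool" where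
  "power_ok f N Q rs \<longleftrightarrow> all_cycles f rs \<and> list_all (\<lambda>(x, l). l mod 3 \<noteq> 0) rs \<and>
     covers f (Q @ traces f rs) [0..<N]"

lemma power_of_power_ok:
  assumes "power_ok f N Q rs"
  defines "E \<equiv> prod_list (map snd rs)"
  shows "\<not> 3 dvd E" "x < N \<Longrightarrow> x \<notin> set Q \<Longrightarrow> (f ^^ E) x = x"
proof -
  have l3: "list_all (\<lambda>(x, l). l mod 3 \<noteq> 0) rs" using assms(1) by (simp add: power_ok_def)
  then show "\<not> 3 dvd E"
    unfolding E_def by (induction rs) (auto simp: not_three_dvd_mult dvd_eq_mod_eq_0[symmetric])
  have rep: "(f ^^ (i * j)) z = z" if "(f ^^ i) z = z" for z i j
    using that by (induction j) (simp_all add: funpow_add)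
  assume x: "x < N" "x \<notin> set Q"
  show "(f ^^ E) x = x"
  proof (cases "f x = x")
    case True
    then have "(f ^^ j) x = x" for j by (induction j) auto
    then show ?thesis .
  next
    case False
    then obtain r l where r: "(r, l) \<in> set rs" "x \<in> set (trace f l r)"
      using assms(1) x by (auto simp: power_ok_def covers_iff set_traces)
    have "cycle_ok f l r" using assms(1) r(1) by (auto simp: power_ok_def all_cycles_iff)
    then have "(f ^^ l) x = x" using cycle_ok_imp(3) r(2) by metis
    moreover have "l dvd E" unfolding E_def using r(1) by (intro prod_list_dvd) force
    ultimately show ?thesis using rep by (metis dvdE)
  qed
qed

fun linked_down :: "(nat \<Rightarrow> nat) \<Rightarrow> nat \<Rightarrow> nat list \<Rightarrow> bool" where
  "linked_down t y [] \<longleftrightarrow> False"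
| "linked_down t y (x # xs) \<longleftrightarrow> t x < y \<or> linked_down t y xs"

lemma linked_down_iff: "linked_down t y xs \<longleftrightarrow> (\<exists>x\<in>set xs. t x < y)"
  by (induction t y xs rule: linked_down.induct) auto

fun all_below :: "(nat \<Rightarrow> nat) \<Rightarrow> nat \<Rightarrow> nat list \<Rightarrow> bool" where
  "all_below t y [] \<longleftrightarrow> True"
| "all_below t y (x # xs) \<longleftrightarrow> t x < y \<and> all_below t y xs"

lemma all_below_iff: "all_below t y xs \<longleftrightarrow> (\<forall>x\<in>set xs. t x < y)"
  by (induction t y xs rule: all_below.induct) auto

text \<open>Every block except the first has an edge of \<open>t\<close> to an earlier one, so by
  induction all blocks are joined to block 0.\<close>

fun blocks_linked :: "(nat \<Rightarrow> nat) \<Rightarrow> nat \<Rightarrow> nat \<Rightarrow> bool" where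
  "blocks_linked t n 0 \<longleftrightarrow> True"
| "blocks_linked t n (Suc k) \<longleftrightarrow> (k = 0 \<or> linked_down t (n * k) [n * k..<n * k + n]) \<and> blocks_linked t n k"

text \<open>Points from \<open>n * k\<close> on are vertices of length 1, each attached to a block
  by \<open>t\<close>. An even number of swaps makes the size of the support of \<open>t\<close> a
  multiple of 4.\<close>

definition base_ok :: "nat \<Rightarrow> nat \<Rightarrow> nat \<Rightarrow> (nat \<times> nat) list \<Rightarrow> bool" where
  "base_ok n k N ts \<longleftrightarrow> 0 < n \<and> 0 < k \<and> n * k \<le> N \<and> distinct (map fst ts @ map snd ts) \<and>
     list_all (\<lambda>x. x < N) (map fst ts @ map snd ts) \<and> even (length ts) \<and>
     blocks_linked (swaps ts) n k \<and> all_below (swaps ts) (n * k) [n * k..<N]"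

locale table =
  fixes n k N :: nat and ts :: "(nat \<times> nat) list"
  assumes base: "base_ok n k N ts"
begin

abbreviation "s \<equiv> rot n k"
abbreviation "s' \<equiv> unrot n k"
abbreviation "t \<equiv> swaps ts"

lemma ts: "distinct (map fst ts @ map snd ts)" "\<And>x. x \<in> set (map fst ts @ map snd ts) \<Longrightarrow> x < N"
  using base by (auto simp: base_ok_def list_all_iff)

lemma s_permutes: "s permutes {..<N}"
  by (rule permutes_subset[OF rot_permutes]) (use base in \<open>auto simp: base_ok_def\<close>)

lemma tt: "t (t x) = x" using ts(1) by (rule swaps_swaps)

lemma t_permutes: "t permutes {..<N}"
  by (rule involution_permutes[OF tt swaps_not_in]) (use ts(2) in auto)

lemma moved_t: "4 dvd card {x \<in> {..<N}. t x \<noteq> x}"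
proof -
  have "{x \<in> {..<N}. t x \<noteq> x} = set (map fst ts @ map snd ts)"
  proof (rule Set.set_eqI)
    show "x \<in> {x \<in> {..<N}. t x \<noteq> x} \<longleftrightarrow> x \<in> set (map fst ts @ map snd ts)" for x
      using swaps_not_in[of x ts] swaps_moves[OF ts(1), of x] ts(2)[of x] by blast
  qed
  then have "card {x \<in> {..<N}. t x \<noteq> x} = 2 * length ts" using distinct_card[OF ts(1)] by simp
  moreover have "even (length ts)" using base by (simp add: base_ok_def)
  ultimately show ?thesis by auto
qed

lemma word_perm_eq: "word_perm s t w = wordmap n k ts w"
  using act_eq_word_perm[of s t w] by (simp add: fun_eq_iff wordmap_def inv_rot)

lemma comm_eq_wordmap: "comm s t = wordmap n k ts [Flip, Bwd, Flip, Fwd]"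
  by (simp add: fun_eq_iff comm_def wordmap_def inv_rot)

lemma connected: "connected_on {..<N} s t"
  unfolding connected_on_def
proof (intro allI impI)
  fix S assume S: "S \<subseteq> {..<N}" "S \<noteq> {}" "s ` S \<subseteq> S" "t ` S \<subseteq> S"
  have n: "n > 0" "k > 0" using base by (simp_all add: base_ok_def)
  have t_mem: "t x \<in> S \<longleftrightarrow> x \<in> S" for x
  proof -
    have "t z \<in> S" if "z \<in> S" for z using that S(4) by blast
    from this[of x] this[of "t x"] show ?thesis unfolding tt by blast
  qed
  have block: "x \<in> S \<longleftrightarrow> y \<in> S" if "x \<in> {n * c..<n * c + n}" "y \<in> {n * c..<n * c + n}" "c < k" for x y c
  proof -
    have orb: "orbit s z = {n * c..<n * c + n}" if z: "z \<in> {n * c..<n * c + n}" for z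
    proof -
      obtain i where "z = n * c + i" "i < n" using z le_Suc_ex[of "n * c" z] by auto
      then show ?thesis using orbit_rot[OF \<open>c < k\<close>, of i n] by simp
    qed
    have "y \<in> S" if "x \<in> S" "x \<in> {n * c..<n * c + n}" "y \<in> {n * c..<n * c + n}" for x y
      using orbit_subset_closed[OF S(3) that(1)] that(2,3) orb by blast
    then show ?thesis using that by blast
  qed
  have start: "n * c \<in> S \<longleftrightarrow> 0 \<in> S" if "c < k" for c
    using that
  proof (induction c rule: less_induct)
    case (less c)
    show ?case
    proof (cases "c = 0")
      case False
      have "blocks_linked t n k" using base by (simp add: base_ok_def)
      then have "linked_down t (n * c) [n * c..<n * c + n]"
        using less.prems False by (induction k) (auto simp: less_Suc_eq)
      then obtain x where x: "x \<in> {n * c..<n * c + n}" "t x < n * c" by (auto simp: linked_down_iff)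
      from this(2) obtain c' i where c': "t x = n * c' + i" "c' < c" "i < n" by (rule block_cases)
      have "n * c \<in> S \<longleftrightarrow> x \<in> S" using x(1) less.prems n by (intro block[of _ c]) auto
      also have "\<dots> \<longleftrightarrow> n * c' \<in> S"
        using c' less.prems t_mem[of x] block[of "t x" c' "n * c'"] by auto
      also have "\<dots> \<longleftrightarrow> 0 \<in> S" using less c' by auto
      finally show ?thesis .
    qed simp
  qed
  have low: "x \<in> S \<longleftrightarrow> 0 \<in> S" if x: "x < n * k" for x
  proof -
    obtain c i where c: "x = n * c + i" "c < k" "i < n" using x by (rule block_cases)
    then show ?thesis using block[of x c "n * c"] start[of c] by auto
  qed
  have all: "x \<in> S \<longleftrightarrow> 0 \<in> S" if x: "x < N" for x
  proof (cases "x < n * k")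
    case False
    then have "t x < n * k" using base x by (auto simp: base_ok_def all_below_iff)
    then show ?thesis using low t_mem[of x] by blast
  qed (rule low)
  have "0 < N" using n base by (auto simp: base_ok_def)
  then show "S = {..<N}" using all S(1,2) by blast
qed

end

fun joined :: "(nat \<Rightarrow> nat) \<Rightarrow> (nat \<Rightarrow> bool) \<Rightarrow> nat list \<Rightarrow> nat list \<Rightarrow> bool" where
  "joined s P L [] \<longleftrightarrow> False"
| "joined s P L (x # xs) \<longleftrightarrow> P x \<and> elem (s x) L \<or> joined s P L xs"

lemma joined_iff: "joined s P L xs \<longleftrightarrow> (\<exists>x\<in>set xs. P x \<and> s x \<in> set L)"
  by (induction s P L xs rule: joined.induct) (auto simp: elem_iff)

definition outside :: "nat \<Rightarrow> nat list \<Rightarrow> nat \<Rightarrow> bool" where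
  "outside N zs x \<longleftrightarrow> x < N \<and> \<not> elem x zs"

definition ends_fixed :: "(nat \<Rightarrow> nat) \<Rightarrow> (nat \<Rightarrow> bool) \<Rightarrow> nat option \<Rightarrow> bool" where
  "ends_fixed t P z \<longleftrightarrow> (case z of None \<Rightarrow> False | Some y \<Rightarrow> P y \<and> t y = y)"

definition ends_moved :: "(nat \<Rightarrow> nat) \<Rightarrow> (nat \<Rightarrow> bool) \<Rightarrow> nat option \<Rightarrow> bool" where
  "ends_moved t P z \<longleftrightarrow> (case z of None \<Rightarrow> False | Some y \<Rightarrow> P y \<and> t y \<noteq> y)"

text \<open>\<open>zs\<close> lists the points reserved for insertions, namely the rung and the
  marks. The congruence and chirality certificates are checked on the complement
  \<open>outside N zs\<close>, which becomes \<open>F\<close>.\<close>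

definition diagram_ok :: "nat \<Rightarrow> nat \<Rightarrow> (nat \<times> nat) list \<Rightarrow> nat list \<Rightarrow> nat \<Rightarrow> nat \<Rightarrow> nat \<Rightarrow>
    (nat \<times> nat) list \<Rightarrow> letter list \<Rightarrow> (letter list \<times> nat \<times> nat) list \<Rightarrow> bool" where
  "diagram_ok n N ts zs a b c gs w js \<longleftrightarrow>
     base_ok n 2 N ts \<and> a < N \<and> b < N \<and> c < N \<and> a \<noteq> b \<and> b \<noteq> c \<and> a \<noteq> c \<and>
     wordmap n 2 ts [Flip, Bwd, Flip, Fwd] a = b \<and> wordmap n 2 ts [Flip, Bwd, Flip, Fwd] b = c \<and>
     wordmap n 2 ts [Flip, Bwd, Flip, Fwd] c = a \<and> swaps ts a = c \<and>
     power_ok (wordmap n 2 ts [Flip, Bwd, Flip, Fwd]) N [a, b, c] gs \<and>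
     ends_fixed (swaps ts) (outside N zs) (walk (rot n 2) (unrot n 2) (swaps ts) (outside N zs) w a) \<and>
     ends_fixed (swaps ts) (outside N zs) (walk (rot n 2) (unrot n 2) (swaps ts) (outside N zs) w b) \<and>
     ends_fixed (swaps ts) (outside N zs) (walk (rot n 2) (unrot n 2) (swaps ts) (outside N zs) w c) \<and>
     (ends_moved (swaps ts) (outside N zs) (walk (rot n 2) (unrot n 2) (swaps ts) (outside N zs) (Bwd # map mirror w) a) \<or>
      ends_moved (swaps ts) (outside N zs) (walk (rot n 2) (unrot n 2) (swaps ts) (outside N zs) (Bwd # map mirror w) b) \<or>
      ends_moved (swaps ts) (outside N zs) (walk (rot n 2) (unrot n 2) (swaps ts) (outside N zs) (Bwd # map mirror w) c)) \<and>
     (let L = joins (rot n 2) (unrot n 2) (swaps ts) (outside N zs) js [a, b, c] in joined (rot n 2) (outside N zs) L L)"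

lemma coset_diagram_of_table:
  assumes "diagram_ok n N ts zs a b c gs w js"
  shows "coset_diagram {..<N} (rot n 2) (swaps ts) {x. outside N zs x} a b c"
proof -
  interpret table n 2 N ts using assms by unfold_locales (simp add: diagram_ok_def)
  let ?P = "outside N zs"
  note ok = assms[unfolded diagram_ok_def Let_def, folded comm_eq_wordmap]
  show ?thesis
  proof
    show "\<exists>E. \<not> 3 dvd E \<and> (\<forall>x\<in>{..<N}. x \<notin> {a, b, c} \<longrightarrow> (comm s t ^^ E) x = x)"
    proof -
      have "power_ok (comm s t) N [a, b, c] gs" using ok by blast
      from power_of_power_ok[OF this] show ?thesis by (intro exI[of _ "prod_list (map snd gs)"]) simp
    qed
    \<comment> \<open>\<open>near\<close> has no rule of reflexivity; at \<open>a\<close> it follows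
      from the pair \<open>a\<close>, \<open>b\<close> by symmetry and transitivity.\<close>
    have aa: "near s t {x. ?P x} a b c a a" by (meson near_ab near_sym near_trans)
    then have "\<forall>x\<in>set (joins s s' t ?P js [a, b, c]). near s t {x. ?P x} a b c a x"
      by (intro near_joins rot_unrot) (simp add: near_ab near_ac)
    moreover obtain x where "?P x" "x \<in> set (joins s s' t ?P js [a, b, c])" "s x \<in> set (joins s s' t ?P js [a, b, c])"
      using ok unfolding joined_iff by blast
    ultimately show "\<exists>x\<in>{x. ?P x}. near s t {x. ?P x} a b c a x \<and> near s t {x. ?P x} a b c a (s x)"
      by blast
    have fixed: "\<exists>p. trail s t {x. ?P x} w (q # p) \<and> t (last (q # p)) = last (q # p)"
      if q: "ends_fixed t ?P (walk s s' t ?P w q)" for q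
    proof -
      obtain y where y: "walk s s' t ?P w q = Some y" "?P y" "t y = y"
        using q by (auto simp: ends_fixed_def split: option.splits)
      from trail_of_walk[OF y(1,2) rot_unrot(1)] y(3) show ?thesis by blast
    qed
    have moved: "\<exists>p. trail s t {x. ?P x} u p \<and> hd p = q \<and> t (last p) \<noteq> last p"
      if q: "ends_moved t ?P (walk s s' t ?P u q)" for q u
    proof -
      obtain y where y: "walk s s' t ?P u q = Some y" "?P y" "t y \<noteq> y"
        using q by (auto simp: ends_moved_def split: option.splits)
      from trail_of_walk[OF y(1,2) rot_unrot(1)] y(3) show ?thesis by (metis list.sel(1))
    qed
    have "\<exists>p. trail s t {x. ?P x} (Bwd # map mirror w) p \<and> hd p \<in> {a, b, c} \<and> t (last p) \<noteq> last p"
      using ok moved[of "Bwd # map mirror w"] by blast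
    then show "chiral_at s t {x. ?P x} a b c"
      unfolding chiral_at_def using ok fixed[of a] fixed[of b] fixed[of c] by blast
    show "a \<in> {..<N}" "b \<in> {..<N}" "c \<in> {..<N}" "a \<noteq> b" "b \<noteq> c" "a \<noteq> c"
      "comm s t a = b" "comm s t b = c" "comm s t c = a" "t a = c"
      using ok unfolding lessThan_iff by blast+
    show "{x. ?P x} \<subseteq> {..<N}" by (auto simp: outside_def)
  qed (fact finite_lessThan s_permutes t_permutes tt connected moved_t)+
qed

definition rung_ok :: "nat \<Rightarrow> nat \<Rightarrow> nat \<Rightarrow> (nat \<times> nat) list \<Rightarrow> nat \<Rightarrow> nat \<Rightarrow> nat \<Rightarrow> nat \<Rightarrow> nat list \<Rightarrow> bool" where
  "rung_ok m n N ts a b c A rs \<longleftrightarrow>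
     A < n \<and> n \<le> swaps ts A \<and> swaps ts A < n * 2 \<and>
     swaps ts (rot n 2 A) = rot n 2 A \<and> swaps ts (unrot n 2 A) = unrot n 2 A \<and>
     swaps ts (rot n 2 (swaps ts A)) = rot n 2 (swaps ts A) \<and>
     swaps ts (unrot n 2 (swaps ts A)) = unrot n 2 (swaps ts A) \<and>
     \<not> elem a [A, swaps ts A, rot n 2 A, rot n 2 (swaps ts A)] \<and>
     \<not> elem b [A, swaps ts A, rot n 2 A, rot n 2 (swaps ts A)] \<and>
     \<not> elem c [A, swaps ts A, rot n 2 A, rot n 2 (swaps ts A)] \<and>
     faces_ok (face n 2 ts) N m rs"

lemma orbit_rot_2:
  assumes "A < n" "n \<le> B" "B < n * 2"
  shows "orbit (rot n 2) A = {..<n}" "orbit (rot n 2) B = {n..<n * 2}"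
  using orbit_rot[of 0 2 A n] orbit_rot[of 1 2 "B - n" n] assms by (simp_all add: lessThan_atLeast0 mult_2_right)

lemma rung_diagram_of_table:
  assumes D: "diagram_ok n N ts zs a b c gs w js"
    and A: "A < n" "n \<le> B" "B < n * 2" "swaps ts A = B" and zs: "elem A zs" "elem B zs"
  shows "rung_diagram {..<N} (rot n 2) (swaps ts) {x. outside N zs x} a b c A B n"
proof (intro rung_diagram.intro coset_diagram_of_table[OF D] rung_diagram_axioms.intro)
  have nN: "n * 2 \<le> N" using D by (simp add: diagram_ok_def base_ok_def)
  note orb = orbit_rot_2[OF A(1-3)]
  show "A \<in> {..<N}" "B \<in> {..<N}" using A nN by auto
  show "swaps ts A = B" by (rule A)
  show "A \<notin> {x. outside N zs x}" "B \<notin> {x. outside N zs x}" using zs by (auto simp: outside_def)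
  show "orbit (rot n 2) A \<inter> orbit (rot n 2) B = {}" "card (orbit (rot n 2) A) = n" "card (orbit (rot n 2) B) = n"
    unfolding orb by auto
  show "rot n 2 x = x \<or> x \<in> orbit (rot n 2) A \<union> orbit (rot n 2) B" for x
    unfolding orb by (auto simp: rot_def)
qed

lemma faces_of_table:
  assumes "diagram_ok n N ts zs a b c gs w js" "faces_ok (face n 2 ts) N m rs"
  shows "regular_cycles {..<N} (rot n 2 \<circ> swaps ts) m"
proof -
  interpret table n 2 N ts using assms(1) by unfold_locales (simp add: diagram_ok_def)
  have "face n 2 ts = s \<circ> t" by (simp add: fun_eq_iff face_def)
  then show ?thesis
    using assms(2) permutes_imp_permutation[OF finite_lessThan permutes_compose[OF t_permutes s_permutes]]
    by (metis regular_cycles_of_faces_ok)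
qed

lemma runged_of_table:
  assumes D: "diagram_ok n N ts zs a b c gs w js" and R: "rung_ok m n N ts a b c A rs"
    and zs: "elem A zs" "elem (swaps ts A) zs"
  shows "runged_diagram {..<N} (rot n 2) (swaps ts) {x. outside N zs x} a b c A (swaps ts A) m n"
proof (intro runged_diagram.intro rung_diagram_of_table[OF D] runged_diagram_axioms.intro)
  have "faces_ok (face n 2 ts) N m rs" using R by (simp add: rung_ok_def)
  then show "regular_cycles {..<N} (rot n 2 \<circ> swaps ts) m" by (rule faces_of_table[OF D])
qed (use R zs in \<open>auto simp: rung_ok_def inv_rot elem_iff\<close>)

fun marks_fixed :: "nat \<Rightarrow> (nat \<times> nat) list \<Rightarrow> nat list \<Rightarrow> bool" where
  "marks_fixed n ts [] \<longleftrightarrow> True"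
| "marks_fixed n ts (y # ys) \<longleftrightarrow> y < n * 2 \<and> swaps ts y = y \<and> rot n 2 y \<noteq> y \<and> marks_fixed n ts ys"

lemma marks_fixed_iff:
  "marks_fixed n ts ys \<longleftrightarrow> (\<forall>y\<in>set ys. y < n * 2 \<and> swaps ts y = y \<and> rot n 2 y \<noteq> y)"
  by (induction n ts ys rule: marks_fixed.induct) auto

fun hits :: "nat list \<Rightarrow> nat list \<Rightarrow> nat" where
  "hits cs [] = 0"
| "hits cs (y # ys) = (if elem y cs then Suc (hits cs ys) else hits cs ys)"

lemma hits_eq: "hits cs ys = length (filter (\<lambda>y. y \<in> set cs) ys)"
  by (induction cs ys rule: hits.induct) (auto simp: elem_iff)

fun hit_once :: "(nat \<Rightarrow> nat) \<Rightarrow> nat \<Rightarrow> nat list \<Rightarrow> nat list \<Rightarrow> bool" where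
  "hit_once f m ys [] \<longleftrightarrow> True"
| "hit_once f m ys (r # rs) \<longleftrightarrow> hits (trace f m r) ys = 1 \<and> hit_once f m ys rs"

lemma hit_once_iff: "hit_once f m ys rs \<longleftrightarrow> (\<forall>r\<in>set rs. hits (trace f m r) ys = 1)"
  by (induction f m ys rs rule: hit_once.induct) auto

definition marked_ok :: "nat \<Rightarrow> nat \<Rightarrow> (nat \<times> nat) list \<Rightarrow> nat \<Rightarrow> nat list \<Rightarrow> nat list \<Rightarrow> bool" where
  "marked_ok m n ts d ys rs \<longleftrightarrow> distinct ys \<and> marks_fixed n ts ys \<and>
     length (filter (\<lambda>y. y < n) ys) = d \<and> length (filter (\<lambda>y. n \<le> y) ys) = d \<and>
     hit_once (face n 2 ts) m ys rs"

text \<open>Every point moved by the face permutation lies on one of the listed cycles, so counting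
  the marks on these cycles settles all faces.\<close>

lemma marked_of_table:
  assumes D: "diagram_ok n N ts (A # swaps ts A # ys) a b c gs w js" and R: "rung_ok m n N ts a b c A rs"
    and M: "marked_ok m n ts d ys rs"
  shows "marked m n d"
proof -
  let ?F = "{x. outside N (A # swaps ts A # ys) x}"
  interpret runged_diagram "{..<N}" "rot n 2" "swaps ts" ?F a b c A "swaps ts A" m n
    by (rule runged_of_table[OF D R]) simp_all
  have A: "A < n" "n \<le> swaps ts A" "swaps ts A < n * 2" using R by (auto simp: rung_ok_def)
  have nN: "n * 2 \<le> N" using D by (simp add: diagram_ok_def base_ok_def)
  have dist: "distinct ys" using M by (simp add: marked_ok_def)
  have ys: "y < n * 2" "swaps ts y = y" "rot n 2 y \<noteq> y" if "y \<in> set ys" for y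
    using M that by (auto simp: marked_ok_def marks_fixed_iff)
  have card: "card (set ys \<inter> S) = length (filter (\<lambda>y. y \<in> S) ys)" for S
    using distinct_card[OF distinct_filter[OF dist]] by (simp add: Int_def)
  have perm: "permutation (rot n 2 \<circ> swaps ts)"
    using permutes_imp_permutation[OF fin permutes_compose[OF t s]] .
  have face: "face n 2 ts = rot n 2 \<circ> swaps ts" by (simp add: fun_eq_iff face_def)
  have "marked_diagram {..<N} (rot n 2) (swaps ts) ?F a b c A (swaps ts A) m n (set ys) d"
  proof (intro marked_diagram.intro runged_diagram_axioms marked_diagram_axioms.intro)
    show "set ys \<subseteq> {..<N}" using ys nN by fastforce
    show "set ys \<inter> ?F = {}" by (auto simp: outside_def elem_iff)
    show "card (set ys \<inter> orbit (rot n 2) A) = d"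
      unfolding orbit_rot_2[OF A] card using M by (simp add: marked_ok_def)
    show "card (set ys \<inter> orbit (rot n 2) (swaps ts A)) = d"
      unfolding orbit_rot_2[OF A] card using M ys by (simp add: marked_ok_def cong: filter_cong)
    show "card (set ys \<inter> orbit (rot n 2 \<circ> swaps ts) x) = 1" if x: "x \<in> {..<N}" "rot n 2 (swaps ts x) \<noteq> x" for x
    proof -
      obtain r where r: "r \<in> set rs" "x \<in> set (trace (face n 2 ts) m r)" "cycle_ok (face n 2 ts) m r"
        using R x by (fastforce simp: rung_ok_def faces_ok_def covers_iff set_traces all_cycles_iff face_def)
      have "orbit (face n 2 ts) x = orbit (face n 2 ts) r"
        using r cycle_ok_imp(1)[OF r(3)] perm by (intro orbit_eq_iff_mem) (simp_all add: face)
      then have "card (set ys \<inter> orbit (face n 2 ts) x) = 1"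
        using M r(1) unfolding card by (simp add: cycle_ok_imp(1)[OF r(3)] marked_ok_def hit_once_iff hits_eq)
      then show ?thesis unfolding face .
    qed
  qed (use ys in auto)
  then show ?thesis unfolding marked_def by (intro exI)
qed

lemma runged_of_table':
  assumes "diagram_ok n N ts [A, swaps ts A] a b c gs w js" "rung_ok m n N ts a b c A rs"
  shows "runged m n"
  unfolding runged_def by (intro exI, rule runged_of_table[OF assms]) (simp_all add: elem_iff)

definition triangle_ok :: "nat \<Rightarrow> nat \<Rightarrow> (nat \<times> nat) list \<Rightarrow> nat \<Rightarrow> nat \<Rightarrow> nat \<Rightarrow> nat \<Rightarrow> nat \<Rightarrow> nat \<Rightarrow> nat \<Rightarrow> nat \<Rightarrow> nat \<Rightarrow>
    nat \<Rightarrow> nat \<Rightarrow> nat \<Rightarrow> nat \<Rightarrow> nat \<Rightarrow> nat \<Rightarrow> nat \<Rightarrow> nat \<Rightarrow> nat list \<Rightarrow> bool" where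
  "triangle_ok n N ts a b c A B x1 x2 x3 y0 z1 z2 y1 w1 y2 w2 v1 v2 rs \<longleftrightarrow>
     A < n \<and> n \<le> B \<and> B < n * 2 \<and> swaps ts A = B \<and>
     distinct [A, B, x1, x2, x3, y0, z1, z2, y1, w1, y2, w2] \<and>
     rot n 2 A = x1 \<and> rot n 2 x1 = x2 \<and> rot n 2 x2 = x3 \<and> rot n 2 y0 = B \<and> rot n 2 B = z1 \<and> rot n 2 z1 = z2 \<and>
     rot n 2 z2 = y1 \<and> rot n 2 w1 = A \<and> rot n 2 v1 = w1 \<and> rot n 2 y1 = y2 \<and> rot n 2 v2 = w2 \<and>
     swaps ts x1 = x1 \<and> swaps ts x2 = y0 \<and> swaps ts x3 = x3 \<and> swaps ts z1 = z2 \<and> swaps ts y1 = w1 \<and>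
     swaps ts v1 = v1 \<and> swaps ts y2 = w2 \<and> swaps ts v2 = v2 \<and>
     \<not> elem a [A, B, x1, x3, z1, z2, y1, w1, y2, w2] \<and> \<not> elem b [A, B, x1, x3, z1, z2, y1, w1, y2, w2] \<and>
     \<not> elem c [A, B, x1, x3, z1, z2, y1, w1, y2, w2] \<and> faces_ok (face n 2 ts) N 3 rs"

lemma triangular_of_table:
  assumes D: "diagram_ok n N ts [A, B] a b c gs w js"
    and T: "triangle_ok n N ts a b c A B x1 x2 x3 y0 z1 z2 y1 w1 y2 w2 v1 v2 rs"
  shows "triangular n"
proof -
  note T' = T[unfolded triangle_ok_def]
  have "triangle_diagram {..<N} (rot n 2) (swaps ts) {x. outside N [A, B] x} a b c
    A B x1 x2 x3 y0 z1 z2 y1 w1 y2 w2 v1 v2 n"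
  proof (intro triangle_diagram.intro rung_diagram_of_table[OF D] triangle_diagram_axioms.intro)
    show "elem A [A, B]" "elem B [A, B]" by simp_all
    have "faces_ok (face n 2 ts) N 3 rs" using T' by blast
    then show "regular_cycles {..<N} (rot n 2 \<circ> swaps ts) 3" by (rule faces_of_table[OF D])
    show "{a, b, c} \<inter> {A, B, x1, x3, z1, z2, y1, w1, y2, w2} = {}" using T' unfolding elem_iff by auto
  qed (use T' in blast)+
  then show ?thesis unfolding triangular_def by (intro exI)
qed

text \<open>For types obtained without insertion. No points are reserved, the number of blocks is
  arbitrary up to parity, and any word having a 3-cycle as a power may take the place of the
  commutator.\<close>

definition direct_ok :: "nat \<Rightarrow> nat \<Rightarrow> nat \<Rightarrow> nat \<Rightarrow> (nat \<times> nat) list \<Rightarrow> nat \<Rightarrow> nat \<Rightarrow> nat \<Rightarrow> letter list \<Rightarrow>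
    (nat \<times> nat) list \<Rightarrow> nat list \<Rightarrow> (letter list \<times> nat \<times> nat) list \<Rightarrow> nat \<Rightarrow> nat \<Rightarrow> bool" where
  "direct_ok m n k N ts a b c w gs rs js z l \<longleftrightarrow>
     base_ok n k N ts \<and> ts \<noteq> [] \<and> (odd n \<or> even k) \<and> a < N \<and> b < N \<and> c < N \<and> a \<noteq> b \<and> b \<noteq> c \<and> a \<noteq> c \<and>
     wordmap n k ts w a = b \<and> wordmap n k ts w b = c \<and> wordmap n k ts w c = a \<and>
     power_ok (wordmap n k ts w) N [a, b, c] gs \<and> faces_ok (face n k ts) N m rs \<and>
     cycle_ok (wordmap n k ts (map mirror w)) l z \<and> (3 * prod_list (map snd gs)) mod l \<noteq> 0 \<and>
     (let L = joins (rot n k) (unrot n k) (swaps ts) (outside N []) js [a, b, c] in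
       joined (rot n k) (outside N []) L L \<and> joined (swaps ts) (outside N []) L L)"

text \<open>
  Here the chirality certificate is a word acting with order dividing \<open>3 * prod_list (map snd gs)\<close>
  whose mirror image has a cycle length \<open>l\<close> not dividing this number.
\<close>

lemma chiral_alternating_of_table:
  assumes D: "direct_ok m n k N ts a b c w gs rs js z l"
  shows "chiral_alternating m n"
proof -
  interpret table n k N ts using D by unfold_locales (simp add: direct_ok_def)
  note ok = D[unfolded direct_ok_def Let_def, folded word_perm_eq]
  let ?g = "word_perm s t w" and ?g' = "word_perm s t (map mirror w)" and ?P = "outside N []"
  define E where "E = prod_list (map snd gs)"
  have abc: "a < N" "b < N" "c < N" "a \<noteq> b" "b \<noteq> c" "a \<noteq> c" using ok by blast+
  have g_abc: "?g a = b" "?g b = c" "?g c = a" using ok by blast+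
  have face: "face n k ts = s \<circ> t" by (simp add: fun_eq_iff face_def)
  have bs: "bij s" using s_permutes by (rule permutes_bij)
  have "power_ok ?g N [a, b, c] gs" using ok by blast
  note E = power_of_power_ok[OF this, folded E_def]
  have letter_out: "letter_perm s t x y = y" if "y \<ge> N" for x y
    using that permutes_not_in[OF s_permutes, of y] permutes_not_in[OF permutes_inv[OF s_permutes], of y]
      permutes_not_in[OF t_permutes, of y] by (cases x) auto
  have "word_perm s t v y = y" if "y \<ge> N" for y v
    using letter_out[OF that] by (induction v) auto
  then have "(?g ^^ j) y = y" if "y \<ge> N" for y j using that by (induction j) auto
  then have out: "(?g ^^ E) y = y" if "y \<notin> {a, b, c}" for y using E(2)[of y] that by (cases "y < N") auto
  have c3: "?g ^^ E = c3 a b c \<or> ?g ^^ E = c3 a c b"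
    by (rule three_cycle_power[OF g_abc abc(4-6) E(1) out])
  have tg: "twin s t (?g ^^ j) (?g' ^^ j)" for j by (rule twin_power[OF twin_word_perm[OF bs]])
  have twin_c3: "\<exists>x'. twin s t (c3 a b c) x'"
    using c3
  proof
    assume "?g ^^ E = c3 a c b"
    moreover have "c3 a c b \<circ> c3 a c b = c3 a b c" using abc(4-6) by (auto simp: fun_eq_iff c3_apply)
    ultimately show ?thesis using twin_comp[OF tg[of E] tg[of E]] by metis
  qed (use tg[of E] in auto)
  then obtain x' where x': "twin s t (c3 a b c) x'" by blast
  have "?g ^^ (3 * E) = id"
  proof -
    have "?g ^^ (3 * E) = (?g ^^ E) \<circ> (?g ^^ E) \<circ> (?g ^^ E)"
    proof -
      have "3 * E = E + E + E" by simp
      then show ?thesis by (simp only: funpow_add)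
    qed
    then show ?thesis using c3 abc(4-6) by (auto simp: fun_eq_iff c3_apply)
  qed
  then have tid: "twin s t id (?g' ^^ (3 * E))" using tg[of "3 * E"] by simp
  have nid: "?g' ^^ (3 * E) \<noteq> id"
  proof
    assume id: "?g' ^^ (3 * E) = id"
    have cyc: "cycle_ok ?g' l z" and ndvd: "(3 * E) mod l \<noteq> 0" using ok unfolding E_def by blast+
    have l: "l > 0" "distinct (trace ?g' l z)" using cyc by (simp_all add: cycle_ok_def)
    have "(?g' ^^ l) z = z" using cycle_ok_imp(3)[OF cyc, of z] l(1) by (cases l) auto
    then have "(?g' ^^ ((3 * E) mod l)) z = (?g' ^^ (3 * E)) z" by (rule funpow_mod_eq)
    then have "trace ?g' l z ! ((3 * E) mod l) = trace ?g' l z ! 0"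
      using id l(1) by (simp add: trace_eq_map)
    then show False using l ndvd nth_eq_iff_index_eq[OF l(2), of "(3 * E) mod l" 0]
      by (simp add: trace_eq_map)
  qed
  have link: "linked s t a b c"
    unfolding linked_def
  proof (intro allI impI)
    fix R :: "nat \<Rightarrow> nat \<Rightarrow> bool"
    assume R: "\<forall>x y. R x y \<longrightarrow> R y x" "\<forall>x y z. R x y \<longrightarrow> R y z \<longrightarrow> R x z"
      "\<forall>x y. R (s x) (s y) = R x y" "\<forall>x y. R x y \<longrightarrow> R (t x) (t y)" "R a b" "R a c"
    have rel: "R x y" if "near s t {x. ?P x} a b c x y" for x y
      using that R by (intro near_imp_rel[of s t "{x. ?P x}" a b c x y R]) blast+
    let ?L = "joins s s' t ?P js [a, b, c]"
    have aa: "near s t {x. ?P x} a b c a a" by (meson near_ab near_sym near_trans)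
    then have L: "\<forall>x\<in>set ?L. near s t {x. ?P x} a b c a x"
      by (intro near_joins rot_unrot) (simp add: near_ab near_ac)
    have "joined s ?P ?L ?L" "joined t ?P ?L ?L" using ok by blast+
    then show "(\<exists>x. R a x \<and> R a (s x)) \<and> (\<exists>x. R a x \<and> R a (t x))"
      using L rel unfolding joined_iff by blast
  qed
  obtain j where "card {x \<in> {..<N}. t x \<noteq> x} = 2 * j" "evenperm t \<longleftrightarrow> even j"
    using evenperm_involution[OF finite_lessThan t_permutes tt] by blast
  then have et: "evenperm t" using moved_t by auto
  have "ts \<noteq> []" using ok by blast
  then have t_id: "t \<noteq> id" using swaps_moves[OF ts(1)] by (cases ts) fastforce+
  have nk: "0 < n" "0 < k" "n * k \<le> N" using base by (auto simp: base_ok_def)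
  have "regular_cycles {..<N} s n"
    unfolding regular_cycles_def
  proof (intro conjI ballI bexI)
    fix x assume "x \<in> {..<N}"
    show "s x = x \<or> card (orbit s x) = n"
    proof (cases "x < n * k")
      case True
      then obtain c i where "x = n * c + i" "c < k" "i < n" by (rule block_cases)
      then show ?thesis by (simp add: orbit_rot)
    qed (simp add: rot_def)
  next
    show "card (orbit s 0) = n" using orbit_rot[of 0 k 0 n] nk by simp
    show "0 \<in> {..<N}" using abc by simp
  qed
  note ord_s = regular_cycles_funpow_eq_id[OF this finite_lessThan s_permutes]
  have p\<rho>: "s \<circ> t permutes {..<N}" using t_permutes s_permutes by (rule permutes_compose)
  have "regular_cycles {..<N} (s \<circ> t) m"
    using ok permutes_imp_permutation[OF finite_lessThan p\<rho>] unfolding face[symmetric]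
    by (intro regular_cycles_of_faces_ok) blast+
  note ord_r = regular_cycles_funpow_eq_id[OF this finite_lessThan p\<rho>]
  have es: "evenperm s" using ok by (intro evenperm_rot) blast
  show ?thesis
    by (rule chiral_alternating_criterion[OF finite_lessThan s_permutes es t_permutes et tt t_id ord_s ord_r
          connected _ _ _ abc(4-6) x' link tid nid]) (simp_all add: abc)
qed

section \<open>Tables for ladders of triangles\<close>

lemma triangular_18: "triangular 18"
  by (rule triangular_of_table[where N = "36" and ts = "[(0, 35), (2, 34), (4, 33), (5, 30), (7, 29), (9, 28), (10, 23), (11, 21), (12, 13), (14, 20), (15, 16), (17, 19), (24, 27), (31, 32)]" and A = "5" and a = "9" and b = "25" and c = "28" and gs = "[(0, 8), (1, 2), (2, 5), (4, 5), (7, 4), (11, 8)]" and w = "[Fwd, Flip, Bwd]" and js = "[([Fwd, Fwd, Fwd], 25, 9), ([Flip], 9, 12)]" and rs = "[0, 1, 3, 5, 6, 8, 10, 11, 12, 15, 25]" and B = "30" and ?x1.0 = "6" and ?x2.0 = "7" and ?x3.0 = "8" and ?y0.0 = "29" and ?z1.0 = "31" and ?z2.0 = "32" and ?y1.0 = "33" and ?w1.0 = "4" and ?y2.0 = "34" and ?w2.0 = "2" and ?v1.0 = "3" and ?v2.0 = "1"]; code_simp)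

lemma triangular_19: "triangular 19"
  by (rule triangular_of_table[where N = "39" and ts = "[(0, 37), (2, 36), (4, 35), (5, 32), (7, 31), (9, 30), (10, 27), (11, 13), (12, 38), (14, 26), (15, 16), (17, 25), (18, 23), (19, 22), (28, 29), (33, 34)]" and A = "5" and a = "22" and b = "1" and c = "19" and gs = "[(0, 4), (2, 5), (4, 5), (7, 8), (9, 13)]" and w = "[Fwd, Fwd]" and js = "[([Bwd, Bwd, Bwd], 22, 1), ([Flip], 22, 17), ([Fwd, Fwd, Fwd], 22, 1), ([Flip], 22, 4), ([Bwd, Bwd, Bwd], 22, 17), ([Flip], 22, 14)]" and rs = "[0, 1, 3, 5, 6, 8, 10, 11, 12, 15, 18, 20]" and B = "32" and ?x1.0 = "6" and ?x2.0 = "7" and ?x3.0 = "8" and ?y0.0 = "31" and ?z1.0 = "33" and ?z2.0 = "34" and ?y1.0 = "35" and ?w1.0 = "4" and ?y2.0 = "36" and ?w2.0 = "2" and ?v1.0 = "3" and ?v2.0 = "1"]; code_simp)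

lemma triangular_20: "triangular 20"
  by (rule triangular_of_table[where N = "40" and ts = "[(0, 39), (2, 38), (4, 37), (5, 34), (7, 33), (9, 32), (10, 29), (11, 26), (12, 15), (16, 25), (17, 23), (19, 22), (20, 21), (27, 28), (30, 31), (35, 36)]" and A = "5" and a = "25" and b = "13" and c = "16" and gs = "[(0, 11), (1, 5), (2, 5), (4, 5), (7, 8), (18, 2)]" and w = "[Fwd, Fwd, Flip, Bwd, Bwd, Bwd, Bwd]" and js = "[([Fwd, Fwd, Fwd], 13, 25), ([Flip], 25, 28)]" and rs = "[0, 1, 3, 5, 6, 8, 10, 11, 12, 13, 17, 18]" and B = "34" and ?x1.0 = "6" and ?x2.0 = "7" and ?x3.0 = "8" and ?y0.0 = "33" and ?z1.0 = "35" and ?z2.0 = "36" and ?y1.0 = "37" and ?w1.0 = "4" and ?y2.0 = "38" and ?w2.0 = "2" and ?v1.0 = "3" and ?v2.0 = "1"]; code_simp)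

lemma triangular_21: "triangular 21"
  by (rule triangular_of_table[where N = "42" and ts = "[(0, 41), (2, 40), (4, 39), (5, 36), (7, 35), (9, 34), (10, 31), (11, 29), (13, 28), (14, 26), (15, 18), (19, 25), (20, 22), (23, 24), (32, 33), (37, 38)]" and A = "5" and a = "18" and b = "27" and c = "15" and gs = "[(0, 8), (1, 2), (2, 5), (4, 5), (7, 4), (9, 10), (12, 2), (13, 2)]" and w = "[Fwd, Fwd, Fwd, Fwd, Flip, Fwd, Fwd]" and js = "[([Bwd, Bwd, Bwd], 18, 27), ([Flip], 18, 24)]" and rs = "[0, 1, 3, 5, 6, 8, 10, 11, 12, 14, 15, 16, 20]" and B = "36" and ?x1.0 = "6" and ?x2.0 = "7" and ?x3.0 = "8" and ?y0.0 = "35" and ?z1.0 = "37" and ?z2.0 = "38" and ?y1.0 = "39" and ?w1.0 = "4" and ?y2.0 = "40" and ?w2.0 = "2" and ?v1.0 = "3" and ?v2.0 = "1"]; code_simp)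

lemma triangular_22: "triangular 22"
  by (rule triangular_of_table[where N = "44" and ts = "[(0, 43), (2, 42), (4, 41), (5, 38), (7, 37), (9, 36), (10, 33), (11, 30), (12, 13), (14, 29), (16, 28), (18, 27), (20, 26), (21, 24), (22, 23), (31, 32), (34, 35), (39, 40)]" and A = "5" and a = "16" and b = "19" and c = "28" and gs = "[(0, 4), (1, 7), (2, 5), (4, 5), (7, 11), (9, 7), (20, 2)]" and w = "[Fwd, Flip, Bwd, Bwd, Flip, Fwd, Fwd]" and js = "[([Fwd, Fwd, Fwd], 16, 19), ([Flip], 16, 0), ([Fwd, Flip, Bwd], 16, 19), ([Fwd, Fwd, Fwd], 16, 28), ([Flip], 16, 31)]" and rs = "[0, 1, 3, 5, 6, 8, 10, 11, 12, 15, 17, 19, 21]" and B = "38" and ?x1.0 = "6" and ?x2.0 = "7" and ?x3.0 = "8" and ?y0.0 = "37" and ?z1.0 = "39" and ?z2.0 = "40" and ?y1.0 = "41" and ?w1.0 = "4" and ?y2.0 = "42" and ?w2.0 = "2" and ?v1.0 = "3" and ?v2.0 = "1"]; code_simp)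

section \<open>Tables with a rung, some of them with marks\<close>

lemma runged_4_12: "runged 4 12"
  by (rule runged_of_table'[where N = "25" and ts = "[(0, 23), (1, 2), (3, 21), (4, 19), (6, 17), (8, 15), (10, 13), (20, 24)]" and A = "8" and a = "19" and b = "22" and c = "4" and gs = "[(0, 2), (1, 8), (6, 2), (7, 2), (8, 2), (9, 2), (10, 2), (11, 2)]" and w = "[Fwd, Flip, Fwd, Fwd, Flip, Bwd, Bwd]" and js = "[([Fwd, Fwd, Fwd], 19, 22), ([Flip], 19, 13), ([Fwd, Fwd, Fwd], 19, 4), ([Fwd, Fwd, Fwd], 19, 10), ([Flip], 19, 1)]" and rs = "[0, 1, 4, 5, 7, 9]"]; code_simp)

lemma runged_4_13: "runged 4 13"
  by (rule runged_of_table'[where N = "27" and ts = "[(0, 25), (2, 23), (3, 4), (5, 20), (7, 8), (9, 19), (10, 16), (11, 14), (15, 26), (21, 22)]" and A = "0" and a = "14" and b = "17" and c = "11" and gs = "[(0, 2), (1, 2), (2, 5), (3, 10), (7, 4)]" and w = "[Fwd, Flip, Bwd, Bwd, Flip, Fwd, Fwd]" and js = "[([Fwd, Fwd, Fwd], 14, 17), ([Flip], 14, 20), ([Fwd, Fwd, Fwd], 14, 20), ([Flip], 14, 23), ([Bwd, Flip, Fwd], 14, 20)]" and rs = "[0, 1, 3, 6, 10, 11]"]; code_simp)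

lemma runged_4_14: "runged 4 14"
  by (rule runged_of_table'[where N = "28" and ts = "[(0, 27), (1, 2), (3, 4), (5, 26), (7, 23), (8, 19), (10, 17), (12, 15), (21, 22), (24, 25)]" and A = "10" and a = "0" and b = "6" and c = "27" and gs = "[(1, 11), (7, 4), (9, 2), (10, 2), (11, 2), (12, 2), (13, 2)]" and w = "[Fwd, Fwd, Flip, Fwd, Flip, Bwd, Bwd]" and js = "[([Fwd, Flip, Bwd], 27, 0)]" and rs = "[0, 1, 6, 8, 9, 11]"]; code_simp)

lemma runged_4_15: "runged 4 15"
  by (rule runged_of_table'[where N = "32" and ts = "[(0, 29), (2, 27), (3, 25), (6, 24), (8, 22), (9, 20), (11, 18), (13, 16), (21, 31), (26, 30)]" and A = "0" and a = "20" and b = "23" and c = "9" and gs = "[(0, 2), (1, 2), (2, 5), (3, 4), (6, 2), (8, 5), (11, 2), (12, 2), (13, 2), (14, 2)]" and w = "[Fwd, Fwd, Fwd, Fwd, Flip, Bwd]" and js = "[([Fwd, Fwd, Fwd], 20, 23), ([Flip], 20, 26)]" and rs = "[0, 1, 3, 4, 7, 9, 10, 12]"]; code_simp)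

lemma runged_5_9: "runged 5 9"
  by (rule runged_of_table'[where N = "20" and ts = "[(0, 17), (2, 14), (4, 12), (6, 19), (7, 11), (13, 18)]" and A = "0" and a = "4" and b = "8" and c = "12" and gs = "[(0, 2), (1, 2), (2, 5), (3, 2), (6, 4)]" and w = "[Bwd, Bwd, Bwd]" and js = "[([Fwd, Flip, Bwd], 4, 12)]" and rs = "[0, 1, 3, 5]"]; code_simp)

lemma runged_5_10: "runged 5 10"
  by (rule runged_of_table'[where N = "21" and ts = "[(0, 19), (3, 17), (4, 5), (7, 15), (9, 12), (10, 20)]" and A = "7" and a = "19" and b = "13" and c = "0" and gs = "[(1, 4), (3, 2), (4, 4), (7, 2), (8, 2), (9, 2)]" and w = "[Bwd, Bwd, Flip, Fwd, Fwd, Fwd]" and js = "[([Fwd, Flip, Bwd], 13, 19)]" and rs = "[0, 1, 4, 8]"]; code_simp)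

lemma runged_5_11: "runged 5 11"
  by (rule runged_of_table'[where N = "22" and ts = "[(0, 21), (3, 19), (4, 5), (7, 17), (10, 15), (13, 14)]" and A = "7" and a = "21" and b = "16" and c = "0" and gs = "[(1, 2), (3, 2), (4, 4), (7, 2), (8, 2), (10, 4)]" and w = "[Bwd, Bwd, Flip, Fwd, Fwd, Fwd]" and js = "[([Bwd, Bwd, Flip, Fwd, Fwd], 0, 21), ([Flip], 21, 5)]" and rs = "[0, 1, 4, 8]"]; code_simp)

lemma runged_5_12: "runged 5 12"
  by (rule runged_of_table'[where N = "25" and ts = "[(0, 23), (1, 24), (2, 21), (3, 17), (6, 15), (9, 13)]" and A = "6" and a = "17" and b = "22" and c = "3" and gs = "[(0, 2), (1, 5), (4, 2), (6, 2), (7, 2), (9, 2), (10, 2)]" and w = "[Fwd, Fwd]" and js = "[([Fwd, Flip, Bwd], 17, 22), ([Bwd, Bwd, Bwd, Bwd], 3, 22)]" and rs = "[0, 1, 3, 4, 7]"]; code_simp)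

lemma runged_5_13: "runged 5 13"
  by (rule runged_of_table'[where N = "26" and ts = "[(0, 25), (3, 23), (5, 20), (7, 16), (9, 13), (17, 18)]" and A = "3" and a = "9" and b = "1" and c = "13" and gs = "[(0, 2), (3, 2), (4, 2), (5, 2), (6, 2), (7, 2), (8, 4), (10, 2)]" and w = "[Fwd]" and js = "[([Fwd, Fwd, Fwd, Fwd, Fwd], 9, 13), ([Flip], 9, 18)]" and rs = "[0, 1, 4, 6, 8]"]; code_simp)

lemma runged_6_10: "runged 6 10"
  by (rule runged_of_table'[where N = "24" and ts = "[(0, 19), (1, 16), (4, 13), (6, 10), (8, 23), (11, 22), (17, 20), (18, 21)]" and A = "4" and a = "8" and b = "9" and c = "23" and gs = "[(0, 7), (1, 4), (4, 2), (5, 2), (7, 4)]" and w = "[Fwd, Flip, Fwd, Flip, Fwd, Fwd, Fwd]" and js = "[]" and rs = "[0, 1, 2, 5]"]; code_simp)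

lemma runged_6_11: "runged 6 11"
  by (rule runged_of_table'[where N = "24" and ts = "[(0, 21), (1, 22), (3, 19), (6, 16), (7, 12), (15, 23)]" and A = "3" and a = "12" and b = "17" and c = "7" and gs = "[(0, 2), (1, 4), (3, 2), (4, 2), (6, 4), (8, 2)]" and w = "[Fwd]" and js = "[([Fwd, Fwd, Fwd, Fwd, Fwd], 12, 7), ([Flip], 12, 1)]" and rs = "[0, 1, 4, 7]"]; code_simp)

lemma runged_6_12: "runged 6 12"
  by (rule runged_of_table'[where N = "25" and ts = "[(0, 23), (2, 24), (3, 21), (7, 19), (9, 14), (16, 17)]" and A = "0" and a = "16" and b = "18" and c = "17" and gs = "[(0, 2), (1, 2), (2, 4), (4, 2), (7, 2), (8, 2), (9, 2), (10, 2)]" and w = "[Fwd, Fwd, Fwd, Flip, Bwd, Bwd]" and js = "[]" and rs = "[0, 1, 4, 8]"]; code_simp)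

lemma runged_6_13: "runged 6 13"
  by (rule runged_of_table'[where N = "26" and ts = "[(0, 25), (3, 21), (5, 6), (8, 19), (10, 15), (23, 24)]" and A = "10" and a = "5" and b = "7" and c = "6" and gs = "[(0, 4), (1, 2), (3, 2), (4, 2), (8, 2), (9, 2), (10, 2), (11, 2)]" and w = "[Fwd, Flip, Bwd, Bwd, Bwd]" and js = "[]" and rs = "[0, 1, 4, 9]"]; code_simp)

lemma runged_6_14: "runged 6 14"
  by (rule runged_of_table'[where N = "28" and ts = "[(0, 27), (2, 22), (5, 19), (7, 8), (9, 16), (10, 11), (14, 15), (24, 25)]" and A = "5" and a = "24" and b = "26" and c = "25" and gs = "[(0, 2), (1, 7), (2, 2), (3, 2), (5, 2), (6, 2), (10, 4)]" and w = "[Fwd, Fwd, Flip, Bwd, Bwd, Flip, Fwd]" and js = "[]" and rs = "[0, 1, 3, 6]"]; code_simp)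

lemma runged_6_15: "runged 6 15"
  by (rule runged_of_table'[where N = "36" and ts = "[(0, 29), (1, 30), (2, 27), (3, 32), (4, 25), (5, 21), (8, 18), (11, 15), (14, 35), (23, 34), (26, 33), (28, 31)]" and A = "8" and a = "23" and b = "24" and c = "34" and gs = "[(0, 10), (1, 10), (6, 2), (8, 2), (9, 2), (12, 2)]" and w = "[Fwd, Fwd, Flip, Fwd, Flip, Bwd, Bwd]" and js = "[]" and rs = "[0, 1, 3, 5, 6, 9]"]; code_simp)

lemma marked_7_8: "marked 7 8 1"
  by (rule marked_of_table[where N = "16" and ts = "[(0, 15), (2, 3), (6, 13), (8, 9)]" and A = "6" and a = "2" and b = "4" and c = "3" and gs = "[(0, 2), (1, 4), (6, 2), (7, 2)]" and w = "[Bwd, Bwd, Flip, Fwd, Flip, Fwd]" and js = "[]" and rs = "[0, 1]" and ys = "[7, 14]"]; code_simp)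

lemma runged_7_9: "runged 7 9"
  by (rule runged_of_table'[where N = "21" and ts = "[(0, 17), (1, 13), (6, 11), (8, 20), (15, 18), (16, 19)]" and A = "6" and a = "13" and b = "9" and c = "1" and gs = "[(0, 8), (2, 2), (6, 2), (7, 2)]" and w = "[Fwd]" and js = "[([Fwd, Fwd, Fwd, Fwd, Fwd], 13, 1), ([Fwd, Fwd, Flip, Bwd, Bwd], 1, 13)]" and rs = "[0, 1, 2]"]; code_simp)

lemma runged_7_10: "runged 7 10"
  by (rule runged_of_table'[where N = "22" and ts = "[(0, 19), (3, 4), (5, 16), (6, 12), (14, 20), (15, 21)]" and A = "0" and a = "12" and b = "17" and c = "6" and gs = "[(0, 2), (1, 2), (3, 8), (7, 2)]" and w = "[Fwd]" and js = "[([Bwd, Bwd, Flip, Fwd, Fwd], 12, 17)]" and rs = "[0, 1, 6]"]; code_simp)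

lemma runged_7_11: "runged 7 11"
  by (rule runged_of_table'[where N = "23" and ts = "[(0, 21), (2, 16), (5, 12), (7, 8), (13, 22), (14, 15)]" and A = "0" and a = "7" and b = "9" and c = "8" and gs = "[(0, 2), (1, 2), (2, 7), (3, 2), (5, 2)]" and w = "[Fwd, Flip, Bwd, Flip, Bwd, Bwd, Bwd]" and js = "[]" and rs = "[0, 1, 3]"]; code_simp)

lemma marked_7_12: "marked 7 12 2"
  by (rule marked_of_table[where N = "28" and ts = "[(0, 23), (2, 19), (4, 25), (6, 17), (7, 26), (9, 15), (16, 27), (20, 24)]" and A = "0" and a = "4" and b = "5" and c = "25" and gs = "[(0, 2), (1, 2), (2, 2), (3, 4), (6, 5), (7, 4), (9, 2)]" and w = "[Fwd, Flip, Bwd, Bwd, Flip, Fwd, Fwd]" and js = "[]" and rs = "[0, 1, 3, 7]" and ys = "[12, 1, 18, 8]"]; code_simp)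

lemma marked_7_13: "marked 7 13 2"
  by (rule marked_of_table[where N = "28" and ts = "[(0, 25), (4, 22), (8, 26), (9, 21), (11, 16), (15, 27)]" and A = "0" and a = "4" and b = "10" and c = "22" and gs = "[(0, 2), (1, 2), (5, 2), (8, 4), (11, 4), (12, 2)]" and w = "[Fwd, Flip, Fwd]" and js = "[([Fwd, Flip, Bwd], 4, 10), ([Flip], 4, 15)]" and rs = "[0, 1, 5, 10]" and ys = "[13, 1, 7, 18]"]; code_simp)

lemma runged_7_14: "runged 7 14"
  by (rule runged_of_table'[where N = "29" and ts = "[(0, 27), (3, 22), (6, 28), (7, 20), (10, 16), (24, 25)]" and A = "10" and a = "24" and b = "26" and c = "25" and gs = "[(0, 2), (1, 2), (3, 2), (4, 2), (6, 4), (8, 2), (10, 2), (11, 2)]" and w = "[Fwd, Flip, Bwd, Bwd, Bwd]" and js = "[]" and rs = "[0, 1, 4, 8]"]; code_simp)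

lemma marked_8_8: "marked 8 8 1"
  by (rule marked_of_table[where N = "17" and ts = "[(0, 15), (3, 9), (4, 16), (11, 12)]" and A = "0" and a = "11" and b = "13" and c = "12" and gs = "[(0, 2), (1, 2), (3, 2), (4, 4)]" and w = "[Fwd, Flip, Bwd, Bwd, Flip, Fwd, Fwd]" and js = "[]" and rs = "[0, 1]" and ys = "[8, 1]"]; code_simp)

lemma marked_8_10: "marked 8 10 1"
  by (rule marked_of_table[where N = "20" and ts = "[(0, 19), (4, 5), (7, 17), (11, 12), (13, 14), (15, 16)]" and A = "0" and a = "4" and b = "6" and c = "5" and gs = "[(0, 2), (1, 2), (7, 8), (8, 2)]" and w = "[Bwd, Bwd, Bwd]" and js = "[]" and rs = "[0, 1]" and ys = "[8, 18]"]; code_simp)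

lemma runged_8_12: "runged 8 12"
  by (rule runged_of_table'[where N = "32" and ts = "[(0, 23), (1, 24), (2, 20), (3, 27), (5, 28), (6, 18), (8, 13), (10, 30), (11, 31), (16, 29), (21, 25), (22, 26)]" and A = "8" and a = "16" and b = "17" and c = "29" and gs = "[(0, 13), (1, 5), (5, 4), (7, 2), (8, 2), (9, 2)]" and w = "[Fwd, Flip, Bwd, Bwd]" and js = "[]" and rs = "[0, 1, 3, 7]"]; code_simp)

lemma marked_8_13: "marked 8 13 2"
  by (rule marked_of_table[where N = "32" and ts = "[(0, 25), (2, 26), (3, 22), (6, 28), (8, 20), (9, 15), (14, 31), (16, 29), (19, 30), (23, 27)]" and A = "0" and a = "6" and b = "7" and c = "28" and gs = "[(0, 2), (1, 2), (2, 4), (4, 4), (8, 4), (9, 5), (10, 4)]" and w = "[Fwd, Flip, Bwd, Bwd]" and js = "[]" and rs = "[0, 1, 4, 9]" and ys = "[10, 1, 21, 17]"]; code_simp)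

lemma runged_8_19: "runged 8 19"
  by (rule runged_of_table'[where N = "39" and ts = "[(0, 37), (1, 2), (3, 38), (5, 34), (9, 30), (11, 12), (13, 14), (15, 16), (17, 26), (19, 20), (22, 23), (27, 28)]" and A = "5" and a = "22" and b = "24" and c = "23" and gs = "[(0, 2), (1, 8), (5, 2), (6, 2), (9, 2), (10, 2), (11, 8), (18, 4)]" and w = "[Fwd, Flip, Fwd, Fwd, Flip, Fwd]" and js = "[]" and rs = "[0, 1, 6, 10]"]; code_simp)

lemma runged_9_12: "runged 9 12"
  by (rule runged_of_table'[where N = "27" and ts = "[(0, 23), (4, 18), (5, 24), (7, 14), (9, 26), (15, 25)]" and A = "0" and a = "9" and b = "10" and c = "26" and gs = "[(0, 2), (1, 2), (4, 2), (5, 4), (7, 2), (8, 4)]" and w = "[Bwd, Bwd, Flip, Fwd, Fwd]" and js = "[]" and rs = "[0, 1, 5]"]; code_simp)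

lemma runged_9_13: "runged 9 13"
  by (rule runged_of_table'[where N = "27" and ts = "[(0, 25), (2, 19), (8, 16), (23, 26)]" and A = "2" and a = "23" and b = "24" and c = "26" and gs = "[(0, 2), (1, 2), (2, 2), (3, 2), (8, 2), (9, 2)]" and w = "[Fwd, Flip, Bwd, Bwd]" and js = "[]" and rs = "[0, 1, 3]"]; code_simp)

lemma marked_9_14: "marked 9 14 2"
  by (rule marked_of_table[where N = "36" and ts = "[(0, 27), (2, 28), (3, 23), (5, 19), (6, 33), (9, 16), (12, 35), (18, 34), (20, 30), (21, 31), (22, 32), (26, 29)]" and A = "9" and a = "12" and b = "13" and c = "35" and gs = "[(0, 4), (1, 2), (2, 13), (4, 2), (5, 4), (9, 2), (10, 2)]" and w = "[Fwd, Flip, Bwd, Bwd]" and js = "[]" and rs = "[0, 1, 4, 6]" and ys = "[14, 1, 4, 17]"]; code_simp)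

lemma runged_10_14: "runged 10 14"
  by (rule runged_of_table'[where N = "40" and ts = "[(0, 27), (2, 28), (6, 24), (8, 29), (9, 20), (10, 32), (11, 16), (12, 36), (13, 37), (14, 38), (15, 39), (17, 33), (18, 34), (19, 35), (21, 30), (22, 31)]" and A = "6" and a = "2" and b = "3" and c = "28" and gs = "[(0, 16), (1, 14), (6, 2), (7, 2)]" and w = "[Fwd, Flip, Fwd]" and js = "[]" and rs = "[0, 1, 7, 10]"]; code_simp)

lemma marked_10_15: "marked 10 15 2"
  by (rule marked_of_table[where N = "40" and ts = "[(0, 29), (1, 30), (2, 24), (3, 33), (4, 34), (7, 22), (10, 16), (12, 37), (13, 38), (14, 39), (20, 36), (23, 35), (25, 31), (26, 32)]" and A = "10" and a = "20" and b = "21" and c = "36" and gs = "[(0, 8), (1, 8), (3, 10), (7, 2), (10, 2), (11, 2)]" and w = "[Bwd, Bwd, Flip, Bwd]" and js = "[]" and rs = "[0, 1, 3, 8]" and ys = "[15, 27, 5, 8]"]; code_simp)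

lemma marked_11_16: "marked 11 16 2"
  by (rule marked_of_table[where N = "44" and ts = "[(0, 31), (3, 32), (4, 33), (5, 28), (7, 35), (8, 24), (9, 39), (10, 40), (11, 41), (12, 42), (13, 22), (20, 43), (25, 36), (26, 37), (27, 38), (29, 34)]" and A = "0" and a = "20" and b = "21" and c = "43" and gs = "[(0, 2), (1, 2), (3, 22), (6, 4), (7, 4), (14, 2)]" and w = "[Bwd, Bwd, Flip, Bwd]" and js = "[]" and rs = "[0, 1, 6, 9]" and ys = "[16, 1, 6, 23]"]; code_simp)

section \<open>Tables for single types\<close>

lemma chiral_alternating_3_7: "chiral_alternating 3 7"
  by (rule chiral_alternating_of_table[where k = "2" and N = "15" and ts = "[(0, 14), (1, 6), (2, 13), (4, 12), (5, 7), (8, 11)]" and a = "7" and b = "3" and c = "4" and w = "[Fwd, Fwd, Fwd, Fwd, Flip, Fwd, Fwd, Flip, Fwd, Fwd, Flip, Bwd, Flip]" and gs = "[(1, 8), (9, 2)]" and rs = "[0, 2, 3, 5, 9]" and js = "[]" and z = "1" and l = "10"], code_simp)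

lemma chiral_alternating_3_8: "chiral_alternating 3 8"
  by (rule chiral_alternating_of_table[where k = "2" and N = "16" and ts = "[(0, 15), (1, 4), (5, 14), (6, 12), (7, 10), (8, 9)]" and a = "14" and b = "13" and c = "6" and w = "[Flip, Fwd, Fwd, Fwd, Fwd, Flip, Fwd, Fwd, Flip, Bwd, Bwd, Flip, Fwd, Flip, Bwd, Bwd]" and gs = "[(0, 13)]" and rs = "[0, 1, 2, 6, 7]" and js = "[]" and z = "0" and l = "7"], code_simp)

lemma chiral_alternating_3_9: "chiral_alternating 3 9"
  by (rule chiral_alternating_of_table[where k = "2" and N = "21" and ts = "[(0, 18), (1, 8), (2, 17), (3, 10), (4, 6), (5, 20), (7, 9), (11, 16), (12, 14), (13, 19)]" and a = "18" and b = "15" and c = "11" and w = "[Bwd, Bwd, Bwd, Flip, Fwd, Fwd, Flip, Fwd, Fwd, Fwd, Fwd, Flip, Fwd, Flip]" and gs = "[(0, 14), (1, 4)]" and rs = "[0, 2, 3, 4, 5, 12, 13]" and js = "[]" and z = "0" and l = "13"], code_simp)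

lemma chiral_alternating_3_10: "chiral_alternating 3 10"
  by (rule chiral_alternating_of_table[where k = "4" and N = "41" and ts = "[(0, 19), (1, 29), (2, 31), (4, 30), (5, 11), (7, 10), (8, 9), (12, 39), (13, 14), (15, 38), (16, 36), (17, 24), (18, 20), (21, 23), (22, 40), (25, 35), (27, 34), (28, 32)]" and a = "33" and b = "26" and c = "17" and w = "[Fwd, Fwd, Flip, Bwd, Bwd, Bwd, Bwd, Flip, Bwd, Bwd, Flip, Fwd, Fwd, Fwd]" and gs = "[(0, 37)]" and rs = "[0, 1, 2, 3, 5, 6, 13, 16, 17, 18, 22, 26, 28]" and js = "[([Flip], 33, 17), ([Bwd, Bwd], 26, 33), ([Flip], 33, 31), ([Bwd, Bwd], 33, 17), ([Flip], 33, 15), ([Bwd, Bwd], 33, 24), ([Flip], 33, 22)]" and z = "0" and l = "23"], code_simp)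

lemma chiral_alternating_3_11: "chiral_alternating 3 11"
  by (rule chiral_alternating_of_table[where k = "1" and N = "11" and ts = "[(1, 8), (2, 3), (4, 7), (9, 10)]" and a = "1" and b = "10" and c = "5" and w = "[Flip, Fwd, Fwd, Flip, Bwd, Bwd, Bwd, Flip, Fwd, Fwd, Fwd, Fwd]" and gs = "[(0, 7)]" and rs = "[0, 2, 5]" and js = "[([Flip], 5, 1), ([Flip], 1, 10)]" and z = "0" and l = "2"], code_simp)

lemma chiral_alternating_3_12: "chiral_alternating 3 12"
  by (rule chiral_alternating_of_table[where k = "2" and N = "24" and ts = "[(0, 7), (1, 4), (5, 6), (8, 23), (10, 22), (11, 12), (13, 21), (14, 18), (15, 16), (19, 20)]" and a = "0" and b = "7" and c = "17" and w = "[Flip, Bwd, Bwd, Bwd, Bwd, Flip, Bwd, Bwd, Bwd, Flip, Bwd, Bwd, Flip, Fwd, Fwd, Fwd, Flip, Bwd, Bwd]" and gs = "[(1, 11), (3, 5), (9, 5)]" and rs = "[0, 1, 2, 9, 11, 14, 15]" and js = "[([Bwd, Bwd, Flip, Fwd], 7, 0), ([Flip], 0, 23)]" and z = "0" and l = "17"], code_simp)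

lemma chiral_alternating_3_13: "chiral_alternating 3 13"
  by (rule chiral_alternating_of_table[where k = "2" and N = "28" and ts = "[(0, 11), (1, 25), (2, 21), (3, 19), (4, 17), (5, 15), (6, 7), (8, 14), (10, 13), (12, 26), (22, 24), (23, 27)]" and a = "2" and b = "9" and c = "20" and w = "[Flip, Bwd, Bwd, Bwd, Flip, Bwd, Bwd, Bwd, Flip, Fwd, Flip, Fwd, Fwd, Fwd, Fwd, Flip, Bwd, Bwd, Bwd, Bwd, Flip]" and gs = "[(0, 7), (1, 17)]" and rs = "[0, 1, 2, 3, 4, 5, 6, 9, 23]" and js = "[([Flip], 9, 2)]" and z = "0" and l = "27"], code_simp)

lemma chiral_alternating_3_14: "chiral_alternating 3 14"
  by (rule chiral_alternating_of_table[where k = "2" and N = "28" and ts = "[(1, 12), (2, 27), (3, 9), (4, 18), (5, 23), (7, 22), (8, 19), (10, 26), (11, 14), (15, 25), (17, 24), (20, 21)]" and a = "0" and b = "26" and c = "8" and w = "[Flip, Bwd, Bwd, Flip, Fwd, Fwd, Fwd, Fwd, Flip, Fwd, Fwd, Fwd]" and gs = "[(1, 23)]" and rs = "[0, 2, 3, 4, 5, 6, 8, 11, 16]" and js = "[([Flip], 0, 26), ([Flip], 0, 8), ([Fwd, Fwd], 8, 0), ([Flip], 0, 2)]" and z = "0" and l = "5"], code_simp)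

lemma chiral_alternating_3_15: "chiral_alternating 3 15"
  by (rule chiral_alternating_of_table[where k = "1" and N = "16" and ts = "[(0, 7), (1, 11), (2, 13), (3, 5), (4, 15), (6, 12), (8, 9), (10, 14)]" and a = "0" and b = "9" and c = "8" and w = "[Flip, Bwd, Bwd, Bwd, Bwd, Flip, Bwd, Bwd, Flip, Fwd, Fwd, Fwd, Fwd]" and gs = "[(1, 4), (3, 8)]" and rs = "[0, 1, 2, 3, 4]" and js = "[]" and z = "0" and l = "7"], code_simp)

lemma chiral_alternating_3_16: "chiral_alternating 3 16"
  by (rule chiral_alternating_of_table[where k = "2" and N = "32" and ts = "[(0, 31), (1, 2), (3, 30), (4, 20), (5, 12), (6, 9), (10, 11), (13, 19), (14, 16), (17, 18), (21, 29), (22, 23), (24, 28), (26, 27)]" and a = "17" and b = "20" and c = "8" and w = "[Bwd, Bwd, Bwd, Bwd, Flip, Bwd, Bwd, Flip, Fwd, Flip, Bwd, Bwd, Bwd, Bwd, Flip, Bwd, Bwd, Bwd, Bwd]" and gs = "[(0, 20), (3, 8)]" and rs = "[0, 1, 4, 5, 6, 7, 14, 22, 25]" and js = "[([Flip], 8, 17)]" and z = "0" and l = "29"], code_simp)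

lemma chiral_alternating_3_17: "chiral_alternating 3 17"
  by (rule chiral_alternating_of_table[where k = "1" and N = "18" and ts = "[(0, 12), (1, 2), (3, 11), (4, 9), (6, 8), (7, 17), (13, 14), (15, 16)]" and a = "5" and b = "17" and c = "8" and w = "[Flip, Bwd, Flip, Bwd, Bwd, Flip, Bwd, Bwd, Bwd, Bwd, Flip, Bwd, Bwd, Bwd, Flip, Bwd, Bwd, Flip]" and gs = "[(1, 13)]" and rs = "[0, 1, 4, 5, 7]" and js = "[]" and z = "0" and l = "6"], code_simp)

lemma chiral_alternating_4_5: "chiral_alternating 4 5"
  by (rule chiral_alternating_of_table[where k = "5" and N = "25" and ts = "[(2, 9), (4, 5), (6, 8), (7, 14), (10, 13), (11, 19), (12, 16), (17, 24), (18, 20), (22, 23)]" and a = "13" and b = "23" and c = "15" and w = "[Flip, Bwd, Bwd, Flip, Bwd, Bwd, Bwd, Flip, Bwd, Bwd, Bwd, Bwd, Flip, Fwd, Fwd, Fwd, Fwd, Flip, Fwd]" and gs = "[(0, 16), (8, 2)]" and rs = "[0, 3, 7, 11, 12, 18]" and js = "[([Flip], 15, 13), ([Flip], 13, 23)]" and z = "2" and l = "5"], code_simp)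

lemma chiral_alternating_4_6: "chiral_alternating 4 6"
  by (rule chiral_alternating_of_table[where k = "4" and N = "25" and ts = "[(0, 11), (1, 9), (2, 17), (4, 12), (5, 8), (10, 24), (13, 16), (14, 23), (15, 20), (18, 19)]" and a = "16" and b = "18" and c = "19" and w = "[Flip, Fwd, Flip, Bwd, Flip, Fwd, Fwd]" and gs = "[(0, 8), (1, 14)]" and rs = "[0, 1, 2, 3, 14, 15]" and js = "[]" and z = "0" and l = "18"], code_simp)

lemma chiral_alternating_4_7: "chiral_alternating 4 7"
  by (rule chiral_alternating_of_table[where k = "1" and N = "9" and ts = "[(0, 4), (1, 2), (3, 8), (6, 7)]" and a = "7" and b = "5" and c = "2" and w = "[Flip, Bwd, Flip, Fwd, Fwd, Flip, Fwd]" and gs = "[(0, 2), (3, 2)]" and rs = "[0, 1]" and js = "[]" and z = "0" and l = "7"], code_simp)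

lemma chiral_alternating_4_8: "chiral_alternating 4 8"
  by (rule chiral_alternating_of_table[where k = "2" and N = "16" and ts = "[(2, 15), (3, 6), (4, 11), (5, 13), (7, 8), (9, 14)]" and a = "8" and b = "9" and c = "14" and w = "[Flip, Fwd, Fwd, Flip, Bwd, Bwd, Flip, Fwd]" and gs = "[(0, 8), (2, 4)]" and rs = "[0, 3, 4, 5]" and js = "[]" and z = "0" and l = "13"], code_simp)

lemma chiral_alternating_4_9: "chiral_alternating 4 9"
  by (rule chiral_alternating_of_table[where k = "1" and N = "9" and ts = "[(0, 6), (1, 7), (3, 8), (4, 5)]" and a = "0" and b = "7" and c = "1" and w = "[Flip, Bwd, Flip, Fwd, Fwd, Flip, Bwd, Bwd]" and gs = "[(2, 5)]" and rs = "[0, 1]" and js = "[]" and z = "0" and l = "7"], code_simp)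

lemma chiral_alternating_4_10: "chiral_alternating 4 10"
  by (rule chiral_alternating_of_table[where k = "2" and N = "20" and ts = "[(0, 10), (1, 15), (3, 12), (6, 11), (7, 8), (13, 14), (16, 17), (18, 19)]" and a = "18" and b = "19" and c = "2" and w = "[Bwd, Bwd, Flip, Bwd, Flip, Fwd, Flip]" and gs = "[(0, 11), (1, 5)]" and rs = "[0, 1, 2, 4]" and js = "[]" and z = "0" and l = "6"], code_simp)

lemma chiral_alternating_4_11: "chiral_alternating 4 11"
  by (rule chiral_alternating_of_table[where k = "1" and N = "11" and ts = "[(0, 5), (1, 2), (7, 8), (9, 10)]" and a = "9" and b = "4" and c = "3" and w = "[Flip, Fwd, Fwd, Flip, Bwd, Bwd, Flip, Bwd]" and gs = "[(0, 7)]" and rs = "[0, 1]" and js = "[]" and z = "2" and l = "4"], code_simp)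

lemma chiral_alternating_5_5: "chiral_alternating 5 5"
  by (rule chiral_alternating_of_table[where k = "3" and N = "15" and ts = "[(0, 9), (1, 14), (3, 7), (4, 10), (5, 8), (6, 13)]" and a = "9" and b = "2" and c = "1" and w = "[Fwd, Flip, Bwd, Bwd, Flip, Fwd, Flip, Fwd]" and gs = "[(0, 5), (3, 7)]" and rs = "[0, 2, 4]" and js = "[]" and z = "1" and l = "6"], code_simp)

lemma chiral_alternating_5_6: "chiral_alternating 5 6"
  by (rule chiral_alternating_of_table[where k = "2" and N = "13" and ts = "[(0, 6), (1, 2), (3, 8), (4, 5), (7, 12), (9, 10)]" and a = "0" and b = "12" and c = "11" and w = "[Bwd, Flip, Fwd, Fwd, Flip, Fwd, Flip]" and gs = "[(1, 8), (4, 2)]" and rs = "[0, 1]" and js = "[]" and z = "0" and l = "10"], code_simp)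

lemma chiral_alternating_5_7: "chiral_alternating 5 7"
  by (rule chiral_alternating_of_table[where k = "1" and N = "10" and ts = "[(0, 8), (1, 5), (2, 9), (6, 7)]" and a = "7" and b = "6" and c = "1" and w = "[Bwd, Flip, Fwd, Flip, Bwd, Flip, Bwd]" and gs = "[(2, 5)]" and rs = "[0, 2]" and js = "[]" and z = "1" and l = "2"], code_simp)

lemma chiral_alternating_5_8: "chiral_alternating 5 8"
  by (rule chiral_alternating_of_table[where k = "2" and N = "16" and ts = "[(0, 8), (1, 12), (3, 4), (5, 10)]" and a = "2" and b = "11" and c = "3" and w = "[Bwd, Flip, Fwd, Flip, Bwd, Bwd, Flip]" and gs = "[(0, 13)]" and rs = "[0, 1, 2]" and js = "[]" and z = "0" and l = "9"], code_simp)

lemma chiral_alternating_6_6: "chiral_alternating 6 6"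
  by (rule chiral_alternating_of_table[where k = "2" and N = "12" and ts = "[(0, 11), (4, 6), (5, 8), (7, 10)]" and a = "9" and b = "11" and c = "10" and w = "[Flip, Fwd, Fwd, Flip, Bwd, Bwd, Flip, Bwd]" and gs = "[(0, 7)]" and rs = "[0, 1]" and js = "[]" and z = "0" and l = "9"], code_simp)

lemma chiral_alternating_6_7: "chiral_alternating 6 7"
  by (rule chiral_alternating_of_table[where k = "2" and N = "14" and ts = "[(0, 7), (2, 9), (5, 6), (11, 12)]" and a = "4" and b = "5" and c = "8" and w = "[Bwd, Flip, Fwd, Fwd, Fwd, Flip, Fwd, Flip]" and gs = "[(0, 11)]" and rs = "[0, 1]" and js = "[]" and z = "0" and l = "10"], code_simp)

lemma chiral_alternating_6_8: "chiral_alternating 6 8"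
  by (rule chiral_alternating_of_table[where k = "2" and N = "16" and ts = "[(0, 8), (1, 2), (3, 10), (6, 7), (11, 12), (14, 15)]" and a = "0" and b = "1" and c = "5" and w = "[Flip, Bwd, Flip, Fwd, Fwd, Flip, Fwd]" and gs = "[(2, 11)]" and rs = "[0, 1]" and js = "[]" and z = "0" and l = "6"], code_simp)

lemma chiral_alternating_6_9: "chiral_alternating 6 9"
  by (rule chiral_alternating_of_table[where k = "1" and N = "12" and ts = "[(1, 9), (2, 6), (4, 10), (5, 11)]" and a = "0" and b = "5" and c = "1" and w = "[Bwd, Flip, Fwd, Flip, Fwd, Fwd, Flip, Bwd]" and gs = "[(3, 7)]" and rs = "[0, 3]" and js = "[]" and z = "1" and l = "2"], code_simp)

lemma chiral_alternating_7_7: "chiral_alternating 7 7"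
  by (rule chiral_alternating_of_table[where k = "1" and N = "9" and ts = "[(0, 1), (3, 8), (4, 5), (6, 7)]" and a = "0" and b = "1" and c = "2" and w = "[Fwd, Flip, Bwd, Flip, Fwd, Flip, Fwd, Fwd]" and gs = "[(3, 5)]" and rs = "[0]" and js = "[]" and z = "0" and l = "9"], code_simp)

lemma chiral_alternating_8_11: "chiral_alternating 8 11"
  by (rule chiral_alternating_of_table[where k = "1" and N = "16" and ts = "[(0, 9), (1, 13), (2, 6), (3, 10), (4, 11), (5, 12), (7, 14), (8, 15)]" and a = "10" and b = "3" and c = "13" and w = "[Flip, Fwd, Flip, Fwd, Fwd, Fwd, Flip, Bwd]" and gs = "[(0, 11)]" and rs = "[0, 1]" and js = "[]" and z = "2" and l = "2"], code_simp)

section \<open>Covering all hyperbolic types\<close>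

text \<open>Each ladder adds \<open>m\<close> to \<open>n\<close>, so \<open>m\<close> consecutive
  values of \<open>n\<close> reach all larger ones.\<close>

lemma runged_window:
  assumes m: "m \<ge> 4" and window: "\<And>n. a \<le> n \<Longrightarrow> n < a + m \<Longrightarrow> runged m n" and n: "a \<le> n"
  shows "runged m n"
  using n
proof (induction n rule: less_induct)
  case (less n)
  show ?case
  proof (cases "n < a + m")
    case True
    then show ?thesis using window less.prems by blast
  next
    case False
    then have "runged m (n - m)" using m by (intro less.IH) auto
    from runged_add_cell[OF this m] show ?thesis using False by simp
  qed
qed

text \<open>A ladder of triangles adds 5, so five consecutive tables are enough.\<close>

lemma triangular_ge_18:
  assumes "n \<ge> 18" shows "triangular n"
  using assms
proof (induction n rule: less_induct)
  case (less n)
  show ?case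
  proof (cases "n < 23")
    case True
    then have "n = 18 \<or> n = 19 \<or> n = 20 \<or> n = 21 \<or> n = 22" using less.prems by linarith
    then show ?thesis
      using triangular_18 triangular_19 triangular_20 triangular_21 triangular_22 by auto
  next
    case False
    then have "triangular (n - 5)" by (intro less.IH) auto
    from triangular_add_5[OF this] show ?thesis using False by simp
  qed
qed

text \<open>Without loops and with one mark per vertex, fixed points lengthen faces and vertices
  equally; the seed is the marked diagram of type 8, 8.\<close>

lemma runged_diagonal: "m \<ge> 9 \<Longrightarrow> runged m m"
  using marked_insert_chunks[OF marked_8_8, of "m - 8" 0] by simp

text \<open>With one mark per vertex, \<open>n - m\<close> grows by the number \<open>l\<close> of
  loops, from 1 in the seed 7, 8 and from 2 in the seed 8, 10. The number \<open>2 * l + 1\<close>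
  is divisible by 3 exactly when \<open>l mod 3 = 1\<close>. With \<open>l = p - 1\<close> the first
  seed therefore fails only for \<open>p mod 3 = 2\<close>, and there \<open>l = p - 2\<close> is
  divisible by 3, as the second seed requires. The bound \<open>m \<ge> p + 7\<close> leaves at
  least one fixed point to insert.\<close>

lemma runged_near_diagonal:
  assumes "p \<ge> 1" "m \<ge> p + 7" shows "runged m (m + p)"
proof (cases "p mod 3 = 2")
  case True
  then obtain j where j: "p = 3 * j + 2" by (metis mult_div_mod_eq)
  have "\<not> 3 dvd 2 * (p - 2) + 1"
  proof -
    have "2 * (p - 2) + 1 = 3 * (2 * j) + 1" using j by simp
    then show ?thesis by presburger
  qed
  moreover have "8 + (p - 2) + (m - p - 6) = m" "10 + (2 * (p - 2) + (m - p - 6)) = m + p"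
    using assms j by simp_all
  ultimately show ?thesis
    using marked_insert_chunks[OF marked_8_10, of "m - p - 6" "p - 2"] assms by simp
next
  case False
  then have "\<not> 3 dvd 2 * (p - 1) + 1" using assms(1) by presburger
  moreover have "7 + (p - 1) + (m - p - 6) = m" "8 + (2 * (p - 1) + (m - p - 6)) = m + p"
    using assms by simp_all
  ultimately show ?thesis
    using marked_insert_chunks[OF marked_7_8, of "m - p - 6" "p - 1"] assms by simp
qed

text \<open>Two marks per vertex and no loops keep \<open>2 * m - n\<close> constant, so there is
  one seed for each value from 1 to 6. The bounds on \<open>m\<close> are strict because at least
  one fixed point has to be inserted.\<close>

lemma runged_near_double:
  "m > 7 \<Longrightarrow> runged m (2 * m - 1)" "m > 7 \<Longrightarrow> runged m (2 * m - 2)" "m > 8 \<Longrightarrow> runged m (2 * m - 3)"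
  "m > 9 \<Longrightarrow> runged m (2 * m - 4)" "m > 10 \<Longrightarrow> runged m (2 * m - 5)" "m > 11 \<Longrightarrow> runged m (2 * m - 6)"
proof -
  have chunk: "runged m (2 * m - c)" if "marked k (2 * k - c) 2" "m > k" "c \<le> 2 * k" for k c m
  proof -
    have "k + 0 + (m - k) = m" "2 * k - c + 2 * (2 * 0 + (m - k)) = 2 * m - c" using that(2,3) by simp_all
    then show ?thesis using marked_insert_chunks[OF that(1), of "m - k" 0] that(2) by simp
  qed
  show "m > 7 \<Longrightarrow> runged m (2 * m - 1)" "m > 7 \<Longrightarrow> runged m (2 * m - 2)" "m > 8 \<Longrightarrow> runged m (2 * m - 3)"
    "m > 9 \<Longrightarrow> runged m (2 * m - 4)" "m > 10 \<Longrightarrow> runged m (2 * m - 5)" "m > 11 \<Longrightarrow> runged m (2 * m - 6)"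
    using chunk[of 7 1] chunk[of 7 2] chunk[of 8 3] chunk[of 9 4] chunk[of 10 5] chunk[of 11 6]
      marked_7_13 marked_7_12 marked_8_13 marked_9_14 marked_10_15 marked_11_16 by simp_all
qed

text \<open>In the window \<open>m \<le> n < 2 * m\<close> the family near the diagonal reaches
  \<open>n - m = m - 7\<close>. What remains are the values of \<open>n\<close> with
  \<open>2 * m - n\<close> between 1 and 6.\<close>

lemma runged_ge_9:
  assumes m: "m \<ge> 9" and n: "n \<ge> m" shows "runged m n"
proof (rule runged_window[where a = m])
  fix n assume n: "m \<le> n" "n < m + m"
  consider "n = m" | "n - m \<ge> 1" "m \<ge> n - m + 7" | "m < n - m + 7" using n by linarith
  then show "runged m n"
  proof cases
    case 1
    then show ?thesis using runged_diagonal m by simp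
  next
    case 2
    then show ?thesis using runged_near_diagonal[of "n - m" m] n by simp
  next
    case 3
    define q where "q = 2 * m - n"
    have q: "n = 2 * m - q" "1 \<le> q" "q \<le> 6" using 3 n by (simp_all add: q_def)
    \<comment> \<open>At \<open>m = 9\<close> the seed itself is taken, since
      \<open>runged_near_double\<close> begins one step beyond it. Below, the differences 5 and 6
      have similar exceptions up to \<open>m = 11\<close>, some of them with tables of their
      own.\<close>
    have R4: "runged m (2 * m - 4)" using m runged_near_double(4) marked_9_14[THEN marked_imp_runged] by (cases "m = 9") auto
    consider "q = 1" | "q = 2" | "q = 3" | "q = 4" | "q = 5" | "q = 6" using q by linarith
    then show ?thesis
    proof cases
      case 5
      consider "m = 9" | "m = 10" | "m > 10" using m by linarith
      then show ?thesis
        unfolding q(1) 5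
        by cases (simp_all add: runged_9_13 marked_10_15[THEN marked_imp_runged] runged_near_double(5))
    next
      case 6
      consider "m = 9" | "m = 10" | "m = 11" | "m > 11" using m by linarith
      then show ?thesis
        unfolding q(1) 6
        by cases (simp_all add: runged_9_12 runged_10_14 marked_11_16[THEN marked_imp_runged] runged_near_double(6))
    qed (use R4 runged_near_double(1-3)[of m] m in \<open>simp_all add: q(1)\<close>)
  qed
qed (use m n in auto)

lemma runged_4: assumes "n \<ge> 12" shows "runged 4 n"
proof (rule runged_window[OF _ _ assms])
  fix n :: nat assume "12 \<le> n" "n < 12 + 4"
  then have "n = 12 \<or> n = 13 \<or> n = 14 \<or> n = 15" by linarith
  then show "runged 4 n" using runged_4_12 runged_4_13 runged_4_14 runged_4_15 by auto
qed simp

lemma runged_5: assumes "n \<ge> 9" shows "runged 5 n"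
proof (rule runged_window[OF _ _ assms])
  fix n :: nat assume "9 \<le> n" "n < 9 + 5"
  then have "n = 9 \<or> n = 10 \<or> n = 11 \<or> n = 12 \<or> n = 13" by linarith
  then show "runged 5 n" using runged_5_9 runged_5_10 runged_5_11 runged_5_12 runged_5_13 by auto
qed simp

lemma runged_6: assumes "n \<ge> 10" shows "runged 6 n"
proof (rule runged_window[OF _ _ assms])
  fix n :: nat assume "10 \<le> n" "n < 10 + 6"
  then have "n = 10 \<or> n = 11 \<or> n = 12 \<or> n = 13 \<or> n = 14 \<or> n = 15" by linarith
  then show "runged 6 n"
    using runged_6_10 runged_6_11 runged_6_12 runged_6_13 runged_6_14 runged_6_15 by auto
qed simp

lemma runged_7: assumes "n \<ge> 8" shows "runged 7 n"
proof (rule runged_window[OF _ _ assms])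
  fix n :: nat assume "8 \<le> n" "n < 8 + 7"
  then have "n = 8 \<or> n = 9 \<or> n = 10 \<or> n = 11 \<or> n = 12 \<or> n = 13 \<or> n = 14" by linarith
  then show "runged 7 n"
    using marked_7_8[THEN marked_imp_runged] runged_7_9 runged_7_10 runged_7_11
      marked_7_12[THEN marked_imp_runged] marked_7_13[THEN marked_imp_runged] runged_7_14 by auto
qed simp

text \<open>Type 8, 11 only has a certificate without a rung, so no ladder can start from it. The
  value 19, which would be \<open>11 + 8\<close>, therefore has a separate table.\<close>

lemma runged_8: assumes "n \<ge> 8" "n \<noteq> 11" shows "runged 8 n"
proof -
  have small: "runged 8 8" "runged 8 9" "runged 8 10"
    using marked_8_8[THEN marked_imp_runged] marked_8_10[THEN marked_imp_runged]
      runged_near_diagonal[of 1 8] by simp_all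
  have large: "runged 8 n" if "n \<ge> 12" for n
  proof (rule runged_window[OF _ _ that])
    fix n :: nat assume "12 \<le> n" "n < 12 + 8"
    then have "n = 12 \<or> n = 13 \<or> n = 14 \<or> n = 15 \<or> n = 8 + 8 \<or> n = 9 + 8 \<or> n = 10 + 8 \<or> n = 19" by linarith
    then show "runged 8 n"
      using runged_8_12 marked_8_13[THEN marked_imp_runged] runged_near_double(1,2)[of 8]
        small[THEN runged_add_cell] runged_8_19 by (elim disjE) simp_all
  qed simp
  have "n = 8 \<or> n = 9 \<or> n = 10 \<or> n \<ge> 12" using assms by linarith
  then show ?thesis using small large by auto
qed

lemma hyperbolic_cases:
  fixes m n :: nat
  assumes "m \<ge> 2" "m \<le> n" "1 / real m + 1 / real n < 1 / 2"
  shows "m \<ge> 3" "m = 3 \<Longrightarrow> n \<ge> 7" "m = 4 \<Longrightarrow> n \<ge> 5"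
proof -
  have n: "n > 0" using assms by simp
  have "m \<noteq> 2" using assms(3) by auto
  then show "m \<ge> 3" using assms(1) by simp
  have "2 * (real n + real m) < real m * real n"
    using assms n by (simp add: field_simps)
  then have h: "2 * (n + m) < m * n" proof -
    have "real (2 * (n + m)) < real (m * n)" using \<open>2 * (real n + real m) < real m * real n\<close> by simp
    then show ?thesis by (simp only: of_nat_less_iff)
  qed
  show "n \<ge> 7" if "m = 3" using h that by simp
  show "n \<ge> 5" if "m = 4" using h that by simp
qed

lemma chiral_alternating_hyperbolic_le:
  fixes m n :: nat
  assumes "m \<ge> 2" "m \<le> n" "1 / real m + 1 / real n < 1 / 2"
  shows "chiral_alternating m n"
proof -
  note hyp = hyperbolic_cases[OF assms]
  note R = chiral_alternating_of_runged'
  consider "m = 3" | "m = 4" | "m = 5" | "m = 6" | "m = 7" | "m = 8" | "m \<ge> 9" using hyp(1) by linarith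
  then show ?thesis
  proof cases
    case 1
    have "n \<ge> 7" using hyp(2)[OF 1] .
    then have "n = 7 \<or> n = 8 \<or> n = 9 \<or> n = 10 \<or> n \<ge> 11" by linarith
    moreover have "n = 11 \<or> n = 12 \<or> n = 13 \<or> n = 14 \<or> n \<ge> 15" if "n \<ge> 11" using that by linarith
    moreover have "n = 15 \<or> n = 16 \<or> n = 17 \<or> n \<ge> 18" if "n \<ge> 15" using that by linarith
    moreover have "chiral_alternating 3 n" if "n \<ge> 18"
      using that by (intro chiral_alternating_of_triangular triangular_ge_18)
    ultimately show ?thesis
      unfolding 1 using chiral_alternating_3_7 chiral_alternating_3_8 chiral_alternating_3_9 chiral_alternating_3_10
        chiral_alternating_3_11 chiral_alternating_3_12 chiral_alternating_3_13 chiral_alternating_3_14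
        chiral_alternating_3_15 chiral_alternating_3_16 chiral_alternating_3_17 by blast
  next
    case 2
    have "n \<ge> 5" using hyp(3)[OF 2] .
    then have "n = 5 \<or> n = 6 \<or> n = 7 \<or> n \<ge> 8" by linarith
    moreover have "n = 8 \<or> n = 9 \<or> n = 10 \<or> n = 11 \<or> n \<ge> 12" if "n \<ge> 8" using that by linarith
    moreover have "chiral_alternating 4 n" if "n \<ge> 12" using that by (intro R runged_4)
    ultimately show ?thesis
      unfolding 2 using chiral_alternating_4_5 chiral_alternating_4_6 chiral_alternating_4_7 chiral_alternating_4_8
        chiral_alternating_4_9 chiral_alternating_4_10 chiral_alternating_4_11 by blast
  next
    case 3
    then have "n = 5 \<or> n = 6 \<or> n = 7 \<or> n = 8 \<or> n \<ge> 9" using assms(2) by linarith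
    moreover have "chiral_alternating 5 n" if "n \<ge> 9" using that by (intro R runged_5)
    ultimately show ?thesis
      unfolding 3 using chiral_alternating_5_5 chiral_alternating_5_6 chiral_alternating_5_7 chiral_alternating_5_8
      by blast
  next
    case 4
    then have "n = 6 \<or> n = 7 \<or> n = 8 \<or> n = 9 \<or> n \<ge> 10" using assms(2) by linarith
    moreover have "chiral_alternating 6 n" if "n \<ge> 10" using that by (intro R runged_6)
    ultimately show ?thesis
      unfolding 4 using chiral_alternating_6_6 chiral_alternating_6_7 chiral_alternating_6_8 chiral_alternating_6_9
      by blast
  next
    case 5
    then have "n = 7 \<or> n \<ge> 8" using assms(2) by linarith
    moreover have "chiral_alternating 7 n" if "n \<ge> 8" using that by (intro R runged_7)
    ultimately show ?thesis unfolding 5 using chiral_alternating_7_7 by blast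
  next
    case 6
    then have "n \<ge> 8" using assms(2) by simp
    then have "chiral_alternating 8 n" if "n \<noteq> 11" using that by (intro R runged_8)
    then show ?thesis unfolding 6 using chiral_alternating_8_11 by blast
  next
    case 7
    then show ?thesis using assms(2) by (intro R runged_ge_9)
  qed
qed

theorem theorem1p1:
  fixes m n :: nat
  assumes "m \<ge> 2" and "n \<ge> 2"
    and "1 / real m + 1 / real n < 1 / 2"
  shows "\<exists>(M :: nat oriented_map) k.
           chiral M \<and> has_type M m n \<and> rotation_group M \<cong> alt_group k"
proof -
  have "chiral_alternating m n"
  proof (cases "m \<le> n")
    case True
    then show ?thesis using assms(1,3) by (intro chiral_alternating_hyperbolic_le)
  next
    case False
    then have "n \<le> m" by simp
    moreover have "1 / real n + 1 / real m < 1 / 2" using assms(3) by linarith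
    ultimately have "chiral_alternating n m" using assms(2) by (intro chiral_alternating_hyperbolic_le)
    then show ?thesis by (rule chiral_alternating_sym)
  qed
  then show ?thesis by (rule ex_chiral_map_of_chiral_alternating)
qed

end
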